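(* Let $u\colon R\to U$ be an epimorphism of associative rings such that $U$ is a flat left $R$-module. Let $\mathbb G$ be the related perfect Gabriel topology of right ideals in $R$, that is, $\mathbb G=\{I\subset R \text{ a right ideal}: R/I\otimes_R U=0\}$. Assume that $\mathbb G$ has a countable base. Then the projective dimension of the left $R$-module $U$ does not exceed $1$.
   Context: Rings are associative and unital. A ring epimorphism is an epimorphism in the category of associative rings. A base of $\mathbb G$ is a subset $\mathbb B\subset\mathbb G$ such that every right ideal in $\mathbb G$ contains a right ideal belonging to $\mathbb B$. *)

theory Defs
  imports "HOL-Algebra.Algebra" "HOL-Library.Extended_Nat"
begin

section \<open>Modules over a noncommutative ring\<close>

text \<open>The locale \<^locale>\<open>module\<close> of the library requires a commutative ring of scalars, so
  one-sided modules are introduced here, on the library's record type.  As there, the multiplicative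
  fields of the record play no role.\<close>

locale left_module = R?: ring R + M?: abelian_group M
  for R :: "('a, 's) ring_scheme" (structure) and M :: "('a, 'b, 'm) module_scheme" (structure) +
  assumes lsmult_closed [simp, intro]:
      "\<lbrakk>a \<in> carrier R; x \<in> carrier M\<rbrakk> \<Longrightarrow> a \<odot>\<^bsub>M\<^esub> x \<in> carrier M"
    and lsmult_l_distr:
      "\<lbrakk>a \<in> carrier R; b \<in> carrier R; x \<in> carrier M\<rbrakk> \<Longrightarrow>
        (a \<oplus>\<^bsub>R\<^esub> b) \<odot>\<^bsub>M\<^esub> x = a \<odot>\<^bsub>M\<^esub> x \<oplus>\<^bsub>M\<^esub> b \<odot>\<^bsub>M\<^esub> x"
    and lsmult_r_distr:
      "\<lbrakk>a \<in> carrier R; x \<in> carrier M; y \<in> carrier M\<rbrakk> \<Longrightarrow>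
        a \<odot>\<^bsub>M\<^esub> (x \<oplus>\<^bsub>M\<^esub> y) = a \<odot>\<^bsub>M\<^esub> x \<oplus>\<^bsub>M\<^esub> a \<odot>\<^bsub>M\<^esub> y"
    and lsmult_assoc:
      "\<lbrakk>a \<in> carrier R; b \<in> carrier R; x \<in> carrier M\<rbrakk> \<Longrightarrow>
        (a \<otimes>\<^bsub>R\<^esub> b) \<odot>\<^bsub>M\<^esub> x = a \<odot>\<^bsub>M\<^esub> (b \<odot>\<^bsub>M\<^esub> x)"
    and lsmult_one [simp]:
      "x \<in> carrier M \<Longrightarrow> \<one>\<^bsub>R\<^esub> \<odot>\<^bsub>M\<^esub> x = x"

text \<open>In a right module, the scalar still stands on the left of the symbol:
  \<open>a \<odot>\<^bsub>M\<^esub> x\<close> denotes the element \<open>x a\<close>.\<close>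

locale right_module = R?: ring R + M?: abelian_group M
  for R :: "('a, 's) ring_scheme" (structure) and M :: "('a, 'b, 'm) module_scheme" (structure) +
  assumes rsmult_closed [simp, intro]:
      "\<lbrakk>a \<in> carrier R; x \<in> carrier M\<rbrakk> \<Longrightarrow> a \<odot>\<^bsub>M\<^esub> x \<in> carrier M"
    and rsmult_l_distr:
      "\<lbrakk>a \<in> carrier R; b \<in> carrier R; x \<in> carrier M\<rbrakk> \<Longrightarrow>
        (a \<oplus>\<^bsub>R\<^esub> b) \<odot>\<^bsub>M\<^esub> x = a \<odot>\<^bsub>M\<^esub> x \<oplus>\<^bsub>M\<^esub> b \<odot>\<^bsub>M\<^esub> x"
    and rsmult_r_distr:
      "\<lbrakk>a \<in> carrier R; x \<in> carrier M; y \<in> carrier M\<rbrakk> \<Longrightarrow>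
        a \<odot>\<^bsub>M\<^esub> (x \<oplus>\<^bsub>M\<^esub> y) = a \<odot>\<^bsub>M\<^esub> x \<oplus>\<^bsub>M\<^esub> a \<odot>\<^bsub>M\<^esub> y"
    and rsmult_assoc:
      "\<lbrakk>a \<in> carrier R; b \<in> carrier R; x \<in> carrier M\<rbrakk> \<Longrightarrow>
        (a \<otimes>\<^bsub>R\<^esub> b) \<odot>\<^bsub>M\<^esub> x = b \<odot>\<^bsub>M\<^esub> (a \<odot>\<^bsub>M\<^esub> x)"
    and rsmult_one [simp]:
      "x \<in> carrier M \<Longrightarrow> \<one>\<^bsub>R\<^esub> \<odot>\<^bsub>M\<^esub> x = x"

definition mod_hom ::
  "('r, 's) ring_scheme \<Rightarrow> ('r, 'a, 'm) module_scheme \<Rightarrow> ('r, 'b, 'n) module_scheme \<Rightarrow> ('a \<Rightarrow> 'b) set"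
  where "mod_hom R M N = {h \<in> carrier M \<rightarrow> carrier N.
    (\<forall>x\<in>carrier M. \<forall>y\<in>carrier M. h (x \<oplus>\<^bsub>M\<^esub> y) = h x \<oplus>\<^bsub>N\<^esub> h y) \<and>
    (\<forall>a\<in>carrier R. \<forall>x\<in>carrier M. h (a \<odot>\<^bsub>M\<^esub> x) = a \<odot>\<^bsub>N\<^esub> h x)}"

definition restrict_scalars ::
  "('u, 't) ring_scheme \<Rightarrow> ('r \<Rightarrow> 'u) \<Rightarrow> ('r, 'u) module"
  where "restrict_scalars U u = \<lparr>carrier = carrier U, monoid.mult = (\<otimes>\<^bsub>U\<^esub>), one = \<one>\<^bsub>U\<^esub>,
    ring.zero = \<zero>\<^bsub>U\<^esub>, add = (\<oplus>\<^bsub>U\<^esub>), smult = (\<lambda>r x. u r \<otimes>\<^bsub>U\<^esub> x)\<rparr>"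

definition right_ideal :: "('r, 's) ring_scheme \<Rightarrow> 'r set \<Rightarrow> bool"
  where "right_ideal R I \<longleftrightarrow> additive_subgroup I R \<and>
    (\<forall>x\<in>I. \<forall>a\<in>carrier R. x \<otimes>\<^bsub>R\<^esub> a \<in> I)"

definition right_quotient :: "('r, 's) ring_scheme \<Rightarrow> 'r set \<Rightarrow> ('r, 'r set) module"
  where "right_quotient R I = \<lparr>carrier = a_rcosets\<^bsub>R\<^esub> I, monoid.mult = undefined, one = undefined,
    ring.zero = I, add = set_add R, smult = (\<lambda>a C. \<Union>x\<in>C. I +>\<^bsub>R\<^esub> (x \<otimes>\<^bsub>R\<^esub> a))\<rparr>"

section \<open>Tensor products\<close>

text \<open>The tensor product of a right module \<open>A\<close> and a left module \<open>M\<close> is the free abelian group on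
  \<open>carrier A \<times> carrier M\<close> modulo the subgroup generated by the usual three families of relators.
  It is a group in multiplicative notation.\<close>

definition tensor_relators ::
  "('r, 's) ring_scheme \<Rightarrow> ('r, 'a, 'm) module_scheme \<Rightarrow> ('r, 'b, 'n) module_scheme
    \<Rightarrow> ('a \<times> 'b \<Rightarrow>\<^sub>0 int) set"
  where "tensor_relators R A M =
    {frag_of (x \<oplus>\<^bsub>A\<^esub> y, v) - frag_of (x, v) - frag_of (y, v) | x y v.
       x \<in> carrier A \<and> y \<in> carrier A \<and> v \<in> carrier M} \<union>
    {frag_of (x, v \<oplus>\<^bsub>M\<^esub> w) - frag_of (x, v) - frag_of (x, w) | x v w.
       x \<in> carrier A \<and> v \<in> carrier M \<and> w \<in> carrier M} \<union>
    {frag_of (a \<odot>\<^bsub>A\<^esub> x, v) - frag_of (x, a \<odot>\<^bsub>M\<^esub> v) | a x v.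
       a \<in> carrier R \<and> x \<in> carrier A \<and> v \<in> carrier M}"

definition tensor_kernel ::
  "('r, 's) ring_scheme \<Rightarrow> ('r, 'a, 'm) module_scheme \<Rightarrow> ('r, 'b, 'n) module_scheme
    \<Rightarrow> ('a \<times> 'b \<Rightarrow>\<^sub>0 int) set"
  where "tensor_kernel R A M =
    generate (free_Abelian_group (carrier A \<times> carrier M)) (tensor_relators R A M)"

definition tensor_prod ::
  "('r, 's) ring_scheme \<Rightarrow> ('r, 'a, 'm) module_scheme \<Rightarrow> ('r, 'b, 'n) module_scheme
    \<Rightarrow> ('a \<times> 'b \<Rightarrow>\<^sub>0 int) set monoid"
  where "tensor_prod R A M =
    free_Abelian_group (carrier A \<times> carrier M) Mod tensor_kernel R A M"

definition tensor_push :: "('a \<Rightarrow> 'b) \<Rightarrow> ('a \<times> 'c \<Rightarrow>\<^sub>0 int) \<Rightarrow> ('b \<times> 'c \<Rightarrow>\<^sub>0 int)"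
  where "tensor_push f = frag_extend (\<lambda>(x, v). frag_of (f x, v))"

text \<open>The map \<open>f \<otimes> id\<close> from \<open>tensor_prod R A M\<close> to \<open>tensor_prod R B M\<close>, for \<open>f\<close> in
  \<open>mod_hom R A B\<close>.\<close>

definition tensor_map ::
  "('r, 's) ring_scheme \<Rightarrow> ('r, 'a, 'm) module_scheme \<Rightarrow> ('r, 'b, 'n) module_scheme
    \<Rightarrow> ('r, 'c, 'k) module_scheme \<Rightarrow> ('a \<Rightarrow> 'b) \<Rightarrow> ('a \<times> 'c \<Rightarrow>\<^sub>0 int) set \<Rightarrow> ('b \<times> 'c \<Rightarrow>\<^sub>0 int) set"
  where "tensor_map R A B M f C =
    (\<Union>z\<in>C. tensor_kernel R B M #>\<^bsub>free_Abelian_group (carrier B \<times> carrier M)\<^esub> tensor_push f z)"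

section \<open>Flat modules, projective modules, projective dimension, ring epimorphisms\<close>

text \<open>A formula cannot quantify over types, so each universal property below quantifies over test
  objects on one fixed type.  That type is large enough for the property to hold for test objects
  on every type: this is proved below as \<open>flat_left_module_inj\<close>, \<open>projective_module_lift\<close> and
  \<open>ring_epimorphism_cancel\<close>.\<close>

definition flat_left_module :: "('r, 's) ring_scheme \<Rightarrow> ('r, 'c, 'k) module_scheme \<Rightarrow> bool"
  where "flat_left_module R M \<longleftrightarrow> left_module R M \<and>
    (\<forall>(A :: ('r, 'r list) module) (B :: ('r, 'r list) module) f.
      right_module R A \<and> right_module R B \<and> f \<in> mod_hom R A B \<and> inj_on f (carrier A) \<longrightarrow>
      inj_on (tensor_map R A B M f) (carrier (tensor_prod R A M)))"

definition projective_module :: "('r, 's) ring_scheme \<Rightarrow> ('r, 'p) module \<Rightarrow> bool"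
  where "projective_module R P \<longleftrightarrow> left_module R P \<and>
    (\<forall>(M :: ('r, 'p \<Rightarrow> 'r) module) (N :: ('r, 'p) module) f g.
      left_module R M \<and> left_module R N \<and> f \<in> mod_hom R M N \<and> f ` carrier M = carrier N \<and>
      g \<in> mod_hom R P N \<longrightarrow>
      (\<exists>h\<in>mod_hom R P M. \<forall>x\<in>carrier P. f (h x) = g x))"

text \<open>A projective resolution \<open>0 \<rightarrow> P\<^sub>n \<rightarrow> \<dots> \<rightarrow> P\<^sub>0 \<rightarrow> M \<rightarrow> 0\<close>.  The common carrier type is chosen to
  have at least \<open>max(|R|, |M|, \<aleph>\<^sub>0)\<close> elements (unless \<open>R\<close> is the zero ring), which is enough room for
  free modules on generating sets of \<open>M\<close> and of the successive syzygies.\<close>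

definition has_projective_resolution ::
  "('r, 's) ring_scheme \<Rightarrow> ('r, 'c, 'k) module_scheme \<Rightarrow> nat \<Rightarrow> bool"
  where "has_projective_resolution R M n \<longleftrightarrow>
    (\<exists>(P :: nat \<Rightarrow> ('r, 'c \<times> nat \<Rightarrow> 'r) module) d e.
      (\<forall>i. projective_module R (P i)) \<and>
      (\<forall>i>n. carrier (P i) = {\<zero>\<^bsub>P i\<^esub>}) \<and>
      e \<in> mod_hom R (P 0) M \<and> e ` carrier (P 0) = carrier M \<and>
      (\<forall>i. d i \<in> mod_hom R (P (Suc i)) (P i)) \<and>
      d 0 ` carrier (P (Suc 0)) = a_kernel (P 0) M e \<and>
      (\<forall>i. d (Suc i) ` carrier (P (Suc (Suc i))) = a_kernel (P (Suc i)) (P i) (d i)))"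

definition projective_dimension ::
  "('r, 's) ring_scheme \<Rightarrow> ('r, 'c, 'k) module_scheme \<Rightarrow> enat"
  where "projective_dimension R M = (INF n\<in>{n. has_projective_resolution R M n}. enat n)"

definition ring_epimorphism ::
  "('r, 's) ring_scheme \<Rightarrow> ('u, 't) ring_scheme \<Rightarrow> ('r \<Rightarrow> 'u) \<Rightarrow> bool"
  where "ring_epimorphism R U u \<longleftrightarrow> ring R \<and> ring U \<and> u \<in> ring_hom R U \<and>
    (\<forall>(S :: ('u + 'u) list list ring) f g.
      ring S \<and> f \<in> ring_hom U S \<and> g \<in> ring_hom U S \<and> (\<forall>r\<in>carrier R. f (u r) = g (u r)) \<longrightarrow>
      (\<forall>x\<in>carrier U. f x = g x))"

section \<open>The perfect Gabriel topology of a ring epimorphism\<close>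

definition gabriel_topology ::
  "('r, 's) ring_scheme \<Rightarrow> ('u, 't) ring_scheme \<Rightarrow> ('r \<Rightarrow> 'u) \<Rightarrow> 'r set set"
  where "gabriel_topology R U u = {I. right_ideal R I \<and>
    (let T = tensor_prod R (right_quotient R I) (restrict_scalars U u) in carrier T = {\<one>\<^bsub>T\<^esub>})}"

definition topology_base :: "'r set set \<Rightarrow> 'r set set \<Rightarrow> bool"
  where "topology_base G B \<longleftrightarrow> B \<subseteq> G \<and> (\<forall>I\<in>G. \<exists>J\<in>B. J \<subseteq> I)"

section \<open>Independence of the types of the test objects\<close>

subsection \<open>Ring epimorphisms\<close>

text \<open>The subring generated by the images of \<open>f\<close> and \<open>g\<close> consists of sums of words in two copies
  of \<open>carrier U\<close>.\<close>

lemma ring_epimorphism_cancel: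
  fixes R :: "('r, 's) ring_scheme" and U :: "('u, 't) ring_scheme" and S :: "('a, 'k) ring_scheme"
  assumes epi: "ring_epimorphism R U u"
    and S: "ring S" and f: "f \<in> ring_hom U S" and g: "g \<in> ring_hom U S"
    and fg: "\<And>r. r \<in> carrier R \<Longrightarrow> f (u r) = g (u r)"
    and x: "x \<in> carrier U"
  shows "f x = g x"
proof -
  interpret S: ring S by (rule S)
  interpret U: ring U using epi by (simp add: ring_epimorphism_def)
  define letter where "letter = case_sum f g"
  define word where "word = (\<lambda>w. foldr (\<lambda>l y. letter l \<otimes>\<^bsub>S\<^esub> y) w \<one>\<^bsub>S\<^esub>)"
  define val where "val = (\<lambda>ws. foldr (\<lambda>w y. word w \<oplus>\<^bsub>S\<^esub> y) ws \<zero>\<^bsub>S\<^esub>)"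
  define L where "L = Inl ` carrier U \<union> Inr ` carrier U"
  define W where "W = lists (lists L)"
  define T where "T = val ` W"
  have letter_closed: "letter l \<in> carrier S" if "l \<in> L" for l
    using that f g by (auto simp: L_def letter_def ring_hom_closed)
  have word_simps [simp]: "word [] = \<one>\<^bsub>S\<^esub>" "word (l # w) = letter l \<otimes>\<^bsub>S\<^esub> word w" for l w
    by (simp_all add: word_def)
  have val_simps [simp]: "val [] = \<zero>\<^bsub>S\<^esub>" "val (w # ws) = word w \<oplus>\<^bsub>S\<^esub> val ws" for w ws
    by (simp_all add: val_def)
  have word_closed: "word w \<in> carrier S" if "w \<in> lists L" for w
    using that by (induction w) (auto simp: letter_closed)
  have val_closed: "val ws \<in> carrier S" if "ws \<in> W" for ws
    using that unfolding W_def by (induction ws) (auto simp: word_closed)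
  have word_append: "word (v @ w) = word v \<otimes>\<^bsub>S\<^esub> word w" if "v \<in> lists L" "w \<in> lists L" for v w
    using that by (induction v) (auto simp: letter_closed word_closed S.m_assoc)
  have val_append: "val (vs @ ws) = val vs \<oplus>\<^bsub>S\<^esub> val ws" if "vs \<in> W" "ws \<in> W" for vs ws
    using that(1) unfolding W_def
    by (induction vs) (use that(2) in \<open>auto simp: word_closed val_closed S.a_assoc W_def\<close>)
  have val_word_mult: "val (map ((@) v) ws) = word v \<otimes>\<^bsub>S\<^esub> val ws \<and> map ((@) v) ws \<in> W"
    if "v \<in> lists L" "ws \<in> W" for v ws
    using that(2) unfolding W_def
  proof (induction ws)
    case Nil
    then show ?case using that(1) by (simp add: word_closed)
  next
    case (Cons w ws)
    then show ?case using that(1)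
      by (auto simp: word_append word_closed val_closed W_def S.r_distr)
  qed
  have T_mult: "val vs \<otimes>\<^bsub>S\<^esub> val ws \<in> T" if "vs \<in> W" "ws \<in> W" for vs ws
    using that(1) unfolding W_def
  proof (induction vs)
    case Nil
    have "val [] \<in> T" unfolding T_def W_def by blast
    then show ?case using that(2) by (simp add: val_closed)
  next
    case (Cons v vs)
    then obtain zs where zs: "zs \<in> W" "val vs \<otimes>\<^bsub>S\<^esub> val ws = val zs" unfolding T_def by auto
    have "val (v # vs) \<otimes>\<^bsub>S\<^esub> val ws = word v \<otimes>\<^bsub>S\<^esub> val ws \<oplus>\<^bsub>S\<^esub> val vs \<otimes>\<^bsub>S\<^esub> val ws"
      using Cons that(2) by (simp add: S.l_distr word_closed val_closed W_def)
    also have "\<dots> = val (map ((@) v) ws @ zs)"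
      using val_word_mult[of v ws] zs that(2) Cons by (simp add: val_append)
    finally show ?case
      using val_word_mult[of v ws] zs that(2) Cons by (auto simp: T_def W_def)
  qed
  have hom_neg: "h (\<ominus>\<^bsub>U\<^esub> y) = \<ominus>\<^bsub>S\<^esub> h y" if "h \<in> ring_hom U S" "y \<in> carrier U" for h y
  proof -
    interpret h: ring_hom_ring U S h
      by (rule ring_hom_ringI2) (use that S U.ring_axioms in auto)
    show ?thesis using that by simp
  qed
  have letter_neg: "\<exists>l'\<in>L. letter l' = \<ominus>\<^bsub>S\<^esub> letter l" if "l \<in> L" for l
  proof -
    from that consider y where "l = Inl y" "y \<in> carrier U" | y where "l = Inr y" "y \<in> carrier U"
      by (auto simp: L_def)
    then show ?thesis
    proof cases
      case 1
      then have "Inl (\<ominus>\<^bsub>U\<^esub> y) \<in> L" "letter (Inl (\<ominus>\<^bsub>U\<^esub> y)) = \<ominus>\<^bsub>S\<^esub> letter l"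
        using hom_neg[OF f] by (auto simp: L_def letter_def)
      then show ?thesis by blast
    next
      case 2
      then have "Inr (\<ominus>\<^bsub>U\<^esub> y) \<in> L" "letter (Inr (\<ominus>\<^bsub>U\<^esub> y)) = \<ominus>\<^bsub>S\<^esub> letter l"
        using hom_neg[OF g] by (auto simp: L_def letter_def)
      then show ?thesis by blast
    qed
  qed
  have word_neg: "\<exists>w'\<in>lists L. word w' = \<ominus>\<^bsub>S\<^esub> word w" if "w \<in> lists L" for w
  proof (cases w)
    case Nil
    have one: "Inl \<one>\<^bsub>U\<^esub> \<in> L" "letter (Inl \<one>\<^bsub>U\<^esub>) = \<one>\<^bsub>S\<^esub>"
      using ring_hom_one[OF f] by (auto simp: L_def letter_def)
    then obtain l' where "l' \<in> L" "letter l' = \<ominus>\<^bsub>S\<^esub> \<one>\<^bsub>S\<^esub>" using letter_neg by metis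
    then have "[l'] \<in> lists L" "word [l'] = \<ominus>\<^bsub>S\<^esub> word w" using Nil by auto
    then show ?thesis by blast
  next
    case (Cons l v)
    with that have "l \<in> L" by simp
    then obtain l' where l': "l' \<in> L" "letter l' = \<ominus>\<^bsub>S\<^esub> letter l" using letter_neg by blast
    then have "l' # v \<in> lists L" "word (l' # v) = \<ominus>\<^bsub>S\<^esub> word w"
      using Cons that by (auto simp: letter_closed word_closed S.l_minus)
    then show ?thesis by blast
  qed
  have T_neg: "\<ominus>\<^bsub>S\<^esub> val ws \<in> T" if "ws \<in> W" for ws
    using that unfolding W_def
  proof (induction ws)
    case Nil
    have "val [] \<in> T" unfolding T_def W_def by blast
    then show ?case by simp
  next
    case (Cons w ws)
    then obtain zs w' where zs: "zs \<in> W" "\<ominus>\<^bsub>S\<^esub> val ws = val zs"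
      and w': "w' \<in> lists L" "word w' = \<ominus>\<^bsub>S\<^esub> word w"
      using word_neg unfolding T_def by force
    then have "\<ominus>\<^bsub>S\<^esub> val (w # ws) = val (w' # zs)"
      using Cons by (simp add: S.minus_add word_closed val_closed W_def)
    then show ?case using w'(1) zs(1) unfolding T_def W_def
      by (metis imageI lists.Cons)
  qed
  have "val [[]] = \<one>\<^bsub>S\<^esub>" "[[]] \<in> W" by (auto simp: W_def)
  then have T_one: "\<one>\<^bsub>S\<^esub> \<in> T" unfolding T_def by (metis imageI)
  have T_add: "a \<oplus>\<^bsub>S\<^esub> b \<in> T" if "a \<in> T" "b \<in> T" for a b
  proof -
    from that obtain vs ws where *: "a = val vs" "b = val ws" "vs \<in> W" "ws \<in> W"
      unfolding T_def by blast
    then have "a \<oplus>\<^bsub>S\<^esub> b = val (vs @ ws)" "vs @ ws \<in> W" using val_append by (auto simp: W_def)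
    then show ?thesis unfolding T_def by blast
  qed
  have sub: "subring T S"
    by (rule S.subringI) (use T_one T_add T_mult T_neg val_closed in \<open>auto simp: T_def\<close>)
  define S' where "S' = S\<lparr>carrier := T\<rparr>"
  interpret S': ring S' unfolding S'_def by (rule S.subring_is_ring[OF sub])
  define \<theta> where "\<theta> = inv_into W val"
  have inj: "inj_on \<theta> (carrier S')"
    unfolding \<theta>_def S'_def T_def by (simp add: inj_on_inv_into)
  have img: "ring (image_ring \<theta> S')" by (rule S'.inj_imp_image_ring_is_ring[OF inj])
  have \<theta>: "\<theta> \<in> ring_hom S' (image_ring \<theta> S')"
    using inj_imp_image_ring_iso[OF inj] by (simp add: ring_iso_def)
  have "f y \<in> T" "g y \<in> T" if "y \<in> carrier U" for y
  proof -
    have "val [[Inl y]] = f y" "val [[Inr y]] = g y" "[[Inl y]] \<in> W" "[[Inr y]] \<in> W"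
      using that f g by (auto simp: letter_def W_def L_def ring_hom_closed)
    then show "f y \<in> T" "g y \<in> T" unfolding T_def by (metis imageI)+
  qed
  then have "f \<in> ring_hom U S'" "g \<in> ring_hom U S'"
    using f g by (auto simp: ring_hom_def S'_def)
  then have hom: "\<theta> \<circ> f \<in> ring_hom U (image_ring \<theta> S')" "\<theta> \<circ> g \<in> ring_hom U (image_ring \<theta> S')"
    and T': "f x \<in> carrier S'" "g x \<in> carrier S'"
    using \<theta> x by (auto intro: ring_hom_trans ring_hom_closed)
  have eq: "\<forall>r\<in>carrier R. (\<theta> \<circ> f) (u r) = (\<theta> \<circ> g) (u r)" using fg by simp
  have "p x = q x"
    if "ring (C :: ('u + 'u) list list ring)" "p \<in> ring_hom U C" "q \<in> ring_hom U C"
      "\<forall>r\<in>carrier R. p (u r) = q (u r)" for C p q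
    using epi that x unfolding ring_epimorphism_def by blast
  from this[OF img hom eq] have "(\<theta> \<circ> f) x = (\<theta> \<circ> g) x" .
  then show ?thesis using inj T' by (simp add: inj_on_def)
qed

subsection \<open>Projective modules\<close>

lemma mod_homI:
  assumes "\<And>x. x \<in> carrier M \<Longrightarrow> h x \<in> carrier N"
    and "\<And>x y. \<lbrakk>x \<in> carrier M; y \<in> carrier M\<rbrakk> \<Longrightarrow> h (x \<oplus>\<^bsub>M\<^esub> y) = h x \<oplus>\<^bsub>N\<^esub> h y"
    and "\<And>a x. \<lbrakk>a \<in> carrier R; x \<in> carrier M\<rbrakk> \<Longrightarrow> h (a \<odot>\<^bsub>M\<^esub> x) = a \<odot>\<^bsub>N\<^esub> h x"
  shows "h \<in> mod_hom R M N"
  using assms by (auto simp: mod_hom_def)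

lemma mod_homD:
  assumes "h \<in> mod_hom R M N"
  shows "x \<in> carrier M \<Longrightarrow> h x \<in> carrier N"
    and "\<lbrakk>x \<in> carrier M; y \<in> carrier M\<rbrakk> \<Longrightarrow> h (x \<oplus>\<^bsub>M\<^esub> y) = h x \<oplus>\<^bsub>N\<^esub> h y"
    and "\<lbrakk>a \<in> carrier R; x \<in> carrier M\<rbrakk> \<Longrightarrow> h (a \<odot>\<^bsub>M\<^esub> x) = a \<odot>\<^bsub>N\<^esub> h x"
  using assms by (auto simp: mod_hom_def)

lemma mod_hom_comp:
  "\<lbrakk>f \<in> mod_hom R A B; g \<in> mod_hom R B C\<rbrakk> \<Longrightarrow> (\<lambda>x. g (f x)) \<in> mod_hom R A C"
  by (auto simp: mod_hom_def Pi_def)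

lemma mod_hom_zero:
  assumes "abelian_group M" "abelian_group N" "h \<in> mod_hom R M N"
  shows "h \<zero>\<^bsub>M\<^esub> = \<zero>\<^bsub>N\<^esub>"
proof -
  interpret M: abelian_group M by fact
  interpret N: abelian_group N by fact
  have "h \<zero>\<^bsub>M\<^esub> \<oplus>\<^bsub>N\<^esub> h \<zero>\<^bsub>M\<^esub> = h \<zero>\<^bsub>M\<^esub>" "h \<zero>\<^bsub>M\<^esub> \<in> carrier N"
    using mod_homD[OF assms(3)] M.zero_closed M.l_zero by metis+
  then show ?thesis by (metis N.add.r_cancel_one')
qed

lemma mod_hom_finsum:
  assumes "abelian_group M" "abelian_group N" "h \<in> mod_hom R M N"
    and "finite A" "k \<in> A \<rightarrow> carrier M"
  shows "h (finsum M k A) = finsum N (\<lambda>x. h (k x)) A"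
proof -
  interpret M: abelian_group M by fact
  interpret N: abelian_group N by fact
  show ?thesis using assms(4,5)
  proof (induction A)
    case empty
    then show ?case using mod_hom_zero[OF assms(1-3)] by simp
  next
    case (insert a A)
    then have "k \<in> A \<rightarrow> carrier M" "k a \<in> carrier M" by auto
    moreover from this have "(\<lambda>x. h (k x)) \<in> A \<rightarrow> carrier N" "h (k a) \<in> carrier N"
      using mod_homD(1)[OF assms(3)] by auto
    ultimately show ?case using insert mod_homD(2)[OF assms(3)] by (simp add: M.finsum_closed)
  qed
qed

context left_module begin

lemma lsmult_zero [simp]: "x \<in> carrier M \<Longrightarrow> \<zero>\<^bsub>R\<^esub> \<odot>\<^bsub>M\<^esub> x = \<zero>\<^bsub>M\<^esub>"
  by (metis R.l_zero R.zero_closed lsmult_closed lsmult_l_distr M.add.r_cancel_one')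

lemma lsmult_zero_right [simp]: "a \<in> carrier R \<Longrightarrow> a \<odot>\<^bsub>M\<^esub> \<zero>\<^bsub>M\<^esub> = \<zero>\<^bsub>M\<^esub>"
  by (metis M.l_zero M.zero_closed lsmult_closed lsmult_r_distr M.add.r_cancel_one')

lemma lsmult_finsum:
  assumes "a \<in> carrier R" "finite A" "k \<in> A \<rightarrow> carrier M"
  shows "a \<odot>\<^bsub>M\<^esub> finsum M k A = finsum M (\<lambda>x. a \<odot>\<^bsub>M\<^esub> k x) A"
  by (rule mod_hom_finsum[of M M _ "R\<lparr>carrier := {}\<rparr>"])
    (use assms in \<open>auto intro!: mod_homI simp: lsmult_r_distr M.abelian_group_axioms\<close>)

end

definition free_mod :: "('r, 's) ring_scheme \<Rightarrow> 'p set \<Rightarrow> ('r, 'p \<Rightarrow> 'r) module"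
  where "free_mod R Y = \<lparr>carrier = {\<theta>. (\<forall>x. \<theta> x \<in> carrier R) \<and> (\<forall>x. x \<notin> Y \<longrightarrow> \<theta> x = \<zero>\<^bsub>R\<^esub>) \<and>
      finite {x. \<theta> x \<noteq> \<zero>\<^bsub>R\<^esub>}},
    monoid.mult = undefined, one = undefined, ring.zero = (\<lambda>x. \<zero>\<^bsub>R\<^esub>), add = (\<lambda>\<theta> \<psi> x. \<theta> x \<oplus>\<^bsub>R\<^esub> \<psi> x),
    smult = (\<lambda>a \<theta> x. a \<otimes>\<^bsub>R\<^esub> \<theta> x)\<rparr>"

definition free_eval ::
  "('r, 's) ring_scheme \<Rightarrow> ('r, 'b, 'n) module_scheme \<Rightarrow> ('p \<Rightarrow> 'b) \<Rightarrow> ('p \<Rightarrow> 'r) \<Rightarrow> 'b"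
  where "free_eval R M m \<theta> = finsum M (\<lambda>x. \<theta> x \<odot>\<^bsub>M\<^esub> m x) {x. \<theta> x \<noteq> \<zero>\<^bsub>R\<^esub>}"

lemma free_mod_left_module:
  fixes R :: "('r, 's) ring_scheme" and Y :: "'p set"
  assumes "ring R"
  shows "left_module R (free_mod R Y)"
proof -
  interpret R: ring R by fact
  have fin: "finite {x. \<theta> x \<oplus>\<^bsub>R\<^esub> \<psi> x \<noteq> \<zero>\<^bsub>R\<^esub>}"
    if "finite {x. \<theta> x \<noteq> \<zero>\<^bsub>R\<^esub>}" "finite {x. \<psi> x \<noteq> \<zero>\<^bsub>R\<^esub>}" for \<theta> \<psi> :: "'p \<Rightarrow> 'r"
    by (rule finite_subset[OF _ finite_UnI[OF that]]) auto
  have fin_smult: "finite {x. a \<otimes>\<^bsub>R\<^esub> \<theta> x \<noteq> \<zero>\<^bsub>R\<^esub>}"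
    if "finite {x. \<theta> x \<noteq> \<zero>\<^bsub>R\<^esub>}" "a \<in> carrier R" for a and \<theta> :: "'p \<Rightarrow> 'r"
    by (rule finite_subset[OF _ that(1)]) (use that(2) in auto)
  have fin_neg: "finite {x. \<ominus>\<^bsub>R\<^esub> \<theta> x \<noteq> \<zero>\<^bsub>R\<^esub>}"
    if "finite {x. \<theta> x \<noteq> \<zero>\<^bsub>R\<^esub>}" for \<theta> :: "'p \<Rightarrow> 'r"
    by (rule finite_subset[OF _ that]) auto
  have "abelian_group (free_mod R Y)"
  proof (rule abelian_groupI)
    fix \<theta> assume \<theta>: "\<theta> \<in> carrier (free_mod R Y)"
    show "\<exists>\<psi>\<in>carrier (free_mod R Y). \<psi> \<oplus>\<^bsub>free_mod R Y\<^esub> \<theta> = \<zero>\<^bsub>free_mod R Y\<^esub>"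
      by (rule bexI[of _ "\<lambda>x. \<ominus>\<^bsub>R\<^esub> \<theta> x"])
        (use \<theta> in \<open>auto simp: free_mod_def fin_neg R.l_neg\<close>)
  qed (auto simp: free_mod_def fin R.a_ac)
  then show ?thesis
    by (intro left_module.intro left_module_axioms.intro assms)
      (auto simp: free_mod_def fin_smult R.l_distr R.r_distr R.m_assoc)
qed

context left_module begin

lemma free_eval_superset:
  assumes "finite A" "{x. \<theta> x \<noteq> \<zero>\<^bsub>R\<^esub>} \<subseteq> A" "A \<subseteq> Y" "m \<in> Y \<rightarrow> carrier M"
    and "\<theta> \<in> carrier (free_mod R Y)"
  shows "free_eval R M m \<theta> = finsum M (\<lambda>x. \<theta> x \<odot>\<^bsub>M\<^esub> m x) A"
  unfolding free_eval_def
  by (rule M.add.finprod_mono_neutral_cong_left)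
    (use assms in \<open>auto simp: free_mod_def Pi_iff subset_eq\<close>)

lemma free_eval_hom:
  assumes m: "m \<in> Y \<rightarrow> carrier M"
  shows "free_eval R M m \<in> mod_hom R (free_mod R Y) M"
proof (rule mod_homI)
  interpret F: left_module R "free_mod R Y"
    by (rule free_mod_left_module) (rule R.ring_axioms)
  have sm: "(\<lambda>x. \<theta> x \<odot>\<^bsub>M\<^esub> m x) \<in> A \<rightarrow> carrier M" if "\<theta> \<in> carrier (free_mod R Y)" "A \<subseteq> Y" for \<theta> A
    using that m by (auto simp: free_mod_def)
  have supp: "finite {x. \<theta> x \<noteq> \<zero>\<^bsub>R\<^esub>}" "{x. \<theta> x \<noteq> \<zero>\<^bsub>R\<^esub>} \<subseteq> Y" "\<And>x. \<theta> x \<in> carrier R"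
    if "\<theta> \<in> carrier (free_mod R Y)" for \<theta>
    using that by (auto simp: free_mod_def)
  show "free_eval R M m \<theta> \<in> carrier M" if "\<theta> \<in> carrier (free_mod R Y)" for \<theta>
    unfolding free_eval_def by (rule M.finsum_closed[OF sm[OF that supp(2)[OF that]]])
  show "free_eval R M m (\<theta> \<oplus>\<^bsub>free_mod R Y\<^esub> \<psi>) = free_eval R M m \<theta> \<oplus>\<^bsub>M\<^esub> free_eval R M m \<psi>"
    if \<theta>: "\<theta> \<in> carrier (free_mod R Y)" and \<psi>: "\<psi> \<in> carrier (free_mod R Y)" for \<theta> \<psi>
  proof -
    let ?A = "{x. \<theta> x \<noteq> \<zero>\<^bsub>R\<^esub>} \<union> {x. \<psi> x \<noteq> \<zero>\<^bsub>R\<^esub>}"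
    let ?s = "\<theta> \<oplus>\<^bsub>free_mod R Y\<^esub> \<psi>"
    have A: "finite ?A" "?A \<subseteq> Y" using supp[OF \<theta>] supp[OF \<psi>] by auto
    have s: "?s \<in> carrier (free_mod R Y)" using \<theta> \<psi> by simp
    have s_app: "?s x = \<theta> x \<oplus>\<^bsub>R\<^esub> \<psi> x" for x by (simp add: free_mod_def)
    have "{x. ?s x \<noteq> \<zero>\<^bsub>R\<^esub>} \<subseteq> ?A" by (auto simp: s_app)
    then have "free_eval R M m ?s = finsum M (\<lambda>x. ?s x \<odot>\<^bsub>M\<^esub> m x) ?A"
      by (rule free_eval_superset[OF A(1) _ A(2) m s])
    also have "\<dots> = finsum M (\<lambda>x. \<theta> x \<odot>\<^bsub>M\<^esub> m x \<oplus>\<^bsub>M\<^esub> \<psi> x \<odot>\<^bsub>M\<^esub> m x) ?A"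
    proof (rule M.finsum_cong')
      have mx: "m x \<in> carrier M" if "x \<in> ?A" for x using that A(2) m by blast
      show "(\<lambda>x. \<theta> x \<odot>\<^bsub>M\<^esub> m x \<oplus>\<^bsub>M\<^esub> \<psi> x \<odot>\<^bsub>M\<^esub> m x) \<in> ?A \<rightarrow> carrier M"
        using mx supp(3)[OF \<theta>] supp(3)[OF \<psi>] by blast
      show "?s x \<odot>\<^bsub>M\<^esub> m x = \<theta> x \<odot>\<^bsub>M\<^esub> m x \<oplus>\<^bsub>M\<^esub> \<psi> x \<odot>\<^bsub>M\<^esub> m x" if "x \<in> ?A" for x
        unfolding s_app by (rule lsmult_l_distr[OF supp(3)[OF \<theta>] supp(3)[OF \<psi>] mx[OF that]])
    qed simp
    also have "\<dots> = finsum M (\<lambda>x. \<theta> x \<odot>\<^bsub>M\<^esub> m x) ?A \<oplus>\<^bsub>M\<^esub> finsum M (\<lambda>x. \<psi> x \<odot>\<^bsub>M\<^esub> m x) ?A"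
      by (rule M.finsum_addf) (use sm[OF \<theta> A(2)] sm[OF \<psi> A(2)] in auto)
    finally show ?thesis
      using free_eval_superset[OF A(1) _ A(2) m \<theta>] free_eval_superset[OF A(1) _ A(2) m \<psi>] by simp
  qed
  show "free_eval R M m (a \<odot>\<^bsub>free_mod R Y\<^esub> \<theta>) = a \<odot>\<^bsub>M\<^esub> free_eval R M m \<theta>"
    if a: "a \<in> carrier R" and \<theta>: "\<theta> \<in> carrier (free_mod R Y)" for a \<theta>
  proof -
    let ?A = "{x. \<theta> x \<noteq> \<zero>\<^bsub>R\<^esub>}"
    let ?s = "a \<odot>\<^bsub>free_mod R Y\<^esub> \<theta>"
    have s: "?s \<in> carrier (free_mod R Y)" using a \<theta> by simp
    have s_app: "?s x = a \<otimes>\<^bsub>R\<^esub> \<theta> x" for x by (simp add: free_mod_def)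
    have "{x. ?s x \<noteq> \<zero>\<^bsub>R\<^esub>} \<subseteq> ?A" using a by (auto simp: s_app)
    then have "free_eval R M m ?s = finsum M (\<lambda>x. ?s x \<odot>\<^bsub>M\<^esub> m x) ?A"
      by (rule free_eval_superset[OF supp(1)[OF \<theta>] _ supp(2)[OF \<theta>] m s])
    also have "\<dots> = finsum M (\<lambda>x. a \<odot>\<^bsub>M\<^esub> (\<theta> x \<odot>\<^bsub>M\<^esub> m x)) ?A"
      by (rule M.finsum_cong')
        (use a m supp[OF \<theta>] in \<open>auto simp: s_app lsmult_assoc Pi_iff subset_eq\<close>)
    also have "\<dots> = a \<odot>\<^bsub>M\<^esub> free_eval R M m \<theta>"
      unfolding free_eval_def
      by (rule lsmult_finsum[symmetric]) (use a supp(1)[OF \<theta>] sm[OF \<theta> supp(2)[OF \<theta>]] in auto)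
    finally show ?thesis .
  qed
qed

lemma free_eval_basis:
  assumes m: "m \<in> Y \<rightarrow> carrier M" and x: "x \<in> Y"
  defines "\<delta> \<equiv> (\<lambda>y. if y = x then \<one>\<^bsub>R\<^esub> else \<zero>\<^bsub>R\<^esub>)"
  shows "\<delta> \<in> carrier (free_mod R Y)" and "free_eval R M m \<delta> = m x"
proof -
  show \<delta>: "\<delta> \<in> carrier (free_mod R Y)"
    using x by (auto simp: free_mod_def \<delta>_def)
  have "free_eval R M m \<delta> = finsum M (\<lambda>y. \<delta> y \<odot>\<^bsub>M\<^esub> m y) {x}"
    by (rule free_eval_superset[OF _ _ _ m \<delta>]) (use x in \<open>auto simp: \<delta>_def\<close>)
  also have "\<dots> = m x" using m x by (simp add: \<delta>_def Pi_iff)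
  finally show "free_eval R M m \<delta> = m x" .
qed

end

lemma mod_hom_free_eval:
  assumes "left_module R M" "left_module R N" "f \<in> mod_hom R M N"
    and "m \<in> Y \<rightarrow> carrier M" "\<theta> \<in> carrier (free_mod R Y)"
  shows "f (free_eval R M m \<theta>) = free_eval R N (\<lambda>x. f (m x)) \<theta>"
proof -
  interpret M: left_module R M by fact
  interpret N: left_module R N by fact
  have supp: "finite {x. \<theta> x \<noteq> \<zero>\<^bsub>R\<^esub>}" "{x. \<theta> x \<noteq> \<zero>\<^bsub>R\<^esub>} \<subseteq> Y" "\<And>x. \<theta> x \<in> carrier R"
    using assms(5) by (auto simp: free_mod_def)
  have "f (free_eval R M m \<theta>) = finsum N (\<lambda>x. f (\<theta> x \<odot>\<^bsub>M\<^esub> m x)) {x. \<theta> x \<noteq> \<zero>\<^bsub>R\<^esub>}"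
    unfolding free_eval_def
    by (rule mod_hom_finsum[OF M.M.abelian_group_axioms N.M.abelian_group_axioms assms(3)])
      (use supp assms(4) in auto)
  also have "\<dots> = free_eval R N (\<lambda>x. f (m x)) \<theta>"
    unfolding free_eval_def
    by (rule N.M.finsum_cong')
      (use supp assms(4) mod_homD(1,3)[OF assms(3)] in \<open>auto simp: Pi_iff subset_eq\<close>)
  finally show ?thesis .
qed

lemma projective_module_lift:
  fixes R :: "('r, 's) ring_scheme" and P :: "('r, 'p) module"
    and M :: "('r, 'a, 'm) module_scheme" and N :: "('r, 'b, 'n) module_scheme"
  assumes P: "projective_module R P"
    and M: "left_module R M" and N: "left_module R N"
    and f: "f \<in> mod_hom R M N" and surj: "f ` carrier M = carrier N"
    and g: "g \<in> mod_hom R P N"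
  shows "\<exists>h\<in>mod_hom R P M. \<forall>x\<in>carrier P. f (h x) = g x"
proof -
  interpret P: left_module R P using P by (simp add: projective_module_def)
  interpret M: left_module R M by fact
  interpret N: left_module R N by fact
  let ?F = "free_mod R (carrier P)"
  define \<pi> where "\<pi> = free_eval R P (\<lambda>x. x)"
  have F: "left_module R ?F" by (rule free_mod_left_module) (rule P.R.ring_axioms)
  have \<pi>: "\<pi> \<in> mod_hom R ?F P" unfolding \<pi>_def by (rule P.free_eval_hom) auto
  have "\<pi> ` carrier ?F = carrier P"
  proof
    show "\<pi> ` carrier ?F \<subseteq> carrier P" using mod_homD(1)[OF \<pi>] by auto
    show "carrier P \<subseteq> \<pi> ` carrier ?F"
    proof
      fix x assume "x \<in> carrier P"
      from P.free_eval_basis[OF _ this, of "\<lambda>x. x"] show "x \<in> \<pi> ` carrier ?F"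
        unfolding \<pi>_def by (metis (no_types, lifting) Pi_I image_eqI)
    qed
  qed
  moreover have "(\<lambda>x. x) \<in> mod_hom R P P" by (rule mod_homI) auto
  ultimately obtain s where s: "s \<in> mod_hom R P ?F" "\<And>x. x \<in> carrier P \<Longrightarrow> \<pi> (s x) = x"
    using P F \<pi> P.left_module_axioms unfolding projective_module_def by metis
  have "\<forall>x\<in>carrier P. \<exists>y. y \<in> carrier M \<and> f y = g x"
    using mod_homD(1)[OF g] surj by (metis imageE)
  then obtain m where m: "\<And>x. x \<in> carrier P \<Longrightarrow> m x \<in> carrier M \<and> f (m x) = g x"
    by metis
  define h where "h = (\<lambda>x. free_eval R M m (s x))"
  have mP: "m \<in> carrier P \<rightarrow> carrier M" using m by auto
  have "h \<in> mod_hom R P M"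
    unfolding h_def by (rule mod_hom_comp[OF s(1) M.free_eval_hom[OF mP]])
  moreover have "f (h x) = g x" if x: "x \<in> carrier P" for x
  proof -
    have sx: "s x \<in> carrier ?F" using mod_homD(1)[OF s(1) x] .
    have "f (h x) = free_eval R N (\<lambda>y. f (m y)) (s x)"
      unfolding h_def by (rule mod_hom_free_eval[OF M N f mP sx])
    also have "\<dots> = free_eval R N g (s x)"
      unfolding free_eval_def
    proof (rule N.M.finsum_cong')
      have supp: "y \<in> carrier P" "s x y \<in> carrier R" if "y \<in> {y. s x y \<noteq> \<zero>\<^bsub>R\<^esub>}" for y
        using that sx by (auto simp: free_mod_def)
      show "(\<lambda>y. s x y \<odot>\<^bsub>N\<^esub> g y) \<in> {y. s x y \<noteq> \<zero>\<^bsub>R\<^esub>} \<rightarrow> carrier N"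
        using supp mod_homD(1)[OF g] by blast
      show "s x y \<odot>\<^bsub>N\<^esub> f (m y) = s x y \<odot>\<^bsub>N\<^esub> g y" if "y \<in> {y. s x y \<noteq> \<zero>\<^bsub>R\<^esub>}" for y
        using supp(1)[OF that] m by simp
    qed simp
    also have "\<dots> = g (free_eval R P (\<lambda>y. y) (s x))"
      by (rule mod_hom_free_eval[OF P.left_module_axioms N g _ sx, symmetric]) auto
    also have "\<dots> = g x" using s(2)[OF x] by (simp add: \<pi>_def)
    finally show ?thesis .
  qed
  ultimately show ?thesis by blast
qed

subsection \<open>Flat modules\<close>

text \<open>An element of the kernel of \<open>f \<otimes> id\<close> and a proof that it lies there involve only finitely
  many elements, and a finitely generated right module injects into the type of lists over \<open>R\<close>.\<close>

lemma tensor_relators_subset: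
  fixes A :: "('r, 'a, 'm) module_scheme" and M :: "('r, 'b, 'n) module_scheme"
  assumes "right_module R A" "left_module R M"
  shows "tensor_relators R A M \<subseteq> carrier (free_Abelian_group (carrier A \<times> carrier M))"
proof -
  interpret A: right_module R A by fact
  interpret M: left_module R M by fact
  have two: "Poly_Mapping.keys (frag_of p - frag_of q) \<subseteq> Y" if "p \<in> Y" "q \<in> Y" for p q :: "'a \<times> 'b" and Y
    using that keys_diff[of "frag_of p" "frag_of q"] by auto
  have three: "Poly_Mapping.keys (frag_of p - frag_of q - frag_of r) \<subseteq> Y"
    if "p \<in> Y" "q \<in> Y" "r \<in> Y" for p q r :: "'a \<times> 'b" and Y
    using that two[of p Y q] keys_diff[of "frag_of p - frag_of q" "frag_of r"] by auto
  show ?thesis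
  proof
    fix t assume "t \<in> tensor_relators R A M"
    then show "t \<in> carrier (free_Abelian_group (carrier A \<times> carrier M))"
      unfolding tensor_relators_def carrier_free_Abelian_group_iff Un_iff mem_Collect_eq
      by (elim disjE exE conjE; hypsubst; intro two three; simp)
  qed
qed

lemma tensor_kernel_subgroup:
  assumes "right_module R A" "left_module R M"
  shows "subgroup (tensor_kernel R A M) (free_Abelian_group (carrier A \<times> carrier M))"
  unfolding tensor_kernel_def
  by (rule group.generate_is_subgroup[OF group_free_Abelian_group tensor_relators_subset[OF assms]])

lemma tensor_kernel_closed:
  assumes "right_module R A" "left_module R M"
  shows "0 \<in> tensor_kernel R A M"
    and "z \<in> tensor_kernel R A M \<Longrightarrow> Poly_Mapping.keys z \<subseteq> carrier A \<times> carrier M"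
    and "z \<in> tensor_kernel R A M \<Longrightarrow> - z \<in> tensor_kernel R A M"
    and "\<lbrakk>z \<in> tensor_kernel R A M; w \<in> tensor_kernel R A M\<rbrakk> \<Longrightarrow> z + w \<in> tensor_kernel R A M"
proof -
  note K = tensor_kernel_subgroup[OF assms]
  show "0 \<in> tensor_kernel R A M" using subgroup.one_closed[OF K] by simp
  show keys: "Poly_Mapping.keys z \<subseteq> carrier A \<times> carrier M" if "z \<in> tensor_kernel R A M" for z
    using subgroup.mem_carrier[OF K that] by simp
  show "- z \<in> tensor_kernel R A M" if "z \<in> tensor_kernel R A M"
    using subgroup.m_inv_closed[OF K that] keys[OF that] by simp
  show "z + w \<in> tensor_kernel R A M" if "z \<in> tensor_kernel R A M" "w \<in> tensor_kernel R A M"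
    using subgroup.m_closed[OF K that] by simp
qed

lemma tensor_relators_kernel: "z \<in> tensor_relators R A M \<Longrightarrow> z \<in> tensor_kernel R A M"
  unfolding tensor_kernel_def by (rule generate.incl)

lemma tensor_kernel_induct [consumes 3, case_names zero rel neg add]:
  assumes "right_module R A" "left_module R M" "z \<in> tensor_kernel R A M"
    and "P 0" and "\<And>h. h \<in> tensor_relators R A M \<Longrightarrow> P h" and "\<And>h. P h \<Longrightarrow> P (- h)"
    and "\<And>h k. \<lbrakk>P h; P k\<rbrakk> \<Longrightarrow> P (h + k)"
  shows "P z"
  using assms(3) unfolding tensor_kernel_def
proof (induction rule: generate.induct)
  case (inv h)
  then have "Poly_Mapping.keys h \<subseteq> carrier A \<times> carrier M"
    using tensor_relators_subset[OF assms(1,2)] by (auto simp: subset_iff)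
  then show ?case using inv assms by simp
qed (use assms in auto)

lemma tensor_push_simps [simp]:
  "tensor_push f 0 = 0"
  "tensor_push f (frag_of (x, v)) = frag_of (f x, v)"
  "tensor_push f (- z) = - tensor_push f z"
  "tensor_push f (z + w) = tensor_push f z + tensor_push f w"
  "tensor_push f (z - w) = tensor_push f z - tensor_push f w"
  by (simp_all add: tensor_push_def frag_extend_minus frag_extend_add frag_extend_diff)

lemma tensor_push_keys:
  assumes "Poly_Mapping.keys z \<subseteq> Y \<times> V" "\<And>x. x \<in> Y \<Longrightarrow> f x \<in> W"
  shows "Poly_Mapping.keys (tensor_push f z) \<subseteq> W \<times> V"
  unfolding tensor_push_def
  by (rule order_trans[OF keys_frag_extend]) (use assms in \<open>force split: if_splits\<close>)

lemma tensor_push_comp: "tensor_push g (tensor_push f z) = tensor_push (\<lambda>x. g (f x)) z"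
  by (rule frag_induction[of z UNIV]) auto

lemma tensor_push_ident:
  assumes "Poly_Mapping.keys z \<subseteq> Y \<times> V" "\<And>x. x \<in> Y \<Longrightarrow> f x = x"
  shows "tensor_push f z = z"
  by (rule frag_induction[OF assms(1)]) (use assms(2) in auto)

lemma tensor_push_kernel:
  assumes A: "right_module R A" and B: "right_module R B" and M: "left_module R M"
    and f: "f \<in> mod_hom R A B" and z: "z \<in> tensor_kernel R A M"
  shows "tensor_push f z \<in> tensor_kernel R B M"
  using A M z
proof (induction rule: tensor_kernel_induct)
  case (rel h)
  have "tensor_push f h \<in> tensor_relators R B M"
    using rel[unfolded tensor_relators_def Un_iff mem_Collect_eq]
  proof (elim disjE exE conjE)
    fix x y v assume *: "h = frag_of (x \<oplus>\<^bsub>A\<^esub> y, v) - frag_of (x, v) - frag_of (y, v)"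
      "x \<in> carrier A" "y \<in> carrier A" "v \<in> carrier M"
    then show "tensor_push f h \<in> tensor_relators R B M"
      unfolding tensor_relators_def Un_iff mem_Collect_eq
      by (intro disjI1 exI[of _ "f x"] exI[of _ "f y"] exI[of _ v])
        (simp add: mod_homD[OF f])
  next
    fix x v w assume *: "h = frag_of (x, v \<oplus>\<^bsub>M\<^esub> w) - frag_of (x, v) - frag_of (x, w)"
      "x \<in> carrier A" "v \<in> carrier M" "w \<in> carrier M"
    then show "tensor_push f h \<in> tensor_relators R B M"
      unfolding tensor_relators_def Un_iff mem_Collect_eq
      by (intro disjI1 disjI2 exI[of _ "f x"] exI[of _ v] exI[of _ w])
        (simp add: mod_homD[OF f])
  next
    fix a x v assume *: "h = frag_of (a \<odot>\<^bsub>A\<^esub> x, v) - frag_of (x, a \<odot>\<^bsub>M\<^esub> v)"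
      "a \<in> carrier R" "x \<in> carrier A" "v \<in> carrier M"
    then show "tensor_push f h \<in> tensor_relators R B M"
      unfolding tensor_relators_def Un_iff mem_Collect_eq
      by (intro disjI2 exI[of _ a] exI[of _ "f x"] exI[of _ v])
        (simp add: mod_homD[OF f])
  qed
  then show ?case by (rule tensor_relators_kernel)
qed (auto intro: tensor_kernel_closed[OF B M])

lemma tensor_map_coset:
  assumes A: "right_module R A" and B: "right_module R B" and M: "left_module R M"
    and f: "f \<in> mod_hom R A B" and z: "Poly_Mapping.keys z \<subseteq> carrier A \<times> carrier M"
  shows "tensor_map R A B M f (tensor_kernel R A M #>\<^bsub>free_Abelian_group (carrier A \<times> carrier M)\<^esub> z)
    = tensor_kernel R B M #>\<^bsub>free_Abelian_group (carrier B \<times> carrier M)\<^esub> tensor_push f z"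
proof -
  let ?Z = "free_Abelian_group (carrier B \<times> carrier M)"
  have "tensor_kernel R B M #>\<^bsub>?Z\<^esub> tensor_push f (k + z) = tensor_kernel R B M #>\<^bsub>?Z\<^esub> tensor_push f z"
    if "k \<in> tensor_kernel R A M" for k
  proof (rule group.repr_independence[symmetric, OF group_free_Abelian_group])
    show "tensor_push f (k + z) \<in> tensor_kernel R B M #>\<^bsub>?Z\<^esub> tensor_push f z"
      using tensor_push_kernel[OF A B M f that] by (auto simp: r_coset_def)
    show "tensor_push f z \<in> carrier ?Z"
      using tensor_push_keys[OF z mod_homD(1)[OF f]] by simp
    show "subgroup (tensor_kernel R B M) ?Z" by (rule tensor_kernel_subgroup[OF B M])
  qed
  moreover have "tensor_kernel R A M #>\<^bsub>free_Abelian_group (carrier A \<times> carrier M)\<^esub> z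
      = (\<lambda>k. k + z) ` tensor_kernel R A M"
    by (auto simp: r_coset_def)
  ultimately show ?thesis
    using tensor_kernel_closed(1)[OF A M] by (auto simp: tensor_map_def)
qed

lemma tensor_map_inj_iff:
  assumes A: "right_module R A" and B: "right_module R B" and M: "left_module R M"
    and f: "f \<in> mod_hom R A B"
  shows "inj_on (tensor_map R A B M f) (carrier (tensor_prod R A M)) \<longleftrightarrow>
    (\<forall>z. Poly_Mapping.keys z \<subseteq> carrier A \<times> carrier M \<longrightarrow> tensor_push f z \<in> tensor_kernel R B M \<longrightarrow>
      z \<in> tensor_kernel R A M)"
proof -
  let ?ZA = "free_Abelian_group (carrier A \<times> carrier M)"
  let ?ZB = "free_Abelian_group (carrier B \<times> carrier M)"
  have coset_eq: "tensor_kernel R C M #>\<^bsub>free_Abelian_group (carrier C \<times> carrier M)\<^esub> z =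
      tensor_kernel R C M #>\<^bsub>free_Abelian_group (carrier C \<times> carrier M)\<^esub> w
      \<longleftrightarrow> z - w \<in> tensor_kernel R C M"
    if C: "right_module R C" and zw: "Poly_Mapping.keys z \<subseteq> carrier C \<times> carrier M"
      "Poly_Mapping.keys w \<subseteq> carrier C \<times> carrier M"
    for C :: "('a, 'z, 'y) module_scheme" and z w
  proof
    let ?Z = "free_Abelian_group (carrier C \<times> carrier M)"
    assume eq: "tensor_kernel R C M #>\<^bsub>?Z\<^esub> z = tensor_kernel R C M #>\<^bsub>?Z\<^esub> w"
    have "z \<in> tensor_kernel R C M #>\<^bsub>?Z\<^esub> z"
      using tensor_kernel_closed(1)[OF C M] by (force simp: r_coset_def)
    then obtain k where "k \<in> tensor_kernel R C M" "z = k + w"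
      unfolding eq by (auto simp: r_coset_def)
    then show "z - w \<in> tensor_kernel R C M" by simp
  next
    let ?Z = "free_Abelian_group (carrier C \<times> carrier M)"
    assume "z - w \<in> tensor_kernel R C M"
    then have "z \<in> tensor_kernel R C M #>\<^bsub>?Z\<^esub> w"
      by (force simp: r_coset_def intro!: bexI[of _ "z - w"])
    then show "tensor_kernel R C M #>\<^bsub>?Z\<^esub> z = tensor_kernel R C M #>\<^bsub>?Z\<^esub> w"
      by (intro group.repr_independence[symmetric, OF group_free_Abelian_group] tensor_kernel_subgroup C M)
        (use zw in auto)
  qed
  have push_keys: "Poly_Mapping.keys (tensor_push f z) \<subseteq> carrier B \<times> carrier M"
    if "Poly_Mapping.keys z \<subseteq> carrier A \<times> carrier M" for z
    using tensor_push_keys[OF that] mod_homD(1)[OF f] by blast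
  have carr: "carrier (tensor_prod R A M) =
      {tensor_kernel R A M #>\<^bsub>?ZA\<^esub> z | z. Poly_Mapping.keys z \<subseteq> carrier A \<times> carrier M}"
    by (auto simp: tensor_prod_def FactGroup_def RCOSETS_def)
  have "inj_on (tensor_map R A B M f) (carrier (tensor_prod R A M)) \<longleftrightarrow>
    (\<forall>z w. Poly_Mapping.keys z \<subseteq> carrier A \<times> carrier M \<longrightarrow> Poly_Mapping.keys w \<subseteq> carrier A \<times> carrier M \<longrightarrow>
      tensor_push f (z - w) \<in> tensor_kernel R B M \<longrightarrow> z - w \<in> tensor_kernel R A M)"
  proof -
    have "inj_on (tensor_map R A B M f) (carrier (tensor_prod R A M)) \<longleftrightarrow>
      (\<forall>z w. Poly_Mapping.keys z \<subseteq> carrier A \<times> carrier M \<longrightarrow> Poly_Mapping.keys w \<subseteq> carrier A \<times> carrier M \<longrightarrow>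
        tensor_map R A B M f (tensor_kernel R A M #>\<^bsub>?ZA\<^esub> z) = tensor_map R A B M f (tensor_kernel R A M #>\<^bsub>?ZA\<^esub> w) \<longrightarrow>
        tensor_kernel R A M #>\<^bsub>?ZA\<^esub> z = tensor_kernel R A M #>\<^bsub>?ZA\<^esub> w)"
      unfolding carr inj_on_def by blast
    then show ?thesis
      by (simp add: tensor_map_coset[OF A B M f] coset_eq[OF A] coset_eq[OF B] push_keys cong: imp_cong)
  qed
  also have "\<dots> \<longleftrightarrow> (\<forall>z. Poly_Mapping.keys z \<subseteq> carrier A \<times> carrier M \<longrightarrow>
      tensor_push f z \<in> tensor_kernel R B M \<longrightarrow> z \<in> tensor_kernel R A M)"
  proof safe
    fix z assume "\<forall>z w. Poly_Mapping.keys z \<subseteq> carrier A \<times> carrier M \<longrightarrow>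
        Poly_Mapping.keys w \<subseteq> carrier A \<times> carrier M \<longrightarrow>
        tensor_push f (z - w) \<in> tensor_kernel R B M \<longrightarrow> z - w \<in> tensor_kernel R A M"
      and "Poly_Mapping.keys z \<subseteq> carrier A \<times> carrier M" "tensor_push f z \<in> tensor_kernel R B M"
    then show "z \<in> tensor_kernel R A M" by (metis diff_zero empty_subsetI keys_zero)
  next
    fix z w assume *: "\<forall>z. Poly_Mapping.keys z \<subseteq> carrier A \<times> carrier M \<longrightarrow>
        tensor_push f z \<in> tensor_kernel R B M \<longrightarrow> z \<in> tensor_kernel R A M"
      and zw: "Poly_Mapping.keys z \<subseteq> carrier A \<times> carrier M"
        "Poly_Mapping.keys w \<subseteq> carrier A \<times> carrier M"
      and "tensor_push f (z - w) \<in> tensor_kernel R B M"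
    moreover have "Poly_Mapping.keys (z - w) \<subseteq> carrier A \<times> carrier M"
      using zw keys_diff[of z w] by blast
    ultimately show "z - w \<in> tensor_kernel R A M" by blast
  qed
  finally show ?thesis .
qed

context right_module begin

definition rsubmodule :: "'b set \<Rightarrow> bool"
  where "rsubmodule S \<longleftrightarrow> S \<subseteq> carrier M \<and> \<zero>\<^bsub>M\<^esub> \<in> S \<and>
    (\<forall>x\<in>S. \<forall>y\<in>S. x \<oplus>\<^bsub>M\<^esub> y \<in> S) \<and> (\<forall>a\<in>carrier R. \<forall>x\<in>S. a \<odot>\<^bsub>M\<^esub> x \<in> S)"

lemma rsmult_zero: "x \<in> carrier M \<Longrightarrow> \<zero>\<^bsub>R\<^esub> \<odot>\<^bsub>M\<^esub> x = \<zero>\<^bsub>M\<^esub>"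
  by (metis R.l_zero R.zero_closed rsmult_closed rsmult_l_distr M.add.r_cancel_one')

lemma rsmult_zero_right: "a \<in> carrier R \<Longrightarrow> a \<odot>\<^bsub>M\<^esub> \<zero>\<^bsub>M\<^esub> = \<zero>\<^bsub>M\<^esub>"
  by (metis M.l_zero M.zero_closed rsmult_closed rsmult_r_distr M.add.r_cancel_one')

lemma rsubmodule_right_module:
  assumes "rsubmodule S"
  shows "right_module R (M\<lparr>carrier := S\<rparr>)"
proof -
  have S: "x \<in> carrier M" if "x \<in> S" for x using that assms by (auto simp: rsubmodule_def)
  have neg: "\<exists>y\<in>S. y \<oplus>\<^bsub>M\<^esub> x = \<zero>\<^bsub>M\<^esub>" if x: "x \<in> S" for x
  proof -
    have "(\<ominus>\<^bsub>R\<^esub> \<one>\<^bsub>R\<^esub>) \<odot>\<^bsub>M\<^esub> x \<oplus>\<^bsub>M\<^esub> x = (\<ominus>\<^bsub>R\<^esub> \<one>\<^bsub>R\<^esub> \<oplus>\<^bsub>R\<^esub> \<one>\<^bsub>R\<^esub>) \<odot>\<^bsub>M\<^esub> x"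
      using S[OF x] by (simp add: rsmult_l_distr)
    also have "\<dots> = \<zero>\<^bsub>M\<^esub>" using S[OF x] by (simp add: R.l_neg rsmult_zero)
    finally show ?thesis using assms x by (auto simp: rsubmodule_def)
  qed
  have "abelian_group (M\<lparr>carrier := S\<rparr>)"
    by (rule abelian_groupI) (use assms S neg in \<open>auto simp: rsubmodule_def M.a_assoc intro: M.a_comm\<close>)
  then show ?thesis
    by (intro right_module.intro right_module_axioms.intro R.ring_axioms)
      (use assms S in \<open>auto simp: rsubmodule_def rsmult_l_distr rsmult_r_distr rsmult_assoc\<close>)
qed

lemma finite_rsubmodule_inj:
  assumes "finite F" "F \<subseteq> carrier M"
  shows "\<exists>S (\<theta> :: 'b \<Rightarrow> 'a list). F \<subseteq> S \<and> rsubmodule S \<and> inj_on \<theta> S"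
proof -
  have "\<exists>S (\<sigma> :: 'a list \<Rightarrow> 'b). F \<subseteq> S \<and> rsubmodule S \<and> S \<subseteq> range \<sigma>"
    using assms
  proof (induction F)
    case empty
    have "rsubmodule {\<zero>\<^bsub>M\<^esub>}" by (auto simp: rsubmodule_def rsmult_zero_right)
    moreover have "{\<zero>\<^bsub>M\<^esub>} \<subseteq> range (\<lambda>_ :: 'a list. \<zero>\<^bsub>M\<^esub>)" by auto
    ultimately show ?case by blast
  next
    case (insert b F)
    then obtain S and \<sigma> :: "'a list \<Rightarrow> 'b" where S: "F \<subseteq> S" "rsubmodule S" "S \<subseteq> range \<sigma>"
      by auto
    have b: "b \<in> carrier M" using insert by simp
    have S': "x \<in> carrier M" if "x \<in> S" for x using that S by (auto simp: rsubmodule_def)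
    have S0: "\<zero>\<^bsub>M\<^esub> \<in> S" using S by (simp add: rsubmodule_def)
    define T where "T = {x \<oplus>\<^bsub>M\<^esub> a \<odot>\<^bsub>M\<^esub> b | x a. x \<in> S \<and> a \<in> carrier R}"
    have TI: "x \<oplus>\<^bsub>M\<^esub> a \<odot>\<^bsub>M\<^esub> b \<in> T" if "x \<in> S" "a \<in> carrier R" for x a
      using that by (auto simp: T_def)
    have "x \<in> T" if "x \<in> S" for x
      using TI[OF that R.zero_closed] S'[OF that] b by (simp add: rsmult_zero)
    then have ST: "S \<subseteq> T" by blast
    moreover have "b \<in> T" using TI[OF S0 R.one_closed] b by simp
    ultimately have "insert b F \<subseteq> T" using S(1) by blast
    moreover have "rsubmodule T"
      unfolding rsubmodule_def
    proof (intro conjI ballI)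
      show "T \<subseteq> carrier M" using S' b by (auto simp: T_def)
      show "\<zero>\<^bsub>M\<^esub> \<in> T" using S0 ST by blast
      fix x y assume "x \<in> T" "y \<in> T"
      then obtain x' a y' c where *: "x = x' \<oplus>\<^bsub>M\<^esub> a \<odot>\<^bsub>M\<^esub> b" "y = y' \<oplus>\<^bsub>M\<^esub> c \<odot>\<^bsub>M\<^esub> b"
        "x' \<in> S" "y' \<in> S" "a \<in> carrier R" "c \<in> carrier R"
        by (auto simp: T_def)
      then have "x \<oplus>\<^bsub>M\<^esub> y = (x' \<oplus>\<^bsub>M\<^esub> y') \<oplus>\<^bsub>M\<^esub> (a \<oplus>\<^bsub>R\<^esub> c) \<odot>\<^bsub>M\<^esub> b"
        using S' b by (simp add: rsmult_l_distr M.a_ac)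
      moreover have "x' \<oplus>\<^bsub>M\<^esub> y' \<in> S" using * S(2) by (simp add: rsubmodule_def)
      ultimately show "x \<oplus>\<^bsub>M\<^esub> y \<in> T" using TI * by simp
    next
      fix a x assume a: "a \<in> carrier R" and "x \<in> T"
      then obtain x' c where *: "x = x' \<oplus>\<^bsub>M\<^esub> c \<odot>\<^bsub>M\<^esub> b" "x' \<in> S" "c \<in> carrier R"
        by (auto simp: T_def)
      then have "a \<odot>\<^bsub>M\<^esub> x = a \<odot>\<^bsub>M\<^esub> x' \<oplus>\<^bsub>M\<^esub> (c \<otimes>\<^bsub>R\<^esub> a) \<odot>\<^bsub>M\<^esub> b"
        using S' b a by (simp add: rsmult_r_distr rsmult_assoc)
      moreover have "a \<odot>\<^bsub>M\<^esub> x' \<in> S" using * a S(2) by (simp add: rsubmodule_def)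
      ultimately show "a \<odot>\<^bsub>M\<^esub> x \<in> T" using TI * a by simp
    qed
    moreover have "T \<subseteq> range (\<lambda>l. \<sigma> (tl l) \<oplus>\<^bsub>M\<^esub> hd l \<odot>\<^bsub>M\<^esub> b)"
    proof
      fix t assume "t \<in> T"
      then obtain x a where t: "t = x \<oplus>\<^bsub>M\<^esub> a \<odot>\<^bsub>M\<^esub> b" "x \<in> S" by (auto simp: T_def)
      then obtain l where "x = \<sigma> l" using S(3) by blast
      then have "t = \<sigma> (tl (a # l)) \<oplus>\<^bsub>M\<^esub> hd (a # l) \<odot>\<^bsub>M\<^esub> b" using t by simp
      then show "t \<in> range (\<lambda>l. \<sigma> (tl l) \<oplus>\<^bsub>M\<^esub> hd l \<odot>\<^bsub>M\<^esub> b)" by blast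
    qed
    ultimately show ?case by blast
  qed
  then obtain S and \<sigma> :: "'a list \<Rightarrow> 'b" where S: "F \<subseteq> S" "rsubmodule S" "S \<subseteq> range \<sigma>"
    by blast
  then have "inj_on (inv_into UNIV \<sigma>) S" by (simp add: inj_on_inv_into)
  with S show ?thesis by blast
qed

end

lemma tensor_kernel_finite:
  fixes B :: "('r, 'b, 'n) module_scheme"
  assumes B: "right_module R B" and M: "left_module R M" and z: "z \<in> tensor_kernel R B M"
  shows "\<exists>F. finite F \<and> F \<subseteq> carrier B \<and>
    (\<forall>S. F \<subseteq> S \<and> right_module.rsubmodule R B S \<longrightarrow> z \<in> tensor_kernel R (B\<lparr>carrier := S\<rparr>) M)"
proof -
  interpret B: right_module R B by fact
  define Q where "Q F z \<longleftrightarrow> finite F \<and> F \<subseteq> carrier B \<and>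
    (\<forall>S. F \<subseteq> S \<and> B.rsubmodule S \<longrightarrow> z \<in> tensor_kernel R (B\<lparr>carrier := S\<rparr>) M)" for F z
  note closed = tensor_kernel_closed[OF B.rsubmodule_right_module M]
  from B M z have "\<exists>F. Q F z"
  proof (induction rule: tensor_kernel_induct)
    case zero
    have "Q {} 0" unfolding Q_def using closed(1) by auto
    then show ?case by blast
  next
    case (rel h)
    have "\<exists>F. finite F \<and> F \<subseteq> carrier B \<and>
      (\<forall>S. F \<subseteq> S \<longrightarrow> h \<in> tensor_relators R (B\<lparr>carrier := S\<rparr>) M)" (is ?goal)
      using rel[unfolded tensor_relators_def Un_iff mem_Collect_eq]
    proof (elim disjE exE conjE)
      fix x y v assume "h = frag_of (x \<oplus>\<^bsub>B\<^esub> y, v) - frag_of (x, v) - frag_of (y, v)"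
        "x \<in> carrier B" "y \<in> carrier B" "v \<in> carrier M"
      then show ?goal
        by (intro exI[of _ "{x, y}"]) (simp add: tensor_relators_def, blast)
    next
      fix x v w assume "h = frag_of (x, v \<oplus>\<^bsub>M\<^esub> w) - frag_of (x, v) - frag_of (x, w)"
        "x \<in> carrier B" "v \<in> carrier M" "w \<in> carrier M"
      then show ?goal
        by (intro exI[of _ "{x}"]) (simp add: tensor_relators_def, blast)
    next
      fix a x v assume "h = frag_of (a \<odot>\<^bsub>B\<^esub> x, v) - frag_of (x, a \<odot>\<^bsub>M\<^esub> v)"
        "a \<in> carrier R" "x \<in> carrier B" "v \<in> carrier M"
      then show ?goal
        by (intro exI[of _ "{x}"]) (simp add: tensor_relators_def, blast)
    qed
    then show ?case unfolding Q_def using tensor_relators_kernel by metis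
  next
    case (neg h)
    then obtain F where "Q F h" by blast
    then have "Q F (- h)" unfolding Q_def using closed(3) by blast
    then show ?case by blast
  next
    case (add h k)
    then obtain F G where "Q F h" "Q G k" by blast
    then have "Q (F \<union> G) (h + k)" unfolding Q_def using closed(4) by simp
    then show ?case by blast
  qed
  then show ?thesis unfolding Q_def .
qed

lemma right_module_transfer:
  fixes B :: "('r, 'b, 'n) module_scheme" and \<theta> :: "'b \<Rightarrow> 'c"
  assumes B: "right_module R B" and inj: "inj_on \<theta> (carrier B)"
  obtains C :: "('r, 'c) module" where "right_module R C" "carrier C = \<theta> ` carrier B"
    "\<theta> \<in> mod_hom R B C"
proof
  interpret B: right_module R B by fact
  define \<psi> where "\<psi> = inv_into (carrier B) \<theta>"
  define C :: "('r, 'c) module" where "C = \<lparr>carrier = \<theta> ` carrier B, monoid.mult = undefined,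
    one = undefined, ring.zero = \<theta> \<zero>\<^bsub>B\<^esub>, add = (\<lambda>x y. \<theta> (\<psi> x \<oplus>\<^bsub>B\<^esub> \<psi> y)),
    smult = (\<lambda>a x. \<theta> (a \<odot>\<^bsub>B\<^esub> \<psi> x))\<rparr>"
  have \<psi> [simp]: "\<psi> (\<theta> x) = x" if "x \<in> carrier B" for x
    using that inj by (simp add: \<psi>_def)
  show "carrier C = \<theta> ` carrier B" by (simp add: C_def)
  show "\<theta> \<in> mod_hom R B C" by (rule mod_homI) (auto simp: C_def)
  have "abelian_group C"
  proof (rule abelian_groupI)
    fix x assume "x \<in> carrier C"
    then obtain y where y: "x = \<theta> y" "y \<in> carrier B" by (auto simp: C_def)
    show "\<exists>w\<in>carrier C. w \<oplus>\<^bsub>C\<^esub> x = \<zero>\<^bsub>C\<^esub>"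
      by (rule bexI[of _ "\<theta> (\<ominus>\<^bsub>B\<^esub> y)"]) (use y in \<open>auto simp: C_def B.M.l_neg\<close>)
  next
    show "x \<oplus>\<^bsub>C\<^esub> y = y \<oplus>\<^bsub>C\<^esub> x" if "x \<in> carrier C" "y \<in> carrier C" for x y
      using that by (auto simp: C_def B.M.a_comm)
  qed (auto simp: C_def B.M.a_assoc)
  then show "right_module R C"
    by (intro right_module.intro right_module_axioms.intro B.R.ring_axioms)
      (auto simp: C_def B.rsmult_l_distr B.rsmult_r_distr B.rsmult_assoc)
qed

lemma flat_left_module_inj:
  fixes R :: "('r, 's) ring_scheme" and M :: "('r, 'c, 'k) module_scheme"
    and A :: "('r, 'a, 'm) module_scheme" and B :: "('r, 'b, 'n) module_scheme"
  assumes flat: "flat_left_module R M"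
    and A: "right_module R A" and B: "right_module R B"
    and f: "f \<in> mod_hom R A B" and inj: "inj_on f (carrier A)"
  shows "inj_on (tensor_map R A B M f) (carrier (tensor_prod R A M))"
proof -
  interpret A: right_module R A by fact
  interpret B: right_module R B by fact
  have M: "left_module R M" using flat by (simp add: flat_left_module_def)
  have "z \<in> tensor_kernel R A M"
    if z: "Poly_Mapping.keys z \<subseteq> carrier A \<times> carrier M"
      and fz: "tensor_push f z \<in> tensor_kernel R B M" for z
  proof -
    define E where "E = fst ` Poly_Mapping.keys z"
    obtain F where F: "finite F" "F \<subseteq> carrier B"
      "\<And>S. \<lbrakk>F \<subseteq> S; B.rsubmodule S\<rbrakk> \<Longrightarrow> tensor_push f z \<in> tensor_kernel R (B\<lparr>carrier := S\<rparr>) M"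
      using tensor_kernel_finite[OF B M fz] by blast
    have E: "finite E" "E \<subseteq> carrier A" using z by (auto simp: E_def)
    then have "finite (F \<union> f ` E)" "F \<union> f ` E \<subseteq> carrier B"
      using F(1,2) mod_homD(1)[OF f] by auto
    from B.finite_rsubmodule_inj[OF this]
    obtain S and \<theta> :: "'b \<Rightarrow> 'r list" where S: "F \<union> f ` E \<subseteq> S" "B.rsubmodule S" "inj_on \<theta> S"
      by blast
    have S_sub: "S \<subseteq> carrier B" using S(2) by (simp add: B.rsubmodule_def)
    have BS: "right_module R (B\<lparr>carrier := S\<rparr>)" by (rule B.rsubmodule_right_module[OF S(2)])
    obtain C :: "('r, 'r list) module" where C: "right_module R C" "carrier C = \<theta> ` S"
      and \<theta>: "\<theta> \<in> mod_hom R (B\<lparr>carrier := S\<rparr>) C"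
      using right_module_transfer[OF BS, of \<theta>] S(3) by auto
    define T where "T = {x \<in> carrier A. f x \<in> S}"
    have f0: "f \<zero>\<^bsub>A\<^esub> = \<zero>\<^bsub>B\<^esub>"
      by (rule mod_hom_zero[OF A.M.abelian_group_axioms B.M.abelian_group_axioms f])
    have T: "A.rsubmodule T"
      using S(2) mod_homD[OF f] f0 by (auto simp: A.rsubmodule_def B.rsubmodule_def T_def)
    have AT: "right_module R (A\<lparr>carrier := T\<rparr>)" by (rule A.rsubmodule_right_module[OF T])
    define \<eta> where "\<eta> = (\<lambda>x. \<theta> (f x))"
    have fT: "f \<in> mod_hom R (A\<lparr>carrier := T\<rparr>) (B\<lparr>carrier := S\<rparr>)"
      by (rule mod_homI) (use mod_homD[OF f] in \<open>auto simp: T_def\<close>)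
    have \<eta>_inj: "inj_on \<eta> T"
      using inj S(3) by (auto simp: \<eta>_def inj_on_def T_def)
    obtain D :: "('r, 'r list) module" where D: "right_module R D" "carrier D = \<eta> ` T"
      and \<eta>: "\<eta> \<in> mod_hom R (A\<lparr>carrier := T\<rparr>) D"
      using right_module_transfer[OF AT, of \<eta>] \<eta>_inj by auto
    have \<eta>C: "\<eta> \<in> mod_hom R (A\<lparr>carrier := T\<rparr>) C"
      unfolding \<eta>_def by (rule mod_hom_comp[OF fT \<theta>])
    have incl: "(\<lambda>x. x) \<in> mod_hom R D C"
      using mod_homD[OF \<eta>] mod_homD[OF \<eta>C] by (intro mod_homI) (auto simp: D(2))
    have flat': "inj_on (tensor_map R D C M (\<lambda>x. x)) (carrier (tensor_prod R D M))"
      using flat D(1) C(1) incl unfolding flat_left_module_def by (metis inj_on_id2)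
    have zT: "Poly_Mapping.keys z \<subseteq> T \<times> carrier M"
    proof
      fix p assume "p \<in> Poly_Mapping.keys z"
      then show "p \<in> T \<times> carrier M"
        using z S(1) unfolding T_def E_def by (cases p) force
    qed
    define w where "w = tensor_push \<eta> z"
    have w_keys: "Poly_Mapping.keys w \<subseteq> carrier D \<times> carrier M"
      unfolding w_def by (rule tensor_push_keys[OF zT]) (simp add: D(2))
    have "w = tensor_push \<theta> (tensor_push f z)" by (simp add: w_def tensor_push_comp \<eta>_def)
    also have "\<dots> \<in> tensor_kernel R C M"
      by (rule tensor_push_kernel[OF BS C(1) M \<theta> F(3)]) (use S in auto)
    finally have "tensor_push (\<lambda>x. x) w \<in> tensor_kernel R C M"
      using tensor_push_ident[OF w_keys] by simp
    then have wD: "w \<in> tensor_kernel R D M"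
      using flat' w_keys unfolding tensor_map_inj_iff[OF D(1) C(1) M incl] by blast
    define \<xi> where "\<xi> = inv_into T \<eta>"
    have \<xi>_eq: "\<xi> (\<eta> x) = x" if "x \<in> T" for x
      using that \<eta>_inj by (simp add: \<xi>_def)
    have \<xi>: "\<xi> \<in> mod_hom R D A"
    proof (rule mod_homI)
      show "\<xi> x \<in> carrier A" if "x \<in> carrier D" for x
        using that \<xi>_eq by (auto simp: D(2) T_def)
      show "\<xi> (x \<oplus>\<^bsub>D\<^esub> y) = \<xi> x \<oplus>\<^bsub>A\<^esub> \<xi> y" if "x \<in> carrier D" "y \<in> carrier D" for x y
      proof -
        from that obtain x' y' where *: "x = \<eta> x'" "y = \<eta> y'" "x' \<in> T" "y' \<in> T" by (auto simp: D(2))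
        then have "x \<oplus>\<^bsub>D\<^esub> y = \<eta> (x' \<oplus>\<^bsub>A\<^esub> y')" using mod_homD(2)[OF \<eta>] by simp
        moreover have "x' \<oplus>\<^bsub>A\<^esub> y' \<in> T" using * T by (simp add: A.rsubmodule_def)
        ultimately show ?thesis using * \<xi>_eq by simp
      qed
      show "\<xi> (a \<odot>\<^bsub>D\<^esub> x) = a \<odot>\<^bsub>A\<^esub> \<xi> x" if "a \<in> carrier R" "x \<in> carrier D" for a x
      proof -
        from that obtain x' where *: "x = \<eta> x'" "x' \<in> T" by (auto simp: D(2))
        then have "a \<odot>\<^bsub>D\<^esub> x = \<eta> (a \<odot>\<^bsub>A\<^esub> x')" using that mod_homD(3)[OF \<eta>] by simp
        moreover have "a \<odot>\<^bsub>A\<^esub> x' \<in> T" using * that T by (simp add: A.rsubmodule_def)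
        ultimately show ?thesis using * \<xi>_eq by simp
      qed
    qed
    have "tensor_push \<xi> w \<in> tensor_kernel R A M"
      by (rule tensor_push_kernel[OF D(1) A M \<xi> wD])
    moreover have "tensor_push \<xi> w = z"
      unfolding w_def tensor_push_comp by (rule tensor_push_ident[OF zT]) (rule \<xi>_eq)
    ultimately show ?thesis by simp
  qed
  then show ?thesis unfolding tensor_map_inj_iff[OF A B M f] by blast
qed

end

theory Submission
  imports Defs
begin

text \<open>
  A right ideal \<open>I\<close> lies in the Gabriel topology iff \<open>I U = U\<close>, that is, iff \<open>1 = \<Sum> u(s\<^sub>i) y\<^sub>i\<close> for
  some \<open>s\<^sub>i \<in> I\<close> and \<open>y\<^sub>i \<in> U\<close> (\<open>gabriel_topology_iff\<close>).  Three kinds of right ideals have this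
  property: the intersection of two members, the set \<open>{r. x u(r) \<in> u(R)}\<close> of denominators of an
  element \<open>x\<close> of \<open>U\<close>, and the annihilator \<open>{b. z b = 0}\<close> of an element \<open>z\<close> of the kernel of \<open>u\<close>.
  All three facts follow from one consequence of flatness (\<open>flat_tensor_zero\<close>): if
  \<open>\<Sum> a\<^sub>j \<otimes> x\<^sub>j = 0\<close>, then the tuple \<open>(x\<^sub>j)\<close> is a sum of tuples \<open>(b\<^sub>j w)\<close> with \<open>\<Sum> a\<^sub>j b\<^sub>j = 0\<close>.
  For denominators it is applied to the relation \<open>x \<otimes> 1 = 1 \<otimes> x\<close> in \<open>U \<otimes>\<^sub>R U\<close>, which is where
  the epimorphism enters (\<open>epimorphism_tensor_commute\<close>).

  A countable base then makes the left module \<open>U\<close> countably presented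
  (\<open>countable_base_resolution\<close>).  For each member \<open>J\<close> of the base fix an expression
  \<open>1 = \<Sum> u(s\<^sub>J\<^sub>,\<^sub>i) y\<^sub>J\<^sub>,\<^sub>i\<close> with \<open>s\<^sub>J\<^sub>,\<^sub>i \<in> J\<close>.  The countably many elements \<open>y\<^sub>J\<^sub>,\<^sub>i\<close> generate \<open>U\<close>: if
  \<open>J\<close> consists of denominators of \<open>x\<close>, then \<open>x = \<Sum> x u(s\<^sub>J\<^sub>,\<^sub>i) y\<^sub>J\<^sub>,\<^sub>i\<close> has its coefficients in
  \<open>u(R)\<close>.  Applied to a generator \<open>x\<close>, this is a first family of relations.  A second one writes each
  generator as a combination of generators with coefficients in \<open>J\<close>, for each \<open>J\<close>.  These
  countably many relations suffice.  Given any relation \<open>\<Sum> r\<^sub>i x\<^sub>i = 0\<close>, a common ideal \<open>J\<close> of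
  denominators and the first family turn it into a relation on the \<open>y\<^sub>J\<^sub>,\<^sub>i\<close> whose coefficients lie in
  the kernel of \<open>u\<close>; each such coefficient \<open>z\<close> kills some member \<open>J'\<close> of the base, so \<open>z\<close> times a
  generator is zero by the second family.

  Finally, a countably presented flat module has projective dimension at most \<open>1\<close>
  (\<open>countably_presented_flat_resolution\<close>).  If \<open>K\<close> is the kernel of a map from a free module \<open>F\<close>
  onto a flat module, then each \<open>k \<in> K\<close> is killed by an endomorphism \<open>\<beta>\<close> of \<open>F\<close> with
  \<open>(1 - \<beta>) F \<subseteq> K\<close> (\<open>flat_kernel_locally_split\<close>).  When \<open>K\<close> is countably generated, composing such
  endomorphisms yields \<open>\<alpha>\<^sub>0 = 1\<close> and \<open>\<alpha>\<^sub>n\<^sub>+\<^sub>1 = \<beta>\<^sub>n \<alpha>\<^sub>n\<close> such that every element of \<open>K\<close> is killed by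
  some \<open>\<alpha>\<^sub>n\<close>.  The telescoping sum \<open>x = \<Sum> (1 - \<beta>\<^sub>n) \<alpha>\<^sub>n x\<close> factors the identity of \<open>K\<close> through
  a direct sum of copies of \<open>F\<close>, so \<open>K\<close> is projective (\<open>locally_split_projective\<close>).
\<close>

section \<open>Vanishing of sums of tensors\<close>

text \<open>The universal property of the tensor product, for maps that are bilinear and balanced only
  modulo a subgroup \<open>N\<close>.  This form avoids passing to the quotient by \<open>N\<close>.\<close>

lemma tensor_kernel_hom:
  fixes A :: "('r, 'a, 'm) module_scheme" and M :: "('r, 'b, 'n) module_scheme"
    and V :: "('v, 'w) monoid_scheme"
  assumes A: "right_module R A" and M: "left_module R M"
    and V: "comm_group V" and N: "subgroup N V"
    and f: "\<And>x v. \<lbrakk>x \<in> carrier A; v \<in> carrier M\<rbrakk> \<Longrightarrow> f x v \<in> carrier V"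
    and add_left: "\<And>x y v. \<lbrakk>x \<in> carrier A; y \<in> carrier A; v \<in> carrier M\<rbrakk> \<Longrightarrow>
      f (x \<oplus>\<^bsub>A\<^esub> y) v \<otimes>\<^bsub>V\<^esub> inv\<^bsub>V\<^esub> f x v \<otimes>\<^bsub>V\<^esub> inv\<^bsub>V\<^esub> f y v \<in> N"
    and add_right: "\<And>x v w. \<lbrakk>x \<in> carrier A; v \<in> carrier M; w \<in> carrier M\<rbrakk> \<Longrightarrow>
      f x (v \<oplus>\<^bsub>M\<^esub> w) \<otimes>\<^bsub>V\<^esub> inv\<^bsub>V\<^esub> f x v \<otimes>\<^bsub>V\<^esub> inv\<^bsub>V\<^esub> f x w \<in> N"
    and balanced: "\<And>a x v. \<lbrakk>a \<in> carrier R; x \<in> carrier A; v \<in> carrier M\<rbrakk> \<Longrightarrow>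
      f (a \<odot>\<^bsub>A\<^esub> x) v \<otimes>\<^bsub>V\<^esub> inv\<^bsub>V\<^esub> f x (a \<odot>\<^bsub>M\<^esub> v) \<in> N"
  obtains h where "h \<in> hom (free_Abelian_group (carrier A \<times> carrier M)) V"
    and "\<And>x v. \<lbrakk>x \<in> carrier A; v \<in> carrier M\<rbrakk> \<Longrightarrow> h (frag_of (x, v)) = f x v"
    and "\<And>z. z \<in> tensor_kernel R A M \<Longrightarrow> h z \<in> N"
proof -
  interpret A: right_module R A by fact
  interpret M: left_module R M by fact
  interpret V: comm_group V by fact
  interpret N: subgroup N V by fact
  let ?Z = "free_Abelian_group (carrier A \<times> carrier M)"
  obtain h where h: "h \<in> hom ?Z V"
    and h_of: "\<And>p. p \<in> carrier A \<times> carrier M \<Longrightarrow> h (frag_of p) = case_prod f p"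
  proof (rule V.free_Abelian_group_universal)
    show "case_prod f ` (carrier A \<times> carrier M) \<subseteq> carrier V" using f by auto
  qed blast
  interpret h: group_hom ?Z V h
    using h by (simp add: group_hom_def group_hom_axioms_def)
  have h_neg: "h (- z) = inv\<^bsub>V\<^esub> h z" if "z \<in> carrier ?Z" for z
    using h.hom_inv[OF that] that by simp
  have h_diff: "h (z - w) = h z \<otimes>\<^bsub>V\<^esub> inv\<^bsub>V\<^esub> h w" if "z \<in> carrier ?Z" "w \<in> carrier ?Z" for z w
    using h.hom_mult[OF that(1), of "- w"] h_neg[OF that(2)] that(2) by simp
  have frag: "frag_of p \<in> carrier ?Z" if "p \<in> carrier A \<times> carrier M" for p
    using that by simp
  have diff: "z - w \<in> carrier ?Z" if "z \<in> carrier ?Z" "w \<in> carrier ?Z" for z w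
    using that keys_diff[of z w] by auto
  have rel: "h z \<in> N" if z: "z \<in> tensor_relators R A M" for z
    using z[unfolded tensor_relators_def Un_iff mem_Collect_eq]
  proof (elim disjE exE conjE)
    fix x y v assume *: "z = frag_of (x \<oplus>\<^bsub>A\<^esub> y, v) - frag_of (x, v) - frag_of (y, v)"
      "x \<in> carrier A" "y \<in> carrier A" "v \<in> carrier M"
    then show "h z \<in> N"
      using add_left[of x y v] by (simp add: h_diff diff h_of del: carrier_free_Abelian_group_iff add: frag)
  next
    fix x v w assume *: "z = frag_of (x, v \<oplus>\<^bsub>M\<^esub> w) - frag_of (x, v) - frag_of (x, w)"
      "x \<in> carrier A" "v \<in> carrier M" "w \<in> carrier M"
    then show "h z \<in> N"
      using add_right[of x v w] by (simp add: h_diff diff h_of del: carrier_free_Abelian_group_iff add: frag)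
  next
    fix a x v assume *: "z = frag_of (a \<odot>\<^bsub>A\<^esub> x, v) - frag_of (x, a \<odot>\<^bsub>M\<^esub> v)"
      "a \<in> carrier R" "x \<in> carrier A" "v \<in> carrier M"
    then show "h z \<in> N"
      using balanced[of a x v] by (simp add: h_diff h_of del: carrier_free_Abelian_group_iff add: frag)
  qed
  have ker: "z \<in> carrier ?Z \<and> h z \<in> N" if "z \<in> tensor_kernel R A M" for z
    using A M that
  proof (induction rule: tensor_kernel_induct)
    case zero
    then show ?case using h.hom_one by simp
  next
    case (rel z)
    then show ?case using \<open>\<And>z. z \<in> tensor_relators R A M \<Longrightarrow> h z \<in> N\<close> tensor_relators_subset[OF A M] by blast
  next
    case (neg z)
    then show ?case using h_neg by simp
  next
    case (add z w)
    then have "z + w \<in> carrier ?Z" using Poly_Mapping.keys_add[of z w] by auto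
    then show ?case using add h.hom_mult[of z w] by simp
  qed
  show thesis by (rule that[of h]) (use h h_of ker in auto)
qed

definition tuple_group :: "('b, 'n) ring_scheme \<Rightarrow> ('j \<Rightarrow> 'b) monoid"
  where "tuple_group M = \<lparr>carrier = {v. \<forall>j. v j \<in> carrier M}, monoid.mult = (\<lambda>v w j. v j \<oplus>\<^bsub>M\<^esub> w j),
    one = (\<lambda>_. \<zero>\<^bsub>M\<^esub>)\<rparr>"

lemma tuple_group_simps [simp]:
  "v \<in> carrier (tuple_group M) \<longleftrightarrow> (\<forall>j. v j \<in> carrier M)"
  "v \<otimes>\<^bsub>tuple_group M\<^esub> w = (\<lambda>j. v j \<oplus>\<^bsub>M\<^esub> w j)"
  "\<one>\<^bsub>tuple_group M\<^esub> = (\<lambda>_. \<zero>\<^bsub>M\<^esub>)"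
  by (auto simp: tuple_group_def)

context abelian_group begin

lemma sum_minus_summands:
  "\<lbrakk>x \<in> carrier G; y \<in> carrier G\<rbrakk> \<Longrightarrow> x \<oplus> y \<oplus> \<ominus> x \<oplus> \<ominus> y = \<zero>"
  using r_neg[of "x \<oplus> y"] by (simp add: minus_add a_ac)

lemma tuple_comm_group: "comm_group (tuple_group G)"
proof (rule comm_groupI)
  fix x assume "x \<in> carrier (tuple_group G)"
  then show "\<exists>y\<in>carrier (tuple_group G). y \<otimes>\<^bsub>tuple_group G\<^esub> x = \<one>\<^bsub>tuple_group G\<^esub>"
    by (intro bexI[of _ "\<lambda>j. \<ominus> x j"]) (auto simp: l_neg)
qed (auto simp: a_ac)

lemma tuple_inv:
  assumes "\<And>j. v j \<in> carrier G"
  shows "inv\<^bsub>tuple_group G\<^esub> v = (\<lambda>j. \<ominus> v j)"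
  by (rule group.inv_equality[OF comm_group.axioms(2)[OF tuple_comm_group]])
    (use assms in \<open>auto simp: l_neg\<close>)

end

lemma (in left_module) lsmult_minus:
  assumes "a \<in> carrier R" "x \<in> carrier M"
  shows "(\<ominus>\<^bsub>R\<^esub> a) \<odot>\<^bsub>M\<^esub> x = \<ominus>\<^bsub>M\<^esub> (a \<odot>\<^bsub>M\<^esub> x)"
proof -
  have "(\<ominus>\<^bsub>R\<^esub> a) \<odot>\<^bsub>M\<^esub> x \<oplus>\<^bsub>M\<^esub> a \<odot>\<^bsub>M\<^esub> x = (\<ominus>\<^bsub>R\<^esub> a \<oplus>\<^bsub>R\<^esub> a) \<odot>\<^bsub>M\<^esub> x"
    using assms by (simp add: lsmult_l_distr)
  then show ?thesis using assms by (simp add: R.l_neg M.minus_equality)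
qed

lemma (in left_module) lsmult_minus_right:
  assumes "a \<in> carrier R" "x \<in> carrier M"
  shows "a \<odot>\<^bsub>M\<^esub> (\<ominus>\<^bsub>M\<^esub> x) = \<ominus>\<^bsub>M\<^esub> (a \<odot>\<^bsub>M\<^esub> x)"
proof -
  have "a \<odot>\<^bsub>M\<^esub> (\<ominus>\<^bsub>M\<^esub> x) \<oplus>\<^bsub>M\<^esub> a \<odot>\<^bsub>M\<^esub> x = a \<odot>\<^bsub>M\<^esub> (\<ominus>\<^bsub>M\<^esub> x \<oplus>\<^bsub>M\<^esub> x)"
    using assms by (simp add: lsmult_r_distr)
  then show ?thesis using assms by (simp add: M.l_neg M.minus_equality)
qed

context right_module begin

definition rcomb :: "'j set \<Rightarrow> ('j \<Rightarrow> 'b) \<Rightarrow> ('j \<Rightarrow> 'a) \<Rightarrow> 'b"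
  where "rcomb J a b = finsum M (\<lambda>j. b j \<odot>\<^bsub>M\<^esub> a j) J"

context
  fixes J :: "'j set" and a :: "'j \<Rightarrow> 'b"
  assumes J: "finite J" and a: "a \<in> J \<rightarrow> carrier M"
begin

lemma rcomb_family: "j \<in> J \<Longrightarrow> a j \<in> carrier M"
  using a by auto

lemma rcomb_closed: "(\<And>j. b j \<in> carrier R) \<Longrightarrow> rcomb J a b \<in> carrier M"
  unfolding rcomb_def using a by (intro M.finsum_closed) auto

lemma rcomb_add:
  assumes "\<And>j. b j \<in> carrier R" "\<And>j. c j \<in> carrier R"
  shows "rcomb J a (\<lambda>j. b j \<oplus>\<^bsub>R\<^esub> c j) = rcomb J a b \<oplus>\<^bsub>M\<^esub> rcomb J a c"
proof -
  have "rcomb J a (\<lambda>j. b j \<oplus>\<^bsub>R\<^esub> c j) = finsum M (\<lambda>j. b j \<odot>\<^bsub>M\<^esub> a j \<oplus>\<^bsub>M\<^esub> c j \<odot>\<^bsub>M\<^esub> a j) J"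
    unfolding rcomb_def using rcomb_family assms by (intro M.finsum_cong') (auto simp: rsmult_l_distr)
  also have "\<dots> = rcomb J a b \<oplus>\<^bsub>M\<^esub> rcomb J a c"
    unfolding rcomb_def using rcomb_family assms by (intro M.finsum_addf) auto
  finally show ?thesis .
qed

lemma rcomb_mult:
  assumes "\<And>j. b j \<in> carrier R" "r \<in> carrier R"
  shows "rcomb J a (\<lambda>j. b j \<otimes>\<^bsub>R\<^esub> r) = r \<odot>\<^bsub>M\<^esub> rcomb J a b"
proof -
  have "rcomb J a (\<lambda>j. b j \<otimes>\<^bsub>R\<^esub> r) = finsum M (\<lambda>j. r \<odot>\<^bsub>M\<^esub> (b j \<odot>\<^bsub>M\<^esub> a j)) J"
    unfolding rcomb_def using rcomb_family assms by (intro M.finsum_cong') (auto simp: rsmult_assoc)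
  \<comment> \<open>Over the record with empty scalar set, \<^const>\<open>mod_hom\<close> consists of all additive maps.\<close>
  also have "\<dots> = r \<odot>\<^bsub>M\<^esub> rcomb J a b"
    unfolding rcomb_def
    by (rule mod_hom_finsum[of M M _ "R\<lparr>carrier := {}\<rparr>", symmetric])
      (use assms a J in \<open>auto intro!: mod_homI simp: rsmult_r_distr M.abelian_group_axioms\<close>)
  finally show ?thesis .
qed

lemma rcomb_neg:
  assumes "\<And>j. b j \<in> carrier R"
  shows "rcomb J a (\<lambda>j. \<ominus>\<^bsub>R\<^esub> b j) = \<ominus>\<^bsub>M\<^esub> rcomb J a b"
proof -
  have "rcomb J a (\<lambda>j. \<ominus>\<^bsub>R\<^esub> b j) \<oplus>\<^bsub>M\<^esub> rcomb J a b = rcomb J a (\<lambda>j. \<zero>\<^bsub>R\<^esub>)"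
    using assms by (subst rcomb_add[symmetric]) (auto simp: R.l_neg)
  also have "\<dots> = \<zero>\<^bsub>M\<^esub>"
    unfolding rcomb_def using rcomb_family by (intro M.add.finprod_one_eqI) (auto simp: rsmult_zero)
  finally show ?thesis using rcomb_closed assms by (simp add: M.minus_equality)
qed

lemma rcomb_basis:
  assumes "i \<in> J"
  shows "rcomb J a (\<lambda>j. if j = i then \<one>\<^bsub>R\<^esub> else \<zero>\<^bsub>R\<^esub>) = a i"
proof -
  have "rcomb J a (\<lambda>j. if j = i then \<one>\<^bsub>R\<^esub> else \<zero>\<^bsub>R\<^esub>) = finsum M (\<lambda>j. if i = j then a j else \<zero>\<^bsub>M\<^esub>) J"
    unfolding rcomb_def using rcomb_family by (intro M.finsum_cong') (auto simp: rsmult_zero)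
  then show ?thesis using M.finsum_singleton[OF assms J, of a] a rcomb_family by auto
qed

end

end

text \<open>Let \<open>A\<close> be generated by the \<open>a\<^sub>j\<close>, so that \<open>A\<close> is \<open>R\<^sup>J\<close> modulo the syzygies of the \<open>a\<^sub>j\<close>.
  Lifting elements of \<open>A\<close> to coefficient vectors gives a map from \<open>A \<otimes> M\<close> to \<open>M\<^sup>J\<close>, well defined
  modulo every subgroup \<open>N\<close> that contains all \<open>(b\<^sub>j w)\<close> with \<open>b\<close> a syzygy; it sends
  \<open>\<Sum> a\<^sub>j \<otimes> x\<^sub>j\<close> to the tuple \<open>x\<close>.\<close>

lemma generated_tensor_zero:
  fixes A :: "('r, 'a, 'm) module_scheme" and M :: "('r, 'b, 'n) module_scheme"
    and a :: "'j \<Rightarrow> 'a"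
  assumes A: "right_module R A" and M: "left_module R M"
    and J: "finite J" and a: "a \<in> J \<rightarrow> carrier A"
    and gen: "\<And>y. y \<in> carrier A \<Longrightarrow>
      \<exists>b. (\<forall>j. b j \<in> carrier R) \<and> (\<forall>j. j \<notin> J \<longrightarrow> b j = \<zero>\<^bsub>R\<^esub>) \<and> right_module.rcomb A J a b = y"
    and x: "\<And>j. x j \<in> carrier M" and x0: "\<And>j. j \<notin> J \<Longrightarrow> x j = \<zero>\<^bsub>M\<^esub>"
    and zero: "(\<Sum>j\<in>J. frag_of (a j, x j)) \<in> tensor_kernel R A M"
    and N: "subgroup N (tuple_group M)"
    and syz: "\<And>b w. \<lbrakk>\<And>j. b j \<in> carrier R; \<And>j. j \<notin> J \<Longrightarrow> b j = \<zero>\<^bsub>R\<^esub>;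
      right_module.rcomb A J a b = \<zero>\<^bsub>A\<^esub>; w \<in> carrier M\<rbrakk> \<Longrightarrow> (\<lambda>j. b j \<odot>\<^bsub>M\<^esub> w) \<in> N"
  shows "x \<in> N"
proof -
  interpret A: right_module R A by fact
  interpret M: left_module R M by fact
  interpret V: comm_group "tuple_group M :: ('j \<Rightarrow> 'b) monoid" by (rule M.M.tuple_comm_group)
  interpret N: subgroup N "tuple_group M" by fact
  note comb = A.rcomb_closed[OF J a] A.rcomb_add[OF J a] A.rcomb_neg[OF J a] A.rcomb_mult[OF J a]
    A.rcomb_basis[OF J a]
  define \<rho> where "\<rho> y = (SOME b. (\<forall>j. b j \<in> carrier R) \<and> (\<forall>j. j \<notin> J \<longrightarrow> b j = \<zero>\<^bsub>R\<^esub>) \<and>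
    A.rcomb J a b = y)" for y
  have \<rho>: "\<rho> y j \<in> carrier R" "j \<notin> J \<longrightarrow> \<rho> y j = \<zero>\<^bsub>R\<^esub>" "A.rcomb J a (\<rho> y) = y"
    if "y \<in> carrier A" for y j
    using someI_ex[OF gen[OF that]] unfolding \<rho>_def by auto
  define f where "f y v = (\<lambda>j. \<rho> y j \<odot>\<^bsub>M\<^esub> v)" for y v
  note inv = M.M.tuple_inv
  obtain h where h: "h \<in> hom (free_Abelian_group (carrier A \<times> carrier M)) (tuple_group M)"
    and h_of: "\<And>y v. \<lbrakk>y \<in> carrier A; v \<in> carrier M\<rbrakk> \<Longrightarrow> h (frag_of (y, v)) = f y v"
    and h_ker: "\<And>z. z \<in> tensor_kernel R A M \<Longrightarrow> h z \<in> N"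
  proof (rule tensor_kernel_hom[OF A M V.comm_group_axioms N, of f])
    fix y v assume "y \<in> carrier A" "v \<in> carrier M"
    then show "f y v \<in> carrier (tuple_group M)" by (simp add: f_def \<rho>)
  next
    fix y z v assume *: "y \<in> carrier A" "z \<in> carrier A" "v \<in> carrier M"
    have "f (y \<oplus>\<^bsub>A\<^esub> z) v \<otimes>\<^bsub>tuple_group M\<^esub> inv\<^bsub>tuple_group M\<^esub> f y v \<otimes>\<^bsub>tuple_group M\<^esub> inv\<^bsub>tuple_group M\<^esub> f z v
      = (\<lambda>j. (\<rho> (y \<oplus>\<^bsub>A\<^esub> z) j \<oplus>\<^bsub>R\<^esub> \<ominus>\<^bsub>R\<^esub> \<rho> y j \<oplus>\<^bsub>R\<^esub> \<ominus>\<^bsub>R\<^esub> \<rho> z j) \<odot>\<^bsub>M\<^esub> v)"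
      using * by (simp add: f_def \<rho> inv M.lsmult_l_distr M.lsmult_minus)
    also have "\<dots> \<in> N"
      by (rule syz) (use * in \<open>auto simp: \<rho> comb A.M.r_neg A.M.a_assoc A.M.minus_add A.M.a_comm[of y z]\<close>)
    finally show "f (y \<oplus>\<^bsub>A\<^esub> z) v \<otimes>\<^bsub>tuple_group M\<^esub> inv\<^bsub>tuple_group M\<^esub> f y v
      \<otimes>\<^bsub>tuple_group M\<^esub> inv\<^bsub>tuple_group M\<^esub> f z v \<in> N" .
  next
    fix y v w assume *: "y \<in> carrier A" "v \<in> carrier M" "w \<in> carrier M"
    have "f y (v \<oplus>\<^bsub>M\<^esub> w) \<otimes>\<^bsub>tuple_group M\<^esub> inv\<^bsub>tuple_group M\<^esub> f y v \<otimes>\<^bsub>tuple_group M\<^esub> inv\<^bsub>tuple_group M\<^esub> f y w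
      = \<one>\<^bsub>tuple_group M\<^esub>"
      using * by (simp add: f_def \<rho> inv M.lsmult_r_distr M.M.sum_minus_summands)
    then show "f y (v \<oplus>\<^bsub>M\<^esub> w) \<otimes>\<^bsub>tuple_group M\<^esub> inv\<^bsub>tuple_group M\<^esub> f y v
      \<otimes>\<^bsub>tuple_group M\<^esub> inv\<^bsub>tuple_group M\<^esub> f y w \<in> N" using N.one_closed by simp
  next
    fix r y v assume *: "r \<in> carrier R" "y \<in> carrier A" "v \<in> carrier M"
    have "f (r \<odot>\<^bsub>A\<^esub> y) v \<otimes>\<^bsub>tuple_group M\<^esub> inv\<^bsub>tuple_group M\<^esub> f y (r \<odot>\<^bsub>M\<^esub> v)
      = (\<lambda>j. (\<rho> (r \<odot>\<^bsub>A\<^esub> y) j \<oplus>\<^bsub>R\<^esub> \<ominus>\<^bsub>R\<^esub> (\<rho> y j \<otimes>\<^bsub>R\<^esub> r)) \<odot>\<^bsub>M\<^esub> v)"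
      using * by (simp add: f_def \<rho> inv M.lsmult_l_distr M.lsmult_minus M.lsmult_assoc)
    also have "\<dots> \<in> N"
      by (rule syz) (use * in \<open>auto simp: \<rho> comb A.M.r_neg\<close>)
    finally show "f (r \<odot>\<^bsub>A\<^esub> y) v \<otimes>\<^bsub>tuple_group M\<^esub> inv\<^bsub>tuple_group M\<^esub> f y (r \<odot>\<^bsub>M\<^esub> v) \<in> N" .
  qed blast
  have N_add: "(\<lambda>j. v j \<oplus>\<^bsub>M\<^esub> w j) \<in> N" if "v \<in> N" "w \<in> N" for v w
    using N.m_closed[OF that] by simp
  \<comment> \<open>Modulo \<open>N\<close>, the map \<open>h\<close> sends the sum over \<open>S\<close> to the tuple \<open>x\<close> truncated to \<open>S\<close>.\<close>
  have partial_sum: "Poly_Mapping.keys (\<Sum>j\<in>S. frag_of (a j, x j)) \<subseteq> carrier A \<times> carrier M \<and>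
    (\<lambda>j. h (\<Sum>j\<in>S. frag_of (a j, x j)) j \<oplus>\<^bsub>M\<^esub> \<ominus>\<^bsub>M\<^esub> (if j \<in> S then x j else \<zero>\<^bsub>M\<^esub>)) \<in> N"
    if "S \<subseteq> J" for S
    using finite_subset[OF that J] that
  proof (induction S)
    case empty
    have "h 0 = \<one>\<^bsub>tuple_group M\<^esub>"
      using hom_one[OF h group_free_Abelian_group V.is_group] by simp
    then show ?case using N.one_closed by (simp add: M.M.r_neg)
  next
    case (insert i S)
    define z where "z = (\<Sum>j\<in>S. frag_of (a j, x j))"
    have i: "a i \<in> carrier A" using insert a by auto
    have z: "Poly_Mapping.keys z \<subseteq> carrier A \<times> carrier M"
      "(\<lambda>j. h z j \<oplus>\<^bsub>M\<^esub> \<ominus>\<^bsub>M\<^esub> (if j \<in> S then x j else \<zero>\<^bsub>M\<^esub>)) \<in> N"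
      using insert by (auto simp: z_def)
    have hz: "h z j \<in> carrier M" for j
      using hom_in_carrier[OF h, of z] z(1) by simp
    have sum: "(\<Sum>j\<in>insert i S. frag_of (a j, x j)) = frag_of (a i, x i) + z"
      using insert by (simp add: z_def)
    have keys: "Poly_Mapping.keys (frag_of (a i, x i) + z) \<subseteq> carrier A \<times> carrier M"
      using Poly_Mapping.keys_add[of "frag_of (a i, x i)" z] z(1) i x by auto
    have h_sum: "h (frag_of (a i, x i) + z) = (\<lambda>j. \<rho> (a i) j \<odot>\<^bsub>M\<^esub> x i \<oplus>\<^bsub>M\<^esub> h z j)"
      using hom_mult[OF h, of "frag_of (a i, x i)" z] z(1) i x h_of by (simp add: f_def)
    define \<delta> where "\<delta> j = (if j = i then \<one>\<^bsub>R\<^esub> else \<zero>\<^bsub>R\<^esub>)" for j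
    have \<delta>: "\<delta> j \<in> carrier R" for j by (simp add: \<delta>_def)
    have "(\<lambda>j. (\<rho> (a i) j \<oplus>\<^bsub>R\<^esub> \<ominus>\<^bsub>R\<^esub> \<delta> j) \<odot>\<^bsub>M\<^esub> x i) \<in> N"
    proof (rule syz)
      have "A.rcomb J a \<delta> = a i" unfolding \<delta>_def by (rule A.rcomb_basis[OF J a]) (use insert in auto)
      then show "A.rcomb J a (\<lambda>j. \<rho> (a i) j \<oplus>\<^bsub>R\<^esub> \<ominus>\<^bsub>R\<^esub> \<delta> j) = \<zero>\<^bsub>A\<^esub>"
        using i \<delta> by (simp add: comb \<rho> A.M.r_neg)
    qed (use i x \<delta> insert \<rho> in \<open>auto simp: \<delta>_def\<close>)
    from N_add[OF this z(2)]
    have "(\<lambda>j. ((\<rho> (a i) j \<oplus>\<^bsub>R\<^esub> \<ominus>\<^bsub>R\<^esub> \<delta> j) \<odot>\<^bsub>M\<^esub> x i) \<oplus>\<^bsub>M\<^esub>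
      (h z j \<oplus>\<^bsub>M\<^esub> \<ominus>\<^bsub>M\<^esub> (if j \<in> S then x j else \<zero>\<^bsub>M\<^esub>))) \<in> N" .
    also have "(\<lambda>j. ((\<rho> (a i) j \<oplus>\<^bsub>R\<^esub> \<ominus>\<^bsub>R\<^esub> \<delta> j) \<odot>\<^bsub>M\<^esub> x i) \<oplus>\<^bsub>M\<^esub>
      (h z j \<oplus>\<^bsub>M\<^esub> \<ominus>\<^bsub>M\<^esub> (if j \<in> S then x j else \<zero>\<^bsub>M\<^esub>))) =
      (\<lambda>j. \<rho> (a i) j \<odot>\<^bsub>M\<^esub> x i \<oplus>\<^bsub>M\<^esub> h z j \<oplus>\<^bsub>M\<^esub> \<ominus>\<^bsub>M\<^esub> (if j \<in> insert i S then x j else \<zero>\<^bsub>M\<^esub>))"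
    proof
      fix j
      have "(\<rho> (a i) j \<oplus>\<^bsub>R\<^esub> \<ominus>\<^bsub>R\<^esub> \<delta> j) \<odot>\<^bsub>M\<^esub> x i =
        \<rho> (a i) j \<odot>\<^bsub>M\<^esub> x i \<oplus>\<^bsub>M\<^esub> \<ominus>\<^bsub>M\<^esub> (if j = i then x i else \<zero>\<^bsub>M\<^esub>)"
        using \<rho>(1)[OF i] x by (auto simp: \<delta>_def M.lsmult_l_distr M.lsmult_minus)
      moreover have "\<rho> (a i) j \<odot>\<^bsub>M\<^esub> x i \<in> carrier M" using \<rho>(1)[OF i] x by simp
      ultimately show "((\<rho> (a i) j \<oplus>\<^bsub>R\<^esub> \<ominus>\<^bsub>R\<^esub> \<delta> j) \<odot>\<^bsub>M\<^esub> x i) \<oplus>\<^bsub>M\<^esub>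
          (h z j \<oplus>\<^bsub>M\<^esub> \<ominus>\<^bsub>M\<^esub> (if j \<in> S then x j else \<zero>\<^bsub>M\<^esub>)) =
        \<rho> (a i) j \<odot>\<^bsub>M\<^esub> x i \<oplus>\<^bsub>M\<^esub> h z j \<oplus>\<^bsub>M\<^esub> \<ominus>\<^bsub>M\<^esub> (if j \<in> insert i S then x j else \<zero>\<^bsub>M\<^esub>)"
        using hz[of j] x[of j] x[of i] insert.hyps by (auto simp: M.M.a_ac)
    qed
    finally show ?case unfolding sum using keys h_sum by simp
  qed
  have x_eq: "(if j \<in> J then x j else \<zero>\<^bsub>M\<^esub>) = x j" for j using x0 by simp
  have "(\<lambda>j. h (\<Sum>j\<in>J. frag_of (a j, x j)) j \<oplus>\<^bsub>M\<^esub> \<ominus>\<^bsub>M\<^esub> x j) \<in> N"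
    using partial_sum[OF order_refl] unfolding x_eq by (rule conjunct2)
  moreover have "h (\<Sum>j\<in>J. frag_of (a j, x j)) \<in> N" by (rule h_ker[OF zero])
  ultimately have "h (\<Sum>j\<in>J. frag_of (a j, x j)) \<otimes>\<^bsub>tuple_group M\<^esub>
      inv\<^bsub>tuple_group M\<^esub> (\<lambda>j. h (\<Sum>j\<in>J. frag_of (a j, x j)) j \<oplus>\<^bsub>M\<^esub> \<ominus>\<^bsub>M\<^esub> x j) \<in> N" (is "?y \<in> N")
    by (intro N.m_closed N.m_inv_closed)
  moreover have "?y = x"
  proof -
    have "h (\<Sum>j\<in>J. frag_of (a j, x j)) j \<in> carrier M" for j
      using N.mem_carrier[OF h_ker[OF zero]] by simp
    then show ?thesis using x by (simp add: M.M.tuple_inv M.M.minus_add M.M.a_assoc[symmetric] M.M.r_neg)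
  qed
  ultimately show "x \<in> N" by simp
qed

text \<open>If \<open>M\<close> is flat, then a sum that vanishes in \<open>A \<otimes> M\<close> already vanishes in \<open>A' \<otimes> M\<close>, where
  \<open>A'\<close> is the submodule generated by the \<open>a\<^sub>j\<close>.  All
  consequences of flatness below go through this one.\<close>

lemma flat_tensor_zero:
  fixes A :: "('r, 'a, 'm) module_scheme" and M :: "('r, 'b, 'n) module_scheme"
    and a :: "'j \<Rightarrow> 'a"
  assumes flat: "flat_left_module R M" and A: "right_module R A"
    and J: "finite J" and a: "a \<in> J \<rightarrow> carrier A"
    and x: "\<And>j. x j \<in> carrier M" and x0: "\<And>j. j \<notin> J \<Longrightarrow> x j = \<zero>\<^bsub>M\<^esub>"
    and zero: "(\<Sum>j\<in>J. frag_of (a j, x j)) \<in> tensor_kernel R A M"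
    and N: "subgroup N (tuple_group M)"
    and syz: "\<And>b w. \<lbrakk>\<And>j. b j \<in> carrier R; \<And>j. j \<notin> J \<Longrightarrow> b j = \<zero>\<^bsub>R\<^esub>;
      right_module.rcomb A J a b = \<zero>\<^bsub>A\<^esub>; w \<in> carrier M\<rbrakk> \<Longrightarrow> (\<lambda>j. b j \<odot>\<^bsub>M\<^esub> w) \<in> N"
  shows "x \<in> N"
proof -
  interpret A: right_module R A by fact
  have M: "left_module R M" using flat by (simp add: flat_left_module_def)
  interpret M: left_module R M by fact
  note comb = A.rcomb_closed[OF J a] A.rcomb_add[OF J a] A.rcomb_neg[OF J a] A.rcomb_mult[OF J a]
  define S where "S = {A.rcomb J a b | b. (\<forall>j. b j \<in> carrier R) \<and> (\<forall>j. j \<notin> J \<longrightarrow> b j = \<zero>\<^bsub>R\<^esub>)}"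
  have SI: "A.rcomb J a b \<in> S" if "\<And>j. b j \<in> carrier R" "\<And>j. j \<notin> J \<Longrightarrow> b j = \<zero>\<^bsub>R\<^esub>" for b
    using that unfolding S_def by blast
  have S: "A.rsubmodule S"
    unfolding A.rsubmodule_def
  proof (intro conjI ballI)
    show "S \<subseteq> carrier A" using comb(1) by (auto simp: S_def)
    show "\<zero>\<^bsub>A\<^esub> \<in> S"
    proof -
      have "A.rcomb J a (\<lambda>j. \<zero>\<^bsub>R\<^esub> \<otimes>\<^bsub>R\<^esub> \<zero>\<^bsub>R\<^esub>) = \<zero>\<^bsub>A\<^esub>"
        by (subst comb(4)) (simp_all add: comb(1) A.rsmult_zero)
      then show ?thesis using SI[of "\<lambda>j. \<zero>\<^bsub>R\<^esub>"] by simp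
    qed
    fix y z assume "y \<in> S" "z \<in> S"
    then obtain b c where *: "y = A.rcomb J a b" "z = A.rcomb J a c" "\<And>j. b j \<in> carrier R" "\<And>j. c j \<in> carrier R"
      "\<And>j. j \<notin> J \<Longrightarrow> b j = \<zero>\<^bsub>R\<^esub>" "\<And>j. j \<notin> J \<Longrightarrow> c j = \<zero>\<^bsub>R\<^esub>"
      unfolding S_def by blast
    then show "y \<oplus>\<^bsub>A\<^esub> z \<in> S" using SI[of "\<lambda>j. b j \<oplus>\<^bsub>R\<^esub> c j"] comb(2)[of b c] by simp
  next
    fix r y assume "r \<in> carrier R" "y \<in> S"
    then obtain b where *: "y = A.rcomb J a b" "\<And>j. b j \<in> carrier R" "\<And>j. j \<notin> J \<Longrightarrow> b j = \<zero>\<^bsub>R\<^esub>"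
      unfolding S_def by blast
    then show "r \<odot>\<^bsub>A\<^esub> y \<in> S"
      using SI[of "\<lambda>j. b j \<otimes>\<^bsub>R\<^esub> r"] comb(4)[of b r] \<open>r \<in> carrier R\<close> by simp
  qed
  let ?B = "A\<lparr>carrier := S\<rparr>"
  have B: "right_module R ?B" by (rule A.rsubmodule_right_module[OF S])
  interpret B: right_module R ?B by fact
  have aS: "a j \<in> S" if "j \<in> J" for j
    unfolding A.rcomb_basis[OF J a that, symmetric] by (rule SI) (use that in auto)
  have incl: "(\<lambda>y. y) \<in> mod_hom R ?B A"
    using S by (intro mod_homI) (auto simp: A.rsubmodule_def)
  define z where "z = (\<Sum>j\<in>J. frag_of (a j, x j))"
  have "Poly_Mapping.keys z \<subseteq> (\<Union>j\<in>J. Poly_Mapping.keys (frag_of (a j, x j)))"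
    unfolding z_def by (rule keys_sum)
  then have keys: "Poly_Mapping.keys z \<subseteq> S \<times> carrier M" using aS x by auto
  have inj: "inj_on (tensor_map R ?B A M (\<lambda>y. y)) (carrier (tensor_prod R ?B M))"
    by (rule flat_left_module_inj[OF flat B A incl]) auto
  have "tensor_push (\<lambda>y. y) z = z" by (rule tensor_push_ident[OF keys]) simp
  then have zB: "z \<in> tensor_kernel R ?B M"
    using inj keys zero unfolding tensor_map_inj_iff[OF B A M incl] by (simp add: z_def)
  have rcomb_eq: "B.rcomb J a b = A.rcomb J a b" if "\<And>j. b j \<in> carrier R" for b
  proof -
    have "(\<lambda>y. y) (finsum ?B (\<lambda>j. b j \<odot>\<^bsub>?B\<^esub> a j) J) = finsum A (\<lambda>j. b j \<odot>\<^bsub>?B\<^esub> a j) J"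
      by (rule mod_hom_finsum[OF B.M.abelian_group_axioms A.M.abelian_group_axioms incl J])
        (use that aS S in \<open>auto simp: A.rsubmodule_def\<close>)
    then show ?thesis by (simp add: A.rcomb_def B.rcomb_def)
  qed
  show ?thesis
  proof (rule generated_tensor_zero[OF B M J, of a x])
    fix y assume "y \<in> carrier ?B"
    then show "\<exists>b. (\<forall>j. b j \<in> carrier R) \<and> (\<forall>j. j \<notin> J \<longrightarrow> b j = \<zero>\<^bsub>R\<^esub>) \<and> B.rcomb J a b = y"
      using rcomb_eq by (auto simp: S_def)
  next
    show "(\<Sum>j\<in>J. frag_of (a j, x j)) \<in> tensor_kernel R ?B M" using zB by (simp add: z_def)
  qed (use aS x x0 N syz rcomb_eq in auto)
qed

section \<open>Ring epimorphisms and the tensor square\<close>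

text \<open>The functions are extensional so that equality in the ring is equality of functions.\<close>

definition endo_ring :: "('g, 'n) monoid_scheme \<Rightarrow> ('g \<Rightarrow> 'g) ring"
  where "endo_ring G = \<lparr>carrier = hom G G \<inter> extensional (carrier G),
    monoid.mult = (\<lambda>\<phi> \<psi>. \<lambda>x\<in>carrier G. \<phi> (\<psi> x)), one = (\<lambda>x\<in>carrier G. x),
    ring.zero = (\<lambda>x\<in>carrier G. \<one>\<^bsub>G\<^esub>), add = (\<lambda>\<phi> \<psi>. \<lambda>x\<in>carrier G. \<phi> x \<otimes>\<^bsub>G\<^esub> \<psi> x)\<rparr>"

lemma (in comm_group) endo_ring: "ring (endo_ring G)"
proof -
  have hom_app: "\<phi> x \<in> carrier G" "\<phi> (x \<otimes> y) = \<phi> x \<otimes> \<phi> y" "\<phi> \<one> = \<one>"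
    if "\<phi> \<in> carrier (endo_ring G)" "x \<in> carrier G" "y \<in> carrier G" for \<phi> x y
    using that hom_one[of \<phi> G] is_group by (auto simp: endo_ring_def hom_def Pi_def)
  have endoI: "restrict \<phi> (carrier G) \<in> carrier (endo_ring G)"
    if "\<And>x. x \<in> carrier G \<Longrightarrow> \<phi> x \<in> carrier G"
      "\<And>x y. \<lbrakk>x \<in> carrier G; y \<in> carrier G\<rbrakk> \<Longrightarrow> \<phi> (x \<otimes> y) = \<phi> x \<otimes> \<phi> y" for \<phi>
    using that by (auto simp: endo_ring_def hom_def)
  have eqI: "\<phi> = \<psi>" if "\<phi> \<in> carrier (endo_ring G)" "\<psi> \<in> carrier (endo_ring G)"
    "\<And>x. x \<in> carrier G \<Longrightarrow> \<phi> x = \<psi> x" for \<phi> \<psi>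
    using that by (intro extensionalityI[of \<phi> "carrier G" \<psi>]) (auto simp: endo_ring_def)
  have add_eq: "\<phi> \<oplus>\<^bsub>endo_ring G\<^esub> \<psi> = (\<lambda>x\<in>carrier G. \<phi> x \<otimes> \<psi> x)"
    and mult_eq: "\<phi> \<otimes>\<^bsub>endo_ring G\<^esub> \<psi> = (\<lambda>x\<in>carrier G. \<phi> (\<psi> x))"
    and zero_eq: "\<zero>\<^bsub>endo_ring G\<^esub> = (\<lambda>x\<in>carrier G. \<one>)"
    and one_eq: "\<one>\<^bsub>endo_ring G\<^esub> = (\<lambda>x\<in>carrier G. x)" for \<phi> \<psi>
    by (simp_all add: endo_ring_def)
  have zero: "\<zero>\<^bsub>endo_ring G\<^esub> \<in> carrier (endo_ring G)"
    unfolding zero_eq by (rule endoI) auto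
  have one: "\<one>\<^bsub>endo_ring G\<^esub> \<in> carrier (endo_ring G)"
    unfolding one_eq by (rule endoI) auto
  have add: "\<phi> \<oplus>\<^bsub>endo_ring G\<^esub> \<psi> \<in> carrier (endo_ring G)"
    if "\<phi> \<in> carrier (endo_ring G)" "\<psi> \<in> carrier (endo_ring G)" for \<phi> \<psi>
    unfolding add_eq by (rule endoI) (use that in \<open>auto simp: hom_app m_ac\<close>)
  have mult: "\<phi> \<otimes>\<^bsub>endo_ring G\<^esub> \<psi> \<in> carrier (endo_ring G)"
    if "\<phi> \<in> carrier (endo_ring G)" "\<psi> \<in> carrier (endo_ring G)" for \<phi> \<psi>
    unfolding mult_eq by (rule endoI) (use that in \<open>auto simp: hom_app\<close>)
  have "abelian_group (endo_ring G)"
  proof (rule abelian_groupI)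
    fix \<phi> assume \<phi>: "\<phi> \<in> carrier (endo_ring G)"
    have "(\<lambda>x\<in>carrier G. inv (\<phi> x)) \<in> carrier (endo_ring G)"
      by (rule endoI) (use \<phi> in \<open>auto simp: hom_app inv_mult\<close>)
    moreover from this have "(\<lambda>x\<in>carrier G. inv (\<phi> x)) \<oplus>\<^bsub>endo_ring G\<^esub> \<phi> = \<zero>\<^bsub>endo_ring G\<^esub>"
      by (intro eqI add zero \<phi>) (use \<phi> in \<open>auto simp: add_eq zero_eq hom_app\<close>)
    ultimately show "\<exists>\<psi>\<in>carrier (endo_ring G). \<psi> \<oplus>\<^bsub>endo_ring G\<^esub> \<phi> = \<zero>\<^bsub>endo_ring G\<^esub>"
      by blast
  next
    fix \<phi> \<psi> \<chi> assume *: "\<phi> \<in> carrier (endo_ring G)" "\<psi> \<in> carrier (endo_ring G)" "\<chi> \<in> carrier (endo_ring G)"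
    then show "\<phi> \<oplus>\<^bsub>endo_ring G\<^esub> \<psi> \<oplus>\<^bsub>endo_ring G\<^esub> \<chi> = \<phi> \<oplus>\<^bsub>endo_ring G\<^esub> (\<psi> \<oplus>\<^bsub>endo_ring G\<^esub> \<chi>)"
      by (intro eqI add) (auto simp: add_eq hom_app m_assoc)
  next
    fix \<phi> \<psi> assume *: "\<phi> \<in> carrier (endo_ring G)" "\<psi> \<in> carrier (endo_ring G)"
    then show "\<phi> \<oplus>\<^bsub>endo_ring G\<^esub> \<psi> = \<psi> \<oplus>\<^bsub>endo_ring G\<^esub> \<phi>"
      by (intro eqI add) (auto simp: add_eq hom_app m_comm)
  next
    fix \<phi> assume *: "\<phi> \<in> carrier (endo_ring G)"
    then show "\<zero>\<^bsub>endo_ring G\<^esub> \<oplus>\<^bsub>endo_ring G\<^esub> \<phi> = \<phi>"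
      by (intro eqI add zero) (auto simp: add_eq zero_eq hom_app)
  qed (auto intro: zero add)
  moreover have "monoid (endo_ring G)"
  proof (rule monoidI)
    fix \<phi> \<psi> \<chi> assume *: "\<phi> \<in> carrier (endo_ring G)" "\<psi> \<in> carrier (endo_ring G)" "\<chi> \<in> carrier (endo_ring G)"
    then show "\<phi> \<otimes>\<^bsub>endo_ring G\<^esub> \<psi> \<otimes>\<^bsub>endo_ring G\<^esub> \<chi> = \<phi> \<otimes>\<^bsub>endo_ring G\<^esub> (\<psi> \<otimes>\<^bsub>endo_ring G\<^esub> \<chi>)"
      by (intro eqI mult) (auto simp: mult_eq hom_app)
  next
    fix \<phi> assume *: "\<phi> \<in> carrier (endo_ring G)"
    then show "\<one>\<^bsub>endo_ring G\<^esub> \<otimes>\<^bsub>endo_ring G\<^esub> \<phi> = \<phi>" "\<phi> \<otimes>\<^bsub>endo_ring G\<^esub> \<one>\<^bsub>endo_ring G\<^esub> = \<phi>"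
      by (intro eqI mult one; auto simp: mult_eq one_eq hom_app)+
  qed (auto intro: one mult)
  ultimately show ?thesis
  proof (rule ringI)
    fix \<phi> \<psi> \<chi> assume *: "\<phi> \<in> carrier (endo_ring G)" "\<psi> \<in> carrier (endo_ring G)" "\<chi> \<in> carrier (endo_ring G)"
    then show "(\<phi> \<oplus>\<^bsub>endo_ring G\<^esub> \<psi>) \<otimes>\<^bsub>endo_ring G\<^esub> \<chi> =
        \<phi> \<otimes>\<^bsub>endo_ring G\<^esub> \<chi> \<oplus>\<^bsub>endo_ring G\<^esub> \<psi> \<otimes>\<^bsub>endo_ring G\<^esub> \<chi>"
      by (intro eqI mult add) (auto simp: mult_eq add_eq hom_app)
    show "\<chi> \<otimes>\<^bsub>endo_ring G\<^esub> (\<phi> \<oplus>\<^bsub>endo_ring G\<^esub> \<psi>) =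
        \<chi> \<otimes>\<^bsub>endo_ring G\<^esub> \<phi> \<oplus>\<^bsub>endo_ring G\<^esub> \<chi> \<otimes>\<^bsub>endo_ring G\<^esub> \<psi>"
      using * by (intro eqI mult add) (auto simp: mult_eq add_eq hom_app)
  qed
qed

text \<open>Between left \<open>U\<close>-modules, an \<open>R\<close>-linear map \<open>D : V \<rightarrow> W\<close> is \<open>U\<close>-linear.  The action of \<open>U\<close> on
  \<open>V \<times> W\<close> and its conjugate by the automorphism \<open>(v, w) \<mapsto> (v, w + D v)\<close> are two ring homomorphisms
  from \<open>U\<close> to the endomorphisms of the abelian group \<open>V \<times> W\<close>.  They agree on \<open>u(R)\<close>, hence on
  \<open>U\<close>.\<close>

lemma epimorphism_linear:
  fixes R :: "('r, 's) ring_scheme" and U :: "('u, 't) ring_scheme"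
    and V :: "('u, 'v, 'm) module_scheme" and W :: "('u, 'w, 'n) module_scheme"
  assumes epi: "ring_epimorphism R U u" and V: "left_module U V" and W: "left_module U W"
    and D_closed: "\<And>v. v \<in> carrier V \<Longrightarrow> D v \<in> carrier W"
    and D_add: "\<And>v w. \<lbrakk>v \<in> carrier V; w \<in> carrier V\<rbrakk> \<Longrightarrow> D (v \<oplus>\<^bsub>V\<^esub> w) = D v \<oplus>\<^bsub>W\<^esub> D w"
    and D_smult: "\<And>r v. \<lbrakk>r \<in> carrier R; v \<in> carrier V\<rbrakk> \<Longrightarrow> D (u r \<odot>\<^bsub>V\<^esub> v) = u r \<odot>\<^bsub>W\<^esub> D v"
    and x: "x \<in> carrier U" and v: "v \<in> carrier V"
  shows "D (x \<odot>\<^bsub>V\<^esub> v) = x \<odot>\<^bsub>W\<^esub> D v"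
proof -
  interpret V: left_module U V by fact
  interpret W: left_module U W by fact
  have u: "u r \<in> carrier U" if "r \<in> carrier R" for r
    using epi that ring_hom_closed[of u R U r] by (simp add: ring_epimorphism_def)
  define G where "G = add_monoid V \<times>\<times> add_monoid W"
  interpret G: comm_group G
  proof (rule group.group_comm_groupI)
    show "group G" unfolding G_def by (intro DirProd_group V.M.a_group W.M.a_group)
  qed (auto simp: G_def V.M.a_comm W.M.a_comm)
  define f where "f x = (\<lambda>(v, w)\<in>carrier G. (x \<odot>\<^bsub>V\<^esub> v, x \<odot>\<^bsub>W\<^esub> w))" for x
  define g where "g x = (\<lambda>(v, w)\<in>carrier G.
    (x \<odot>\<^bsub>V\<^esub> v, x \<odot>\<^bsub>W\<^esub> w \<oplus>\<^bsub>W\<^esub> (D (x \<odot>\<^bsub>V\<^esub> v) \<oplus>\<^bsub>W\<^esub> \<ominus>\<^bsub>W\<^esub> (x \<odot>\<^bsub>W\<^esub> D v))))" for x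
  have f: "f \<in> ring_hom U (endo_ring G)"
    by (rule ring_hom_memI)
      (auto simp: f_def G_def endo_ring_def hom_def V.lsmult_l_distr V.lsmult_r_distr V.lsmult_assoc
        W.lsmult_l_distr W.lsmult_r_distr W.lsmult_assoc intro!: restrict_ext)
  have neg_smult: "x \<odot>\<^bsub>W\<^esub> (\<ominus>\<^bsub>W\<^esub> w) = \<ominus>\<^bsub>W\<^esub> (x \<odot>\<^bsub>W\<^esub> w)" if "x \<in> carrier U" "w \<in> carrier W" for x w
  proof -
    have "x \<odot>\<^bsub>W\<^esub> (\<ominus>\<^bsub>W\<^esub> w) \<oplus>\<^bsub>W\<^esub> x \<odot>\<^bsub>W\<^esub> w = x \<odot>\<^bsub>W\<^esub> (\<ominus>\<^bsub>W\<^esub> w \<oplus>\<^bsub>W\<^esub> w)"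
      using that by (simp add: W.lsmult_r_distr)
    then show ?thesis using that by (simp add: W.M.l_neg W.M.minus_equality)
  qed
  \<comment> \<open>The failure of \<open>D\<close> to commute with \<open>x\<close>: a derivation in \<open>x\<close>, which makes \<open>g\<close> multiplicative.\<close>
  define E where "E x v = D (x \<odot>\<^bsub>V\<^esub> v) \<oplus>\<^bsub>W\<^esub> \<ominus>\<^bsub>W\<^esub> (x \<odot>\<^bsub>W\<^esub> D v)" for x v
  have E_closed: "E x v \<in> carrier W" if "x \<in> carrier U" "v \<in> carrier V" for x v
    using that D_closed by (simp add: E_def)
  have E_add: "E x (v \<oplus>\<^bsub>V\<^esub> w) = E x v \<oplus>\<^bsub>W\<^esub> E x w"
    if "x \<in> carrier U" "v \<in> carrier V" "w \<in> carrier V" for x v w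
    using that D_closed by (simp add: E_def V.lsmult_r_distr W.lsmult_r_distr D_add W.M.minus_add W.M.a_ac)
  have E_plus: "E (x \<oplus>\<^bsub>U\<^esub> y) v = E x v \<oplus>\<^bsub>W\<^esub> E y v"
    if "x \<in> carrier U" "y \<in> carrier U" "v \<in> carrier V" for x y v
    using that D_closed by (simp add: E_def V.lsmult_l_distr W.lsmult_l_distr D_add W.M.minus_add W.M.a_ac)
  have E_mult: "E (x \<otimes>\<^bsub>U\<^esub> y) v = E x (y \<odot>\<^bsub>V\<^esub> v) \<oplus>\<^bsub>W\<^esub> x \<odot>\<^bsub>W\<^esub> E y v"
    if "x \<in> carrier U" "y \<in> carrier U" "v \<in> carrier V" for x y v
    using that D_closed
    by (simp add: E_def V.lsmult_assoc W.lsmult_assoc W.lsmult_r_distr neg_smult W.M.a_assoc W.M.r_neg1)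
  have E_one: "E \<one>\<^bsub>U\<^esub> v = \<zero>\<^bsub>W\<^esub>" if "v \<in> carrier V" for v
    using that D_closed by (simp add: E_def W.M.r_neg)
  have g_eq: "g x = (\<lambda>(v, w)\<in>carrier G. (x \<odot>\<^bsub>V\<^esub> v, x \<odot>\<^bsub>W\<^esub> w \<oplus>\<^bsub>W\<^esub> E x v))" for x
    by (simp add: g_def E_def)
  have g: "g \<in> ring_hom U (endo_ring G)"
  proof (rule ring_hom_memI)
    fix x assume x: "x \<in> carrier U"
    then show "g x \<in> carrier (endo_ring G)"
      by (auto simp: g_eq G_def endo_ring_def hom_def V.lsmult_r_distr W.lsmult_r_distr E_closed E_add W.M.a_ac)
    fix y assume y: "y \<in> carrier U"
    show "g (x \<otimes>\<^bsub>U\<^esub> y) = g x \<otimes>\<^bsub>endo_ring G\<^esub> g y"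
      using x y by (auto simp: g_eq G_def endo_ring_def V.lsmult_assoc W.lsmult_assoc W.lsmult_r_distr
        E_closed E_mult W.M.a_ac intro!: restrict_ext)
    show "g (x \<oplus>\<^bsub>U\<^esub> y) = g x \<oplus>\<^bsub>endo_ring G\<^esub> g y"
      using x y by (auto simp: g_eq G_def endo_ring_def V.lsmult_l_distr W.lsmult_l_distr
        E_closed E_plus W.M.a_ac intro!: restrict_ext)
  next
    show "g \<one>\<^bsub>U\<^esub> = \<one>\<^bsub>endo_ring G\<^esub>"
      by (auto simp: g_eq G_def endo_ring_def E_one intro!: restrict_ext)
  qed
  have "f x = g x"
  proof (rule ring_epimorphism_cancel[OF epi G.endo_ring f g _ x])
    fix r assume "r \<in> carrier R"
    then show "f (u r) = g (u r)"
      by (auto simp: f_def g_def G_def D_smult u D_closed W.M.r_neg intro!: restrict_ext)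
  qed
  moreover have "(v, \<zero>\<^bsub>W\<^esub>) \<in> carrier G" using v by (simp add: G_def)
  ultimately have "f x (v, \<zero>\<^bsub>W\<^esub>) = g x (v, \<zero>\<^bsub>W\<^esub>)" by simp
  then have "D (x \<odot>\<^bsub>V\<^esub> v) \<oplus>\<^bsub>W\<^esub> \<ominus>\<^bsub>W\<^esub> (x \<odot>\<^bsub>W\<^esub> D v) = \<zero>\<^bsub>W\<^esub>"
    using x v D_closed by (simp add: f_def g_def G_def)
  then show ?thesis
    using x v D_closed W.M.r_neg2 W.M.minus_equality[of "D (x \<odot>\<^bsub>V\<^esub> v)" "\<ominus>\<^bsub>W\<^esub> (x \<odot>\<^bsub>W\<^esub> D v)"] by simp
qed

lemma tensor_prod_carrier:
  "carrier (tensor_prod R A M) =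
    {tensor_kernel R A M #>\<^bsub>free_Abelian_group (carrier A \<times> carrier M)\<^esub> z | z.
      Poly_Mapping.keys z \<subseteq> carrier A \<times> carrier M}"
  by (auto simp: tensor_prod_def FactGroup_def RCOSETS_def)

lemma tensor_coset_eq:
  assumes A: "right_module R A" and M: "left_module R M"
    and z: "Poly_Mapping.keys z \<subseteq> carrier A \<times> carrier M"
    and w: "Poly_Mapping.keys w \<subseteq> carrier A \<times> carrier M"
  shows "tensor_kernel R A M #>\<^bsub>free_Abelian_group (carrier A \<times> carrier M)\<^esub> z =
    tensor_kernel R A M #>\<^bsub>free_Abelian_group (carrier A \<times> carrier M)\<^esub> w
    \<longleftrightarrow> z - w \<in> tensor_kernel R A M"
proof -
  let ?Z = "free_Abelian_group (carrier A \<times> carrier M)"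
  have "subgroup (tensor_kernel R A M) ?Z" by (rule tensor_kernel_subgroup[OF A M])
  then have "tensor_kernel R A M #>\<^bsub>?Z\<^esub> z = tensor_kernel R A M #>\<^bsub>?Z\<^esub> w \<longleftrightarrow>
      z \<in> tensor_kernel R A M #>\<^bsub>?Z\<^esub> w"
    using z w group.repr_independence[OF group_free_Abelian_group, of z]
      group.rcos_self[OF group_free_Abelian_group, of z] by (metis carrier_free_Abelian_group_iff)
  also have "\<dots> \<longleftrightarrow> z - w \<in> tensor_kernel R A M"
    by (auto simp: r_coset_def intro!: bexI[of _ "z - w"])
  finally show ?thesis .
qed

lemma tensor_kernel_bilinear:
  shows "\<lbrakk>x \<in> carrier A; y \<in> carrier A; v \<in> carrier M\<rbrakk> \<Longrightarrow>
      frag_of (x \<oplus>\<^bsub>A\<^esub> y, v) - frag_of (x, v) - frag_of (y, v) \<in> tensor_kernel R A M"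
    and "\<lbrakk>x \<in> carrier A; v \<in> carrier M; w \<in> carrier M\<rbrakk> \<Longrightarrow>
      frag_of (x, v \<oplus>\<^bsub>M\<^esub> w) - frag_of (x, v) - frag_of (x, w) \<in> tensor_kernel R A M"
    and "\<lbrakk>a \<in> carrier R; x \<in> carrier A; v \<in> carrier M\<rbrakk> \<Longrightarrow>
      frag_of (a \<odot>\<^bsub>A\<^esub> x, v) - frag_of (x, a \<odot>\<^bsub>M\<^esub> v) \<in> tensor_kernel R A M"
  by (rule tensor_relators_kernel, unfold tensor_relators_def, blast)+

text \<open>The right-module counterpart of \<^const>\<open>restrict_scalars\<close>; with \<open>u\<close> the identity it is \<open>R\<close> as
  a right module over itself.\<close>

definition right_restrict_scalars ::
  "('u, 't) ring_scheme \<Rightarrow> ('r \<Rightarrow> 'u) \<Rightarrow> ('r, 'u) module"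
  where "right_restrict_scalars U u = \<lparr>carrier = carrier U, monoid.mult = (\<otimes>\<^bsub>U\<^esub>), one = \<one>\<^bsub>U\<^esub>,
    ring.zero = \<zero>\<^bsub>U\<^esub>, add = (\<oplus>\<^bsub>U\<^esub>), smult = (\<lambda>r x. x \<otimes>\<^bsub>U\<^esub> u r)\<rparr>"

lemma restrict_scalars_simps [simp]:
  "carrier (restrict_scalars U u) = carrier U" "\<zero>\<^bsub>restrict_scalars U u\<^esub> = \<zero>\<^bsub>U\<^esub>"
  "x \<oplus>\<^bsub>restrict_scalars U u\<^esub> y = x \<oplus>\<^bsub>U\<^esub> y" "r \<odot>\<^bsub>restrict_scalars U u\<^esub> x = u r \<otimes>\<^bsub>U\<^esub> x"
  "carrier (right_restrict_scalars U u) = carrier U" "\<zero>\<^bsub>right_restrict_scalars U u\<^esub> = \<zero>\<^bsub>U\<^esub>"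
  "x \<oplus>\<^bsub>right_restrict_scalars U u\<^esub> y = x \<oplus>\<^bsub>U\<^esub> y" "r \<odot>\<^bsub>right_restrict_scalars U u\<^esub> x = x \<otimes>\<^bsub>U\<^esub> u r"
  by (simp_all add: restrict_scalars_def right_restrict_scalars_def)

context
  fixes R :: "('r, 's) ring_scheme" and U :: "('u, 't) ring_scheme" and u :: "'r \<Rightarrow> 'u"
  assumes R: "ring R" and U: "ring U" and u: "u \<in> ring_hom R U"
begin

interpretation R: ring R by (rule R)
interpretation U: ring U by (rule U)

lemma neg_exists: "x \<in> carrier U \<Longrightarrow> \<exists>y\<in>carrier U. y \<oplus>\<^bsub>U\<^esub> x = \<zero>\<^bsub>U\<^esub>"
  using U.l_neg U.a_inv_closed by blast

lemma restrict_scalars_left_module: "left_module R (restrict_scalars U u)"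
proof -
  have "abelian_group (restrict_scalars U u)"
    by (rule abelian_groupI) (auto simp: U.a_ac neg_exists)
  then show ?thesis
    by (intro left_module.intro left_module_axioms.intro R)
      (auto simp: ring_hom_closed[OF u] ring_hom_add[OF u] ring_hom_mult[OF u] ring_hom_one[OF u]
        U.l_distr U.r_distr U.m_assoc)
qed

lemma right_restrict_scalars_right_module: "right_module R (right_restrict_scalars U u)"
proof -
  have "abelian_group (right_restrict_scalars U u)"
    by (rule abelian_groupI) (auto simp: U.a_ac neg_exists)
  then show ?thesis
    by (intro right_module.intro right_module_axioms.intro R)
      (auto simp: ring_hom_closed[OF u] ring_hom_add[OF u] ring_hom_mult[OF u] ring_hom_one[OF u]
        U.l_distr U.r_distr U.m_assoc)
qed

end

text \<open>The map \<open>y \<mapsto> 1 \<otimes> y\<close> from \<open>U\<close> to \<open>U \<otimes>\<^sub>R U\<close> is left \<open>R\<close>-linear, because the tensor product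
  is balanced over \<open>R\<close>.  By \<open>epimorphism_linear\<close> it is \<open>U\<close>-linear for the action on the left factor, so
  \<open>1 \<otimes> x = x (1 \<otimes> 1) = x \<otimes> 1\<close>.\<close>

lemma epimorphism_tensor_commute:
  fixes R :: "('r, 's) ring_scheme" and U :: "('u, 't) ring_scheme"
  assumes epi: "ring_epimorphism R U u" and x: "x \<in> carrier U"
  shows "frag_of (x, \<one>\<^bsub>U\<^esub>) - frag_of (\<one>\<^bsub>U\<^esub>, x) \<in>
    tensor_kernel R (right_restrict_scalars U u) (restrict_scalars U u)"
proof -
  have R: "ring R" and U: "ring U" and u: "u \<in> ring_hom R U"
    using epi by (auto simp: ring_epimorphism_def)
  interpret U: ring U by fact
  define A where "A = right_restrict_scalars U u"
  define M where "M = restrict_scalars U u"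
  have A: "right_module R A" unfolding A_def by (rule right_restrict_scalars_right_module[OF R U u])
  have M: "left_module R M" unfolding M_def by (rule restrict_scalars_left_module[OF R U u])
  have carr [simp]: "carrier A = carrier U" "carrier M = carrier U" by (simp_all add: A_def M_def)
  let ?Z = "free_Abelian_group (carrier U \<times> carrier U)"
  let ?K = "tensor_kernel R A M"
  define cl where "cl z = ?K #>\<^bsub>?Z\<^esub> z" for z
  define W where "W = \<lparr>carrier = carrier (tensor_prod R A M), monoid.mult = (\<otimes>\<^bsub>tensor_prod R A M\<^esub>), one = ?K,
    ring.zero = ?K, add = (\<otimes>\<^bsub>tensor_prod R A M\<^esub>), smult = (\<lambda>x. tensor_map R A A M (\<lambda>y. x \<otimes>\<^bsub>U\<^esub> y))\<rparr>"
  have K: "subgroup ?K ?Z" using tensor_kernel_subgroup[OF A M] by simp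
  interpret Z: comm_group ?Z by (rule abelian_free_Abelian_group)
  have normal: "?K \<lhd> ?Z" by (rule Z.subgroup_imp_normal[OF K])
  have W_carrier: "carrier W = {cl z | z. Poly_Mapping.keys z \<subseteq> carrier U \<times> carrier U}"
    by (simp add: W_def tensor_prod_carrier cl_def)
  have W_add: "cl z \<oplus>\<^bsub>W\<^esub> cl w = cl (z + w)"
    if "Poly_Mapping.keys z \<subseteq> carrier U \<times> carrier U" "Poly_Mapping.keys w \<subseteq> carrier U \<times> carrier U" for z w
    using normal.rcos_sum[OF normal, of z w] that
    by (simp add: W_def tensor_prod_def cl_def)
  have W_zero: "\<zero>\<^bsub>W\<^esub> = cl 0"
    using Z.coset_mult_one[of ?K] subgroup.subset[OF K] by (simp add: W_def cl_def)
  have cl_eq: "cl z = cl w \<longleftrightarrow> z - w \<in> ?K"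
    if "Poly_Mapping.keys z \<subseteq> carrier U \<times> carrier U" "Poly_Mapping.keys w \<subseteq> carrier U \<times> carrier U" for z w
    using tensor_coset_eq[OF A M, of z w] that by (simp add: cl_def)
  have left_mult: "(\<lambda>y. x \<otimes>\<^bsub>U\<^esub> y) \<in> mod_hom R A A" if "x \<in> carrier U" for x
    using that ring_hom_closed[OF u] by (intro mod_homI) (auto simp: A_def U.r_distr U.m_assoc)
  have W_smult: "x \<odot>\<^bsub>W\<^esub> cl z = cl (tensor_push (\<lambda>y. x \<otimes>\<^bsub>U\<^esub> y) z)"
    if "x \<in> carrier U" "Poly_Mapping.keys z \<subseteq> carrier U \<times> carrier U" for x z
    using tensor_map_coset[OF A A M left_mult[OF that(1)], of z] that
    by (simp add: W_def cl_def)
  have keys: "Poly_Mapping.keys (tensor_push (\<lambda>y. x \<otimes>\<^bsub>U\<^esub> y) z) \<subseteq> carrier U \<times> carrier U"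
    if "x \<in> carrier U" "Poly_Mapping.keys z \<subseteq> carrier U \<times> carrier U" for x z
    by (rule tensor_push_keys[OF that(2)]) (use that in auto)
  have keys_add: "Poly_Mapping.keys (z + w) \<subseteq> carrier U \<times> carrier U"
    if "Poly_Mapping.keys z \<subseteq> carrier U \<times> carrier U" "Poly_Mapping.keys w \<subseteq> carrier U \<times> carrier U"
    for z w :: "'u \<times> 'u \<Rightarrow>\<^sub>0 int"
    using that Poly_Mapping.keys_add[of z w] by blast
  have clI: "cl z \<in> carrier W" if "Poly_Mapping.keys z \<subseteq> carrier U \<times> carrier U" for z
    using that unfolding W_carrier by blast
  have W: "left_module U W"
  proof (intro left_module.intro left_module_axioms.intro U)
    show "abelian_group W"
    proof (rule abelian_groupI)
      fix c assume "c \<in> carrier W"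
      then obtain z where z: "c = cl z" "Poly_Mapping.keys z \<subseteq> carrier U \<times> carrier U"
        unfolding W_carrier by blast
      then show "\<exists>d\<in>carrier W. d \<oplus>\<^bsub>W\<^esub> c = \<zero>\<^bsub>W\<^esub>"
        by (intro bexI[of _ "cl (- z)"]) (auto simp: W_add W_zero W_carrier intro!: exI[of _ "- z"])
    next
      fix c d assume "c \<in> carrier W" "d \<in> carrier W"
      then obtain z w where "c = cl z" "d = cl w" "Poly_Mapping.keys z \<subseteq> carrier U \<times> carrier U"
        "Poly_Mapping.keys w \<subseteq> carrier U \<times> carrier U"
        unfolding W_carrier by blast
      then show "c \<oplus>\<^bsub>W\<^esub> d \<in> carrier W"
        using clI[OF keys_add[of z w]] by (simp add: W_add)
    qed (auto simp: W_carrier W_add W_zero keys_add add_ac intro: exI[of _ 0])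
  next
    fix x c assume x: "x \<in> carrier U" and "c \<in> carrier W"
    then obtain z where z: "c = cl z" "Poly_Mapping.keys z \<subseteq> carrier U \<times> carrier U"
      unfolding W_carrier by blast
    then show "x \<odot>\<^bsub>W\<^esub> c \<in> carrier W" using x clI[OF keys[of x z]] by (simp add: W_smult)
    fix d assume "d \<in> carrier W"
    then obtain w where w: "d = cl w" "Poly_Mapping.keys w \<subseteq> carrier U \<times> carrier U"
      unfolding W_carrier by blast
    then show "x \<odot>\<^bsub>W\<^esub> (c \<oplus>\<^bsub>W\<^esub> d) = x \<odot>\<^bsub>W\<^esub> c \<oplus>\<^bsub>W\<^esub> x \<odot>\<^bsub>W\<^esub> d"
      using x z by (simp add: W_smult W_add keys keys_add)
  next
    fix x y c assume x: "x \<in> carrier U" and y: "y \<in> carrier U" and "c \<in> carrier W"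
    then obtain z where z: "c = cl z" "Poly_Mapping.keys z \<subseteq> carrier U \<times> carrier U"
      unfolding W_carrier by blast
    have "tensor_push ((\<otimes>\<^bsub>U\<^esub>) (x \<otimes>\<^bsub>U\<^esub> y)) z = tensor_push ((\<otimes>\<^bsub>U\<^esub>) x) (tensor_push ((\<otimes>\<^bsub>U\<^esub>) y) z)"
      by (rule frag_induction[OF z(2)]) (auto simp: U.m_assoc x y)
    then show "(x \<otimes>\<^bsub>U\<^esub> y) \<odot>\<^bsub>W\<^esub> c = x \<odot>\<^bsub>W\<^esub> (y \<odot>\<^bsub>W\<^esub> c)"
      using x y z by (simp add: W_smult keys)
    have "tensor_push ((\<otimes>\<^bsub>U\<^esub>) (x \<oplus>\<^bsub>U\<^esub> y)) z -
        (tensor_push ((\<otimes>\<^bsub>U\<^esub>) x) z + tensor_push ((\<otimes>\<^bsub>U\<^esub>) y) z) \<in> ?K"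
    proof (rule frag_induction[OF z(2)])
      show "tensor_push ((\<otimes>\<^bsub>U\<^esub>) (x \<oplus>\<^bsub>U\<^esub> y)) 0 -
        (tensor_push ((\<otimes>\<^bsub>U\<^esub>) x) 0 + tensor_push ((\<otimes>\<^bsub>U\<^esub>) y) 0) \<in> ?K"
        using tensor_kernel_closed(1)[OF A M] by simp
    next
      fix p assume "p \<in> carrier U \<times> carrier U"
      then obtain a b where p: "p = (a, b)" "a \<in> carrier U" "b \<in> carrier U" by auto
      have "frag_of ((x \<otimes>\<^bsub>U\<^esub> a) \<oplus>\<^bsub>A\<^esub> (y \<otimes>\<^bsub>U\<^esub> a), b) - frag_of (x \<otimes>\<^bsub>U\<^esub> a, b) - frag_of (y \<otimes>\<^bsub>U\<^esub> a, b) \<in> ?K"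
        by (rule tensor_kernel_bilinear) (use x y p in auto)
      then show "tensor_push ((\<otimes>\<^bsub>U\<^esub>) (x \<oplus>\<^bsub>U\<^esub> y)) (frag_of p) -
        (tensor_push ((\<otimes>\<^bsub>U\<^esub>) x) (frag_of p) + tensor_push ((\<otimes>\<^bsub>U\<^esub>) y) (frag_of p)) \<in> ?K"
        using p x y by (simp add: A_def U.l_distr diff_diff_eq)
    next
      fix a b assume
        "tensor_push ((\<otimes>\<^bsub>U\<^esub>) (x \<oplus>\<^bsub>U\<^esub> y)) a - (tensor_push ((\<otimes>\<^bsub>U\<^esub>) x) a + tensor_push ((\<otimes>\<^bsub>U\<^esub>) y) a) \<in> ?K"
        "tensor_push ((\<otimes>\<^bsub>U\<^esub>) (x \<oplus>\<^bsub>U\<^esub> y)) b - (tensor_push ((\<otimes>\<^bsub>U\<^esub>) x) b + tensor_push ((\<otimes>\<^bsub>U\<^esub>) y) b) \<in> ?K"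
      from tensor_kernel_closed(4)[OF A M this(1) tensor_kernel_closed(3)[OF A M this(2)]]
      show "tensor_push ((\<otimes>\<^bsub>U\<^esub>) (x \<oplus>\<^bsub>U\<^esub> y)) (a - b) -
        (tensor_push ((\<otimes>\<^bsub>U\<^esub>) x) (a - b) + tensor_push ((\<otimes>\<^bsub>U\<^esub>) y) (a - b)) \<in> ?K"
        by (simp add: algebra_simps)
    qed
    then show "(x \<oplus>\<^bsub>U\<^esub> y) \<odot>\<^bsub>W\<^esub> c = x \<odot>\<^bsub>W\<^esub> c \<oplus>\<^bsub>W\<^esub> y \<odot>\<^bsub>W\<^esub> c"
      using x y z by (simp add: W_smult W_add keys keys_add cl_eq)
  next
    fix c assume "c \<in> carrier W"
    then obtain z where z: "c = cl z" "Poly_Mapping.keys z \<subseteq> carrier U \<times> carrier U"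
      unfolding W_carrier by blast
    have "tensor_push ((\<otimes>\<^bsub>U\<^esub>) \<one>\<^bsub>U\<^esub>) z = z" by (rule tensor_push_ident[OF z(2)]) simp
    then show "\<one>\<^bsub>U\<^esub> \<odot>\<^bsub>W\<^esub> c = c" using z by (simp add: W_smult)
  qed
  define D where "D y = cl (frag_of (\<one>\<^bsub>U\<^esub>, y))" for y
  have frag_keys: "Poly_Mapping.keys (frag_of (a, b)) \<subseteq> carrier U \<times> carrier U"
    if "a \<in> carrier U" "b \<in> carrier U" for a b
    using that by simp
  have V: "left_module U (restrict_scalars U (\<lambda>x. x))"
    by (rule restrict_scalars_left_module[OF U U]) (auto intro: ring_hom_memI)
  have "D (x \<odot>\<^bsub>restrict_scalars U (\<lambda>x. x)\<^esub> \<one>\<^bsub>U\<^esub>) = x \<odot>\<^bsub>W\<^esub> D \<one>\<^bsub>U\<^esub>"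
  proof (rule epimorphism_linear[OF epi V W])
    show "D v \<in> carrier W" if "v \<in> carrier (restrict_scalars U (\<lambda>x. x))" for v
      using that frag_keys[of "\<one>\<^bsub>U\<^esub>" v] by (auto simp: D_def W_carrier)
  next
    fix v w
    assume "v \<in> carrier (restrict_scalars U (\<lambda>x. x))" "w \<in> carrier (restrict_scalars U (\<lambda>x. x))"
    then have *: "v \<in> carrier U" "w \<in> carrier U" by simp_all
    have "frag_of (\<one>\<^bsub>U\<^esub>, v \<oplus>\<^bsub>M\<^esub> w) - frag_of (\<one>\<^bsub>U\<^esub>, v) - frag_of (\<one>\<^bsub>U\<^esub>, w) \<in> ?K"
      by (rule tensor_kernel_bilinear) (use * in auto)
    then show "D (v \<oplus>\<^bsub>restrict_scalars U (\<lambda>x. x)\<^esub> w) = D v \<oplus>\<^bsub>W\<^esub> D w"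
      unfolding D_def using *
      by (subst W_add) (auto simp: cl_eq keys_add frag_keys M_def diff_diff_eq)
  next
    fix r v assume r: "r \<in> carrier R" and "v \<in> carrier (restrict_scalars U (\<lambda>x. x))"
    then have *: "v \<in> carrier U" "u r \<in> carrier U" using ring_hom_closed[OF u] by simp_all
    have "frag_of (r \<odot>\<^bsub>A\<^esub> \<one>\<^bsub>U\<^esub>, v) - frag_of (\<one>\<^bsub>U\<^esub>, r \<odot>\<^bsub>M\<^esub> v) \<in> ?K"
      by (rule tensor_kernel_bilinear) (use * r in auto)
    then have "cl (frag_of (u r, v)) = cl (frag_of (\<one>\<^bsub>U\<^esub>, u r \<otimes>\<^bsub>U\<^esub> v))"
      using * by (subst cl_eq) (auto simp: A_def M_def)
    then show "D (u r \<odot>\<^bsub>restrict_scalars U (\<lambda>x. x)\<^esub> v) = u r \<odot>\<^bsub>W\<^esub> D v"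
      using * by (simp add: D_def W_smult)
  qed (use x in auto)
  then have "cl (frag_of (\<one>\<^bsub>U\<^esub>, x)) = cl (frag_of (x, \<one>\<^bsub>U\<^esub>))"
    using x by (simp add: D_def W_smult)
  then show ?thesis
    using x cl_eq[of "frag_of (x, \<one>\<^bsub>U\<^esub>)" "frag_of (\<one>\<^bsub>U\<^esub>, x)"] by (simp add: A_def M_def)
qed

section \<open>Right ideals with trivial quotient after tensoring\<close>

lemma right_idealD:
  assumes "right_ideal R I"
  shows "additive_subgroup I R" and "\<lbrakk>x \<in> I; a \<in> carrier R\<rbrakk> \<Longrightarrow> x \<otimes>\<^bsub>R\<^esub> a \<in> I"
  using assms by (auto simp: right_ideal_def)

lemma (in ring) right_idealI:
  assumes "I \<subseteq> carrier R" "\<zero>\<^bsub>R\<^esub> \<in> I" "\<And>x y. \<lbrakk>x \<in> I; y \<in> I\<rbrakk> \<Longrightarrow> x \<oplus>\<^bsub>R\<^esub> y \<in> I"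
    and "\<And>x a. \<lbrakk>x \<in> I; a \<in> carrier R\<rbrakk> \<Longrightarrow> x \<otimes>\<^bsub>R\<^esub> a \<in> I"
  shows "right_ideal R I"
proof -
  have "\<ominus>\<^bsub>R\<^esub> x \<in> I" if "x \<in> I" for x
    using assms(4)[OF that, of "\<ominus>\<^bsub>R\<^esub> \<one>\<^bsub>R\<^esub>"] that assms(1) by (auto simp: r_minus)
  then have "subgroup I (add_monoid R)"
    by (intro add.subgroupI) (use assms in \<open>auto simp: a_inv_def\<close>)
  then show ?thesis using assms by (simp add: right_ideal_def additive_subgroup.intro)
qed

context ring begin

context
  fixes I assumes I: "right_ideal R I"
begin

interpretation I: abelian_subgroup I R
  by (rule abelian_subgroupI3[OF right_idealD(1)[OF I]]) unfold_locales

lemma right_ideal_subset: "I \<subseteq> carrier R"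
  by (rule I.a_subset)

lemma right_quotient_carrier: "carrier (right_quotient R I) = {I +> x | x. x \<in> carrier R}"
  by (auto simp: right_quotient_def A_RCOSETS_def')

lemma right_quotient_add:
  "\<lbrakk>x \<in> carrier R; y \<in> carrier R\<rbrakk> \<Longrightarrow> (I +> x) \<oplus>\<^bsub>right_quotient R I\<^esub> (I +> y) = I +> (x \<oplus> y)"
  by (simp add: right_quotient_def I.a_rcos_sum)

lemma right_quotient_zero: "\<zero>\<^bsub>right_quotient R I\<^esub> = I +> \<zero>"
  using a_coset_add_zero[OF right_ideal_subset] by (simp add: right_quotient_def)

lemma right_coset_eq:
  assumes "x \<in> carrier R" "y \<in> carrier R"
  shows "I +> x = I +> y \<longleftrightarrow> x \<ominus> y \<in> I"
proof -
  have "subgroup I (add_monoid R)" by (rule additive_subgroup.a_subgroup[OF right_idealD(1)[OF I]])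
  then have "I +> x = I +> y \<longleftrightarrow> x \<in> I +> y"
    using a_repr_independence[of x I y] I.a_rcos_self[OF assms(1)] assms(2) by auto
  also have "\<dots> \<longleftrightarrow> x \<ominus> y \<in> I"
    using I.a_rcos_module[OF assms(2,1)] by (simp add: a_minus_def)
  finally show ?thesis .
qed

lemma right_quotient_smult:
  assumes a: "a \<in> carrier R" and x: "x \<in> carrier R"
  shows "a \<odot>\<^bsub>right_quotient R I\<^esub> (I +> x) = I +> (x \<otimes> a)"
proof -
  have coset: "I +> (y \<otimes> a) = I +> (x \<otimes> a)" if y_mem: "y \<in> I +> x" for y
  proof -
    have y: "y \<in> carrier R" by (rule I.a_elemrcos_carrier[OF x y_mem])
    have "y \<ominus> x \<in> I" using y_mem I.a_rcos_module[OF x y] unfolding a_minus_def by blast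
    then have "(y \<ominus> x) \<otimes> a \<in> I" by (rule right_idealD(2)[OF I _ a])
    moreover have "(y \<ominus> x) \<otimes> a = y \<otimes> a \<ominus> x \<otimes> a"
      using x y a by (simp add: a_minus_def l_distr l_minus)
    ultimately have "y \<otimes> a \<ominus> x \<otimes> a \<in> I" by simp
    then show ?thesis using right_coset_eq[OF m_closed[OF y a] m_closed[OF x a]] by blast
  qed
  have "a \<odot>\<^bsub>right_quotient R I\<^esub> (I +> x) = (\<Union>y\<in>I +> x. I +> (y \<otimes> a))"
    by (simp add: right_quotient_def)
  also have "\<dots> = (\<Union>y\<in>I +> x. I +> (x \<otimes> a))" using coset by (rule SUP_cong[OF refl])
  also have "\<dots> = I +> (x \<otimes> a)" using I.a_rcos_self[OF x] by blast
  finally show ?thesis .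
qed

lemma right_quotient_closed: "x \<in> carrier R \<Longrightarrow> I +> x \<in> carrier (right_quotient R I)"
  unfolding right_quotient_carrier by blast

lemma right_quotient_cases:
  assumes "c \<in> carrier (right_quotient R I)"
  obtains x where "x \<in> carrier R" "c = I +> x"
  using assms unfolding right_quotient_carrier by blast

lemma right_quotient_right_module: "right_module R (right_quotient R I)"
proof (intro right_module.intro right_module_axioms.intro)
  note simps = right_quotient_add right_quotient_zero right_quotient_smult right_quotient_closed
  show "ring R" by (rule ring_axioms)
  show "abelian_group (right_quotient R I)"
  proof (rule abelian_groupI)
    fix c d e assume "c \<in> carrier (right_quotient R I)" "d \<in> carrier (right_quotient R I)"
      "e \<in> carrier (right_quotient R I)"
    then show "c \<oplus>\<^bsub>right_quotient R I\<^esub> d \<oplus>\<^bsub>right_quotient R I\<^esub> e =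
        c \<oplus>\<^bsub>right_quotient R I\<^esub> (d \<oplus>\<^bsub>right_quotient R I\<^esub> e)"
      by (elim right_quotient_cases) (simp add: simps a_assoc)
  next
    fix c d assume "c \<in> carrier (right_quotient R I)" "d \<in> carrier (right_quotient R I)"
    then show "c \<oplus>\<^bsub>right_quotient R I\<^esub> d \<in> carrier (right_quotient R I)"
      and "c \<oplus>\<^bsub>right_quotient R I\<^esub> d = d \<oplus>\<^bsub>right_quotient R I\<^esub> c"
      by (elim right_quotient_cases; simp add: simps a_comm)+
  next
    fix c assume "c \<in> carrier (right_quotient R I)"
    then obtain x where x: "x \<in> carrier R" "c = I +> x" by (rule right_quotient_cases)
    then show "\<zero>\<^bsub>right_quotient R I\<^esub> \<oplus>\<^bsub>right_quotient R I\<^esub> c = c"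
      unfolding right_quotient_zero by (simp only: right_quotient_add zero_closed l_zero)
    have "(I +> (\<ominus> x)) \<oplus>\<^bsub>right_quotient R I\<^esub> c = \<zero>\<^bsub>right_quotient R I\<^esub>"
      unfolding right_quotient_zero using x by (simp only: right_quotient_add a_inv_closed l_neg)
    then show "\<exists>d\<in>carrier (right_quotient R I). d \<oplus>\<^bsub>right_quotient R I\<^esub> c = \<zero>\<^bsub>right_quotient R I\<^esub>"
      using right_quotient_closed[OF a_inv_closed[OF x(1)]] by blast
  next
    show "\<zero>\<^bsub>right_quotient R I\<^esub> \<in> carrier (right_quotient R I)"
      unfolding right_quotient_zero by (rule right_quotient_closed) simp
  qed
next
  note simps = right_quotient_add right_quotient_smult right_quotient_closed
  fix a b c assume ab: "a \<in> carrier R" "b \<in> carrier R" and "c \<in> carrier (right_quotient R I)"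
  then obtain x where x: "x \<in> carrier R" "c = I +> x" using right_quotient_cases by blast
  show "(a \<oplus> b) \<odot>\<^bsub>right_quotient R I\<^esub> c =
      a \<odot>\<^bsub>right_quotient R I\<^esub> c \<oplus>\<^bsub>right_quotient R I\<^esub> b \<odot>\<^bsub>right_quotient R I\<^esub> c"
    using ab x by (simp add: simps r_distr)
  show "(a \<otimes> b) \<odot>\<^bsub>right_quotient R I\<^esub> c =
      b \<odot>\<^bsub>right_quotient R I\<^esub> (a \<odot>\<^bsub>right_quotient R I\<^esub> c)"
    using ab x by (simp add: simps m_assoc)
next
  note simps = right_quotient_add right_quotient_smult right_quotient_closed
  fix a c assume a: "a \<in> carrier R" and "c \<in> carrier (right_quotient R I)"
  then obtain x where x: "x \<in> carrier R" "c = I +> x" using right_quotient_cases by blast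
  show "a \<odot>\<^bsub>right_quotient R I\<^esub> c \<in> carrier (right_quotient R I)"
    using a x by (simp add: simps)
  fix d assume "d \<in> carrier (right_quotient R I)"
  then obtain y where y: "y \<in> carrier R" "d = I +> y" using right_quotient_cases by blast
  show "a \<odot>\<^bsub>right_quotient R I\<^esub> (c \<oplus>\<^bsub>right_quotient R I\<^esub> d) =
      a \<odot>\<^bsub>right_quotient R I\<^esub> c \<oplus>\<^bsub>right_quotient R I\<^esub> a \<odot>\<^bsub>right_quotient R I\<^esub> d"
    using a x y by (simp add: simps l_distr)
next
  fix c assume "c \<in> carrier (right_quotient R I)"
  then obtain x where x: "x \<in> carrier R" "c = I +> x" using right_quotient_cases by blast
  show "\<one> \<odot>\<^bsub>right_quotient R I\<^esub> c = c"
    using x by (simp add: right_quotient_smult)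
qed

end

end

definition ideal_span :: "('r, 'b, 'n) module_scheme \<Rightarrow> 'r set \<Rightarrow> 'b set"
  where "ideal_span M I = generate (add_monoid M) {s \<odot>\<^bsub>M\<^esub> x | s x. s \<in> I \<and> x \<in> carrier M}"

context left_module begin

lemma ideal_spanI: "\<lbrakk>s \<in> I; x \<in> carrier M\<rbrakk> \<Longrightarrow> s \<odot>\<^bsub>M\<^esub> x \<in> ideal_span M I"
  unfolding ideal_span_def by (rule generate.incl) blast

lemma ideal_span_subgroup:
  assumes "I \<subseteq> carrier R"
  shows "subgroup (ideal_span M I) (add_monoid M)"
  unfolding ideal_span_def
  by (rule group.generate_is_subgroup[OF M.a_group]) (use assms in auto)

lemma ideal_span_closed:
  assumes "I \<subseteq> carrier R"
  shows "\<zero>\<^bsub>M\<^esub> \<in> ideal_span M I" and "x \<in> ideal_span M I \<Longrightarrow> x \<in> carrier M"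
    and "\<lbrakk>x \<in> ideal_span M I; y \<in> ideal_span M I\<rbrakk> \<Longrightarrow> x \<oplus>\<^bsub>M\<^esub> y \<in> ideal_span M I"
    and "x \<in> ideal_span M I \<Longrightarrow> \<ominus>\<^bsub>M\<^esub> x \<in> ideal_span M I"
proof -
  interpret S: subgroup "ideal_span M I" "add_monoid M" by (rule ideal_span_subgroup[OF assms])
  show "\<zero>\<^bsub>M\<^esub> \<in> ideal_span M I" using S.one_closed by simp
  show "x \<in> ideal_span M I \<Longrightarrow> x \<in> carrier M" using S.mem_carrier by simp
  show "\<lbrakk>x \<in> ideal_span M I; y \<in> ideal_span M I\<rbrakk> \<Longrightarrow> x \<oplus>\<^bsub>M\<^esub> y \<in> ideal_span M I"
    using S.m_closed by simp
  show "x \<in> ideal_span M I \<Longrightarrow> \<ominus>\<^bsub>M\<^esub> x \<in> ideal_span M I"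
    using S.m_inv_closed by (simp add: a_inv_def)
qed

lemma ideal_span_induct [consumes 2, case_names smult zero neg add]:
  assumes I: "I \<subseteq> carrier R" and y: "y \<in> ideal_span M I"
    and "\<And>s x. \<lbrakk>s \<in> I; x \<in> carrier M\<rbrakk> \<Longrightarrow> P (s \<odot>\<^bsub>M\<^esub> x)" and "P \<zero>\<^bsub>M\<^esub>"
    and "\<And>x. \<lbrakk>x \<in> carrier M; P x\<rbrakk> \<Longrightarrow> P (\<ominus>\<^bsub>M\<^esub> x)"
    and "\<And>x y. \<lbrakk>x \<in> carrier M; y \<in> carrier M; P x; P y\<rbrakk> \<Longrightarrow> P (x \<oplus>\<^bsub>M\<^esub> y)"
  shows "P y"
proof -
  have "y \<in> carrier M \<and> P y"
    using y unfolding ideal_span_def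
  proof (induction rule: generate.induct)
    case (inv h)
    then have "h \<in> carrier M" "P h" using I assms(3) by auto
    then show ?case using assms(5)[of h] M.a_inv_closed[of h] by (simp add: a_inv_def)
  qed (use I assms in auto)
  then show ?thesis ..
qed

lemma tuple_subgroup:
  assumes "subgroup S (add_monoid M)"
  shows "subgroup {v. (\<forall>j. v j \<in> carrier M) \<and> v i \<in> S} (tuple_group M)"
proof -
  interpret S: subgroup S "add_monoid M" by fact
  interpret V: comm_group "tuple_group M :: ('j \<Rightarrow> 'b) monoid" by (rule M.tuple_comm_group)
  show ?thesis
  proof (rule V.subgroupI)
    show "{v. (\<forall>j. v j \<in> carrier M) \<and> v i \<in> S} \<noteq> {}"
      using S.one_closed by (auto intro!: exI[of _ "\<lambda>_. \<zero>\<^bsub>M\<^esub>"])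
    fix v assume v: "v \<in> {v. (\<forall>j. v j \<in> carrier M) \<and> v i \<in> S}"
    then have "\<ominus>\<^bsub>M\<^esub> v i \<in> S" using S.m_inv_closed by (simp add: a_inv_def)
    then show "inv\<^bsub>tuple_group M\<^esub> v \<in> {v. (\<forall>j. v j \<in> carrier M) \<and> v i \<in> S}"
      using v by (simp add: M.tuple_inv)
  qed (use S.m_closed in auto)
qed

end

context right_module begin

definition annihilator :: "'b \<Rightarrow> 'a set"
  where "annihilator a = {b \<in> carrier R. b \<odot>\<^bsub>M\<^esub> a = \<zero>\<^bsub>M\<^esub>}"

lemma rcomb_singleton:
  "\<lbrakk>a i \<in> carrier M; b i \<in> carrier R\<rbrakk> \<Longrightarrow> rcomb {i} a b = b i \<odot>\<^bsub>M\<^esub> a i"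
  by (simp add: rcomb_def)

end

lemma cyclic_tensor_zero:
  fixes A :: "('r, 'a, 'm) module_scheme" and M :: "('r, 'b, 'n) module_scheme"
  assumes A: "right_module R A" and M: "left_module R M"
    and a: "a \<in> carrier A" and gen: "\<And>y. y \<in> carrier A \<Longrightarrow> \<exists>b\<in>carrier R. b \<odot>\<^bsub>A\<^esub> a = y"
    and x: "x \<in> carrier M" and zero: "frag_of (a, x) \<in> tensor_kernel R A M"
  shows "x \<in> ideal_span M (right_module.annihilator R A a)"
proof -
  interpret A: right_module R A by fact
  interpret M: left_module R M by fact
  have ann: "A.annihilator a \<subseteq> carrier R" by (auto simp: A.annihilator_def)
  let ?N = "{v. (\<forall>j :: unit. v j \<in> carrier M) \<and> v () \<in> ideal_span M (A.annihilator a)}"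
  have "(\<lambda>_. x) \<in> ?N"
  proof (rule generated_tensor_zero[OF A M, of "{()}" "\<lambda>_. a"])
    fix y assume "y \<in> carrier A"
    then obtain b where "b \<in> carrier R" "b \<odot>\<^bsub>A\<^esub> a = y" using gen by blast
    then show "\<exists>b. (\<forall>j. b j \<in> carrier R) \<and> (\<forall>j. j \<notin> {()} \<longrightarrow> b j = \<zero>\<^bsub>R\<^esub>) \<and> A.rcomb {()} (\<lambda>_. a) b = y"
      using a by (intro exI[of _ "\<lambda>_. b"]) (auto simp: A.rcomb_singleton)
  next
    show "subgroup ?N (tuple_group M)" by (rule M.tuple_subgroup[OF M.ideal_span_subgroup[OF ann]])
  next
    fix b w assume "\<And>j. b j \<in> carrier R" "A.rcomb {()} (\<lambda>_. a) b = \<zero>\<^bsub>A\<^esub>" "w \<in> carrier M"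
    then show "(\<lambda>j. b j \<odot>\<^bsub>M\<^esub> w) \<in> ?N"
      using a by (auto simp: A.rcomb_singleton A.annihilator_def intro!: M.ideal_spanI)
  qed (use a x zero in auto)
  then show ?thesis by simp
qed

lemma flat_single_tensor_zero:
  fixes A :: "('r, 'a, 'm) module_scheme" and M :: "('r, 'b, 'n) module_scheme"
  assumes M: "flat_left_module R M" and A: "right_module R A"
    and a: "a \<in> carrier A" and x: "x \<in> carrier M" and zero: "frag_of (a, x) \<in> tensor_kernel R A M"
  shows "x \<in> ideal_span M (right_module.annihilator R A a)"
proof -
  interpret A: right_module R A by fact
  interpret M: left_module R M using M by (simp add: flat_left_module_def)
  have ann: "A.annihilator a \<subseteq> carrier R" by (auto simp: A.annihilator_def)
  let ?N = "{v. (\<forall>j :: unit. v j \<in> carrier M) \<and> v () \<in> ideal_span M (A.annihilator a)}"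
  have "(\<lambda>_. x) \<in> ?N"
  proof (rule flat_tensor_zero[OF M A, of "{()}" "\<lambda>_. a"])
    show "subgroup ?N (tuple_group M)" by (rule M.tuple_subgroup[OF M.ideal_span_subgroup[OF ann]])
  next
    fix b w assume "\<And>j. b j \<in> carrier R" "A.rcomb {()} (\<lambda>_. a) b = \<zero>\<^bsub>A\<^esub>" "w \<in> carrier M"
    then show "(\<lambda>j. b j \<odot>\<^bsub>M\<^esub> w) \<in> ?N"
      using a by (auto simp: A.rcomb_singleton A.annihilator_def intro!: M.ideal_spanI)
  qed (use a x zero in auto)
  then show ?thesis by simp
qed

lemma trivial_tensor_iff:
  fixes A :: "('r, 'a, 'm) module_scheme" and M :: "('r, 'b, 'n) module_scheme"
  assumes A: "right_module R A" and M: "left_module R M"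
  shows "carrier (tensor_prod R A M) = {\<one>\<^bsub>tensor_prod R A M\<^esub>} \<longleftrightarrow>
    (\<forall>z. Poly_Mapping.keys z \<subseteq> carrier A \<times> carrier M \<longrightarrow> z \<in> tensor_kernel R A M)"
proof -
  let ?Z = "free_Abelian_group (carrier A \<times> carrier M)" and ?K = "tensor_kernel R A M"
  have one: "\<one>\<^bsub>tensor_prod R A M\<^esub> = ?K #>\<^bsub>?Z\<^esub> 0"
    using group.coset_mult_one[OF group_free_Abelian_group subgroup.subset[OF tensor_kernel_subgroup[OF A M]]]
    by (simp add: tensor_prod_def)
  have single: "{f z | z. P z} = {c} \<longleftrightarrow> (\<forall>z. P z \<longrightarrow> f z = c)" if "P z0"
    for f :: "'x \<Rightarrow> 'y" and P z0 c using that by blast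
  have "carrier (tensor_prod R A M) = {\<one>\<^bsub>tensor_prod R A M\<^esub>} \<longleftrightarrow>
    (\<forall>z. Poly_Mapping.keys z \<subseteq> carrier A \<times> carrier M \<longrightarrow> ?K #>\<^bsub>?Z\<^esub> z = ?K #>\<^bsub>?Z\<^esub> 0)"
    unfolding tensor_prod_carrier one by (rule single[of _ 0]) simp
  then show ?thesis using tensor_coset_eq[OF A M, of _ 0] by simp
qed

lemma tensor_kernel_zero:
  fixes A :: "('r, 'a, 'm) module_scheme" and M :: "('r, 'b, 'n) module_scheme"
  assumes A: "right_module R A" and M: "left_module R M"
  shows "v \<in> carrier M \<Longrightarrow> frag_of (\<zero>\<^bsub>A\<^esub>, v) \<in> tensor_kernel R A M"
    and "y \<in> carrier A \<Longrightarrow> frag_of (y, \<zero>\<^bsub>M\<^esub>) \<in> tensor_kernel R A M"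
    and "\<lbrakk>y \<in> carrier A; v \<in> carrier M\<rbrakk> \<Longrightarrow>
      frag_of (y, \<ominus>\<^bsub>M\<^esub> v) + frag_of (y, v) \<in> tensor_kernel R A M"
proof -
  interpret A: right_module R A by fact
  interpret M: left_module R M by fact
  note neg = tensor_kernel_closed(3)[OF A M]
  show "frag_of (\<zero>\<^bsub>A\<^esub>, v) \<in> tensor_kernel R A M" if "v \<in> carrier M"
    using neg[OF tensor_kernel_bilinear(1)[OF A.M.zero_closed A.M.zero_closed that]] by simp
  show right0: "frag_of (y, \<zero>\<^bsub>M\<^esub>) \<in> tensor_kernel R A M" if "y \<in> carrier A" for y
    using neg[OF tensor_kernel_bilinear(2)[OF that M.M.zero_closed M.M.zero_closed]] by simp
  show "frag_of (y, \<ominus>\<^bsub>M\<^esub> v) + frag_of (y, v) \<in> tensor_kernel R A M"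
    if "y \<in> carrier A" "v \<in> carrier M"
    using tensor_kernel_closed(4)[OF A M right0[OF that(1)]
        neg[OF tensor_kernel_bilinear(2)[OF that(1) M.M.a_inv_closed[OF that(2)] that(2)]]] that
    by (simp add: M.M.l_neg algebra_simps)
qed

text \<open>\<open>R/I \<otimes> M\<close> is \<open>M / I M\<close>.  For one direction, \<open>R/I\<close> is generated by the coset of \<open>1\<close>, whose
  annihilator is \<open>I\<close>; for the other, \<open>1 \<otimes> s y = s \<otimes> y\<close> vanishes for \<open>s \<in> I\<close>.\<close>

lemma quotient_tensor_trivial_iff:
  fixes M :: "('r, 'b, 'n) module_scheme"
  assumes M: "left_module R M" and I: "right_ideal R I"
  defines "T \<equiv> tensor_prod R (right_quotient R I) M"
  shows "carrier T = {\<one>\<^bsub>T\<^esub>} \<longleftrightarrow> carrier M \<subseteq> ideal_span M I"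
proof -
  interpret M: left_module R M by fact
  let ?A = "right_quotient R I"
  have A: "right_module R ?A" by (rule M.R.right_quotient_right_module[OF I])
  interpret A: right_module R ?A by fact
  have I_sub: "I \<subseteq> carrier R" by (rule M.R.right_ideal_subset[OF I])
  define K where "K = tensor_kernel R ?A M"
  note K = tensor_kernel_closed[OF A M, folded K_def]
  have K_diff: "z - w \<in> K" if "z \<in> K" "w \<in> K" for z w
    using K(4)[OF that(1) K(3)[OF that(2)]] by simp
  have "carrier T = {\<one>\<^bsub>T\<^esub>} \<longleftrightarrow> (\<forall>z. Poly_Mapping.keys z \<subseteq> carrier ?A \<times> carrier M \<longrightarrow> z \<in> K)"
    unfolding T_def K_def by (rule trivial_tensor_iff[OF A M])
  also have "\<dots> \<longleftrightarrow> carrier M \<subseteq> ideal_span M I"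
  proof
    assume trivial: "\<forall>z. Poly_Mapping.keys z \<subseteq> carrier ?A \<times> carrier M \<longrightarrow> z \<in> K"
    define a where "a = I +>\<^bsub>R\<^esub> \<one>\<^bsub>R\<^esub>"
    have a: "a \<in> carrier ?A" unfolding a_def by (rule M.R.right_quotient_closed[OF I M.R.one_closed])
    have smult_a: "b \<odot>\<^bsub>?A\<^esub> a = I +>\<^bsub>R\<^esub> b" if "b \<in> carrier R" for b
      using that by (simp add: a_def M.R.right_quotient_smult[OF I])
    have "b \<odot>\<^bsub>?A\<^esub> a = \<zero>\<^bsub>?A\<^esub> \<longleftrightarrow> b \<in> I" if b: "b \<in> carrier R" for b
    proof -
      have "b \<ominus>\<^bsub>R\<^esub> \<zero>\<^bsub>R\<^esub> = b" using b by (simp add: a_minus_def)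
      then show ?thesis
        unfolding smult_a[OF b] M.R.right_quotient_zero[OF I]
        using M.R.right_coset_eq[OF I b M.R.zero_closed] by argo
    qed
    then have ann: "A.annihilator a = I"
      using I_sub by (auto simp: A.annihilator_def)
    show "carrier M \<subseteq> ideal_span M I"
    proof
      fix x assume x: "x \<in> carrier M"
      have "x \<in> ideal_span M (A.annihilator a)"
      proof (rule cyclic_tensor_zero[OF A M a _ x])
        show "\<exists>b\<in>carrier R. b \<odot>\<^bsub>?A\<^esub> a = y" if y: "y \<in> carrier ?A" for y
        proof -
          obtain r where "r \<in> carrier R" "y = I +>\<^bsub>R\<^esub> r"
            by (rule M.R.right_quotient_cases[OF I y])
          then show ?thesis using smult_a by blast
        qed
        show "frag_of (a, x) \<in> tensor_kernel R ?A M" using trivial a x by (simp add: K_def)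
      qed
      then show "x \<in> ideal_span M I" unfolding ann .
    qed
  next
    assume span: "carrier M \<subseteq> ideal_span M I"
    have frag: "frag_of (c, x) \<in> K" if c: "c \<in> carrier ?A" and x: "x \<in> carrier M" for c x
    proof -
      define a where "a = I +>\<^bsub>R\<^esub> \<one>\<^bsub>R\<^esub>"
      have a: "a \<in> carrier ?A" unfolding a_def by (rule M.R.right_quotient_closed[OF I M.R.one_closed])
      have bil: "frag_of (y \<oplus>\<^bsub>?A\<^esub> y', v) - frag_of (y, v) - frag_of (y', v) \<in> K"
        if "y \<in> carrier ?A" "y' \<in> carrier ?A" "v \<in> carrier M" for y y' v
        unfolding K_def by (rule tensor_kernel_bilinear) (use that in simp_all)
      have bir: "frag_of (y, v \<oplus>\<^bsub>M\<^esub> w) - frag_of (y, v) - frag_of (y, w) \<in> K"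
        if "y \<in> carrier ?A" "v \<in> carrier M" "w \<in> carrier M" for y v w
        unfolding K_def by (rule tensor_kernel_bilinear) (use that in simp_all)
      have bal: "frag_of (b \<odot>\<^bsub>?A\<^esub> y, v) - frag_of (y, b \<odot>\<^bsub>M\<^esub> v) \<in> K"
        if "b \<in> carrier R" "y \<in> carrier ?A" "v \<in> carrier M" for b y v
        unfolding K_def by (rule tensor_kernel_bilinear) (use that in simp_all)
      note left0 = tensor_kernel_zero(1)[OF A M, folded K_def]
        and right0 = tensor_kernel_zero(2)[OF A M, folded K_def]
        and right_neg = tensor_kernel_zero(3)[OF A M, folded K_def]
      have aK: "frag_of (a, v) \<in> K" if "v \<in> carrier M" for v
      proof -
        have "v \<in> ideal_span M I" using that span by blast
        from I_sub this show ?thesis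
        proof (induction rule: M.ideal_span_induct)
          case (smult s y)
          then have s: "s \<in> carrier R" using I_sub by blast
          have "s \<odot>\<^bsub>?A\<^esub> a = I +>\<^bsub>R\<^esub> s" using s by (simp add: a_def M.R.right_quotient_smult[OF I])
          also have "\<dots> = \<zero>\<^bsub>?A\<^esub>"
            unfolding M.R.right_quotient_zero[OF I]
            by (rule M.R.right_coset_eq[OF I s M.R.zero_closed, THEN iffD2]) (use s smult in \<open>simp add: a_minus_def\<close>)
          finally show ?case
            using K_diff[OF left0[OF smult(2)] bal[OF s a smult(2)]] by simp
        next
          case zero
          then show ?case using right0 a by simp
        next
          case (neg y)
          from K_diff[OF right_neg[OF a neg(1)] neg(2)] show ?case by simp
        next
          case (add y y')
          from K(4)[OF bir[OF a add(1,2)] K(4)[OF add(3,4)]] show ?case by simp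
        qed
      qed
      from c obtain r where r: "r \<in> carrier R" "c = I +>\<^bsub>R\<^esub> r"
        by (rule M.R.right_quotient_cases[OF I])
      then have "c = r \<odot>\<^bsub>?A\<^esub> a" by (simp add: a_def M.R.right_quotient_smult[OF I])
      then show ?thesis using K(4)[OF bal[OF r(1) a x] aK[of "r \<odot>\<^bsub>M\<^esub> x"]] r x by simp
    qed
    show "\<forall>z. Poly_Mapping.keys z \<subseteq> carrier ?A \<times> carrier M \<longrightarrow> z \<in> K"
    proof (intro allI impI)
      fix z :: "'r set \<times> 'b \<Rightarrow>\<^sub>0 int"
      assume "Poly_Mapping.keys z \<subseteq> carrier ?A \<times> carrier M"
      then show "z \<in> K"
        by (rule frag_induction) (use K(1) frag K_diff in auto)
    qed
  qed
  finally show ?thesis .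
qed

lemma regular_right_module: "ring R \<Longrightarrow> right_module R (right_restrict_scalars R (\<lambda>r. r))"
  by (rule right_restrict_scalars_right_module) (auto intro: ring_hom_memI)

text \<open>The equational criterion for flatness: a relation \<open>\<Sum> r\<^sub>j x\<^sub>j = 0\<close> in \<open>M\<close> says that
  \<open>\<Sum> r\<^sub>j \<otimes> x\<^sub>j\<close> vanishes in \<open>R \<otimes> M\<close>.\<close>

lemma flat_relation:
  fixes M :: "('r, 'b, 'n) module_scheme" and r :: "'j \<Rightarrow> 'r"
  assumes flat: "flat_left_module R M" and J: "finite J"
    and r: "r \<in> J \<rightarrow> carrier R"
    and x: "\<And>j. x j \<in> carrier M" and x0: "\<And>j. j \<notin> J \<Longrightarrow> x j = \<zero>\<^bsub>M\<^esub>"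
    and zero: "finsum M (\<lambda>j. r j \<odot>\<^bsub>M\<^esub> x j) J = \<zero>\<^bsub>M\<^esub>"
    and N: "subgroup N (tuple_group M)"
    and syz: "\<And>b w. \<lbrakk>\<And>j. b j \<in> carrier R; \<And>j. j \<notin> J \<Longrightarrow> b j = \<zero>\<^bsub>R\<^esub>;
      finsum (right_restrict_scalars R (\<lambda>r. r)) (\<lambda>j. r j \<otimes>\<^bsub>R\<^esub> b j) J = \<zero>\<^bsub>R\<^esub>; w \<in> carrier M\<rbrakk> \<Longrightarrow>
      (\<lambda>j. b j \<odot>\<^bsub>M\<^esub> w) \<in> N"
  shows "x \<in> N"
proof -
  let ?A = "right_restrict_scalars R (\<lambda>r. r)"
  have M: "left_module R M" using flat by (simp add: flat_left_module_def)
  interpret M: left_module R M by fact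
  have A: "right_module R ?A" by (rule regular_right_module[OF M.R.ring_axioms])
  interpret A: right_module R ?A by fact
  let ?K = "tensor_kernel R ?A M"
  have "(\<Sum>j\<in>S. frag_of (r j, x j)) - frag_of (\<one>\<^bsub>R\<^esub>, finsum M (\<lambda>j. r j \<odot>\<^bsub>M\<^esub> x j) S) \<in> ?K"
    if "S \<subseteq> J" for S
    using finite_subset[OF that J] that
  proof (induction S)
    case empty
    then show ?case
      using tensor_kernel_closed(3)[OF A M tensor_kernel_zero(2)[OF A M, of "\<one>\<^bsub>R\<^esub>"]] by simp
  next
    case (insert i S)
    define s where "s = finsum M (\<lambda>j. r j \<odot>\<^bsub>M\<^esub> x j) S"
    have i: "r i \<in> carrier R" using insert r by auto
    have s: "s \<in> carrier M" using insert r x unfolding s_def by (intro M.M.finsum_closed) auto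
    have sum: "finsum M (\<lambda>j. r j \<odot>\<^bsub>M\<^esub> x j) (insert i S) = r i \<odot>\<^bsub>M\<^esub> x i \<oplus>\<^bsub>M\<^esub> s"
      unfolding s_def using insert r x by (intro M.M.finsum_insert) auto
    have "frag_of (r i \<odot>\<^bsub>?A\<^esub> \<one>\<^bsub>R\<^esub>, x i) - frag_of (\<one>\<^bsub>R\<^esub>, r i \<odot>\<^bsub>M\<^esub> x i) \<in> ?K"
      by (rule tensor_kernel_bilinear) (use i x in auto)
    then have "frag_of (r i, x i) - frag_of (\<one>\<^bsub>R\<^esub>, r i \<odot>\<^bsub>M\<^esub> x i) \<in> ?K"
      using i by simp
    moreover have "frag_of (\<one>\<^bsub>R\<^esub>, r i \<odot>\<^bsub>M\<^esub> x i \<oplus>\<^bsub>M\<^esub> s) - frag_of (\<one>\<^bsub>R\<^esub>, r i \<odot>\<^bsub>M\<^esub> x i)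
        - frag_of (\<one>\<^bsub>R\<^esub>, s) \<in> ?K"
      by (rule tensor_kernel_bilinear) (use i x s in auto)
    moreover have "(\<Sum>j\<in>S. frag_of (r j, x j)) - frag_of (\<one>\<^bsub>R\<^esub>, s) \<in> ?K"
      using insert by (simp add: s_def)
    ultimately have "(frag_of (r i, x i) - frag_of (\<one>\<^bsub>R\<^esub>, r i \<odot>\<^bsub>M\<^esub> x i)) +
        (((\<Sum>j\<in>S. frag_of (r j, x j)) - frag_of (\<one>\<^bsub>R\<^esub>, s)) +
        - (frag_of (\<one>\<^bsub>R\<^esub>, r i \<odot>\<^bsub>M\<^esub> x i \<oplus>\<^bsub>M\<^esub> s) - frag_of (\<one>\<^bsub>R\<^esub>, r i \<odot>\<^bsub>M\<^esub> x i)
        - frag_of (\<one>\<^bsub>R\<^esub>, s))) \<in> ?K"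
      by (intro tensor_kernel_closed(3,4)[OF A M])
    then show ?case unfolding sum using insert by (simp add: algebra_simps)
  qed
  from this[OF order_refl] have "(\<Sum>j\<in>J. frag_of (r j, x j)) - frag_of (\<one>\<^bsub>R\<^esub>, \<zero>\<^bsub>M\<^esub>) \<in> ?K"
    by (simp add: zero)
  from tensor_kernel_closed(4)[OF A M this tensor_kernel_zero(2)[OF A M, of "\<one>\<^bsub>R\<^esub>"]]
  have zero': "(\<Sum>j\<in>J. frag_of (r j, x j)) \<in> ?K" by simp
  show ?thesis
  proof (rule flat_tensor_zero[OF flat A J _ x x0 zero' N])
    fix b w assume "\<And>j. b j \<in> carrier R" "\<And>j. j \<notin> J \<Longrightarrow> b j = \<zero>\<^bsub>R\<^esub>"
      "A.rcomb J r b = \<zero>\<^bsub>?A\<^esub>" "w \<in> carrier M"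
    then show "(\<lambda>j. b j \<odot>\<^bsub>M\<^esub> w) \<in> N" using syz by (simp add: A.rcomb_def)
  qed (use r in auto)
qed

lemma flat_annihilator_span:
  fixes M :: "('r, 'b, 'n) module_scheme"
  assumes flat: "flat_left_module R M" and z: "z \<in> carrier R" and x: "x \<in> carrier M"
    and zero: "z \<odot>\<^bsub>M\<^esub> x = \<zero>\<^bsub>M\<^esub>"
  shows "x \<in> ideal_span M {b \<in> carrier R. z \<otimes>\<^bsub>R\<^esub> b = \<zero>\<^bsub>R\<^esub>}"
proof -
  let ?A = "right_restrict_scalars R (\<lambda>r. r)"
  have M: "left_module R M" using flat by (simp add: flat_left_module_def)
  interpret M: left_module R M by fact
  have A: "right_module R ?A" by (rule regular_right_module[OF M.R.ring_axioms])
  interpret A: right_module R ?A by fact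
  have "frag_of (z \<odot>\<^bsub>?A\<^esub> \<one>\<^bsub>R\<^esub>, x) - frag_of (\<one>\<^bsub>R\<^esub>, z \<odot>\<^bsub>M\<^esub> x) \<in> tensor_kernel R ?A M"
    by (rule tensor_kernel_bilinear) (use z x in auto)
  from tensor_kernel_closed(4)[OF A M this tensor_kernel_zero(2)[OF A M, of "\<one>\<^bsub>R\<^esub>"]]
  have "frag_of (z, x) \<in> tensor_kernel R ?A M" using z by (simp add: zero)
  from flat_single_tensor_zero[OF flat A _ x this] show ?thesis
    using z by (simp add: A.annihilator_def)
qed

text \<open>As \<open>R/I \<otimes> M = 0\<close>, the tensor of the coset of \<open>s\<close> with any \<open>x\<close> vanishes, and the annihilator
  of that coset is \<open>{b. s b \<in> I}\<close>.\<close>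

lemma colon_ideal_span:
  fixes M :: "('r, 'b, 'n) module_scheme"
  assumes flat: "flat_left_module R M" and I: "right_ideal R I" and s: "s \<in> carrier R"
    and span: "carrier M \<subseteq> ideal_span M I"
  shows "carrier M \<subseteq> ideal_span M {b \<in> carrier R. s \<otimes>\<^bsub>R\<^esub> b \<in> I}"
proof
  fix x assume x: "x \<in> carrier M"
  let ?A = "right_quotient R I"
  have M: "left_module R M" using flat by (simp add: flat_left_module_def)
  interpret M: left_module R M by fact
  have A: "right_module R ?A" by (rule M.R.right_quotient_right_module[OF I])
  interpret A: right_module R ?A by fact
  define a where "a = I +>\<^bsub>R\<^esub> s"
  have a: "a \<in> carrier ?A" unfolding a_def by (rule M.R.right_quotient_closed[OF I s])
  have "b \<odot>\<^bsub>?A\<^esub> a = \<zero>\<^bsub>?A\<^esub> \<longleftrightarrow> s \<otimes>\<^bsub>R\<^esub> b \<in> I" if b: "b \<in> carrier R" for b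
  proof -
    have "s \<otimes>\<^bsub>R\<^esub> b \<ominus>\<^bsub>R\<^esub> \<zero>\<^bsub>R\<^esub> = s \<otimes>\<^bsub>R\<^esub> b" using b s by (simp add: a_minus_def)
    then show ?thesis
      unfolding a_def M.R.right_quotient_smult[OF I b s] M.R.right_quotient_zero[OF I]
      using M.R.right_coset_eq[OF I M.R.m_closed[OF s b] M.R.zero_closed] by argo
  qed
  then have ann: "A.annihilator a = {b \<in> carrier R. s \<otimes>\<^bsub>R\<^esub> b \<in> I}"
    by (auto simp: A.annihilator_def)
  have "carrier (tensor_prod R ?A M) = {\<one>\<^bsub>tensor_prod R ?A M\<^esub>}"
    using quotient_tensor_trivial_iff[OF M I] span by simp
  then have "frag_of (a, x) \<in> tensor_kernel R ?A M"
    using trivial_tensor_iff[OF A M] a x by simp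
  from flat_single_tensor_zero[OF flat A a x this]
  show "x \<in> ideal_span M {b \<in> carrier R. s \<otimes>\<^bsub>R\<^esub> b \<in> I}" unfolding ann .
qed

text \<open>An element of \<open>I M\<close> is a sum of terms \<open>s y\<close> with \<open>s \<in> I\<close>.  Expanding each \<open>y\<close> with
  coefficients \<open>b\<close> such that \<open>s b \<in> J\<close> moves the coefficients \<open>s b\<close> into \<open>I \<inter> J\<close>.\<close>

lemma inter_ideal_span:
  fixes M :: "('r, 'b, 'n) module_scheme"
  assumes flat: "flat_left_module R M" and I: "right_ideal R I" and J: "right_ideal R J"
    and spanI: "carrier M \<subseteq> ideal_span M I" and spanJ: "carrier M \<subseteq> ideal_span M J"
  shows "carrier M \<subseteq> ideal_span M (I \<inter> J)"
proof
  fix x assume x: "x \<in> carrier M"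
  interpret M: left_module R M using flat by (simp add: flat_left_module_def)
  have I_sub: "I \<subseteq> carrier R" by (rule M.R.right_ideal_subset[OF I])
  then have "I \<inter> J \<subseteq> carrier R" by blast
  note IJ = M.ideal_span_closed[OF this]
  from x spanI have "x \<in> ideal_span M I" by blast
  from I_sub this show "x \<in> ideal_span M (I \<inter> J)"
  proof (induction rule: M.ideal_span_induct)
    case (smult s y)
    then have s: "s \<in> carrier R" using I_sub by blast
    let ?C = "{b \<in> carrier R. s \<otimes>\<^bsub>R\<^esub> b \<in> J}"
    have C: "?C \<subseteq> carrier R" by blast
    have "y \<in> ideal_span M ?C" using colon_ideal_span[OF flat J s spanJ] smult by blast
    from C this show ?case
    proof (induction rule: M.ideal_span_induct)
      case (smult b w)
      then have "s \<otimes>\<^bsub>R\<^esub> b \<in> I \<inter> J" using right_idealD(2)[OF I \<open>s \<in> I\<close>] by blast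
      from M.ideal_spanI[OF this, of w] show ?case using smult s by (simp add: M.lsmult_assoc)
    qed (use s IJ in \<open>auto simp: M.lsmult_minus_right M.lsmult_r_distr\<close>)
  qed (use IJ in auto)
qed

section \<open>The Gabriel topology of a flat ring epimorphism\<close>

locale flat_epimorphism =
  fixes R :: "('r, 's) ring_scheme" and U :: "('u, 't) ring_scheme" and u :: "'r \<Rightarrow> 'u"
  assumes epi: "ring_epimorphism R U u"
    and flat: "flat_left_module R (restrict_scalars U u)"
begin

sublocale R: ring R using epi by (simp add: ring_epimorphism_def)
sublocale U: ring U using epi by (simp add: ring_epimorphism_def)

lemma u_hom: "u \<in> ring_hom R U" using epi by (simp add: ring_epimorphism_def)

abbreviation "UM \<equiv> restrict_scalars U u"

sublocale M: left_module R UM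
  by (rule restrict_scalars_left_module[OF R.ring_axioms U.ring_axioms u_hom])

lemma u_simps [simp]:
  "r \<in> carrier R \<Longrightarrow> u r \<in> carrier U"
  "\<lbrakk>r \<in> carrier R; s \<in> carrier R\<rbrakk> \<Longrightarrow> u (r \<otimes>\<^bsub>R\<^esub> s) = u r \<otimes>\<^bsub>U\<^esub> u s"
  "\<lbrakk>r \<in> carrier R; s \<in> carrier R\<rbrakk> \<Longrightarrow> u (r \<oplus>\<^bsub>R\<^esub> s) = u r \<oplus>\<^bsub>U\<^esub> u s"
  "u \<one>\<^bsub>R\<^esub> = \<one>\<^bsub>U\<^esub>" "u \<zero>\<^bsub>R\<^esub> = \<zero>\<^bsub>U\<^esub>"
  "r \<in> carrier R \<Longrightarrow> u (\<ominus>\<^bsub>R\<^esub> r) = \<ominus>\<^bsub>U\<^esub> u r"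
proof -
  interpret h: ring_hom_ring R U u
    by (rule ring_hom_ringI2[OF R.ring_axioms U.ring_axioms u_hom])
  show "r \<in> carrier R \<Longrightarrow> u r \<in> carrier U"
    "\<lbrakk>r \<in> carrier R; s \<in> carrier R\<rbrakk> \<Longrightarrow> u (r \<otimes>\<^bsub>R\<^esub> s) = u r \<otimes>\<^bsub>U\<^esub> u s"
    "\<lbrakk>r \<in> carrier R; s \<in> carrier R\<rbrakk> \<Longrightarrow> u (r \<oplus>\<^bsub>R\<^esub> s) = u r \<oplus>\<^bsub>U\<^esub> u s"
    "u \<one>\<^bsub>R\<^esub> = \<one>\<^bsub>U\<^esub>" "u \<zero>\<^bsub>R\<^esub> = \<zero>\<^bsub>U\<^esub>"
    "r \<in> carrier R \<Longrightarrow> u (\<ominus>\<^bsub>R\<^esub> r) = \<ominus>\<^bsub>U\<^esub> u r"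
    by simp_all
qed

lemma UM_minus: "x \<in> carrier U \<Longrightarrow> \<ominus>\<^bsub>UM\<^esub> x = \<ominus>\<^bsub>U\<^esub> x"
  using M.M.minus_equality[of "\<ominus>\<^bsub>U\<^esub> x" x] by (simp add: U.l_neg)

lemma gabriel_topology_span:
  "I \<in> gabriel_topology R U u \<longleftrightarrow> right_ideal R I \<and> carrier U \<subseteq> ideal_span UM I"
  using quotient_tensor_trivial_iff[OF M.left_module_axioms, of I]
  by (auto simp: gabriel_topology_def Let_def)

lemma ideal_span_right_mult:
  assumes I: "I \<subseteq> carrier R" and y: "y \<in> ideal_span UM I" and x: "x \<in> carrier U"
  shows "y \<otimes>\<^bsub>U\<^esub> x \<in> ideal_span UM I"
  using I y
proof (induction rule: M.ideal_span_induct)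
  case (smult s w)
  then have "s \<in> carrier R" using I by blast
  then show ?case using M.ideal_spanI[OF smult(1), of "w \<otimes>\<^bsub>U\<^esub> x"] smult x by (simp add: U.m_assoc)
next
  case (neg y)
  then show ?case using M.ideal_span_closed(4)[OF I neg(2)] M.ideal_span_closed(2)[OF I neg(2)] x
    by (simp add: UM_minus U.l_minus)
next
  case (add y z)
  then show ?case using M.ideal_span_closed(3)[OF I add(3,4)] x by (simp add: U.l_distr)
qed (use M.ideal_span_closed(1)[OF I] x in auto)

text \<open>\<open>I U\<close> is a right ideal of \<open>U\<close>, so it suffices that it contains \<open>1\<close>.\<close>

lemma gabriel_topology_iff:
  "I \<in> gabriel_topology R U u \<longleftrightarrow> right_ideal R I \<and> \<one>\<^bsub>U\<^esub> \<in> ideal_span UM I"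
proof -
  have "carrier U \<subseteq> ideal_span UM I" if "right_ideal R I" "\<one>\<^bsub>U\<^esub> \<in> ideal_span UM I"
    using ideal_span_right_mult[OF R.right_ideal_subset[OF that(1)] that(2)] by fastforce
  then show ?thesis using gabriel_topology_span by blast
qed

lemma gabriel_topology_inter:
  assumes "I \<in> gabriel_topology R U u" "J \<in> gabriel_topology R U u"
  shows "I \<inter> J \<in> gabriel_topology R U u"
proof -
  have "right_ideal R I" "right_ideal R J" using assms gabriel_topology_span by auto
  then have "right_ideal R (I \<inter> J)"
    using R.right_ideal_subset
    by (intro R.right_idealI)
      (auto dest: right_idealD intro: additive_subgroup.zero_closed additive_subgroup.a_closed)
  then show ?thesis
    using inter_ideal_span[OF flat, of I J] assms unfolding gabriel_topology_span by auto
qed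

text \<open>The relation \<open>z \<otimes> 1 = 0\<close> in \<open>R \<otimes> U\<close> forces \<open>1\<close> to have an expansion with coefficients that
  \<open>z\<close> annihilates.\<close>

lemma annihilator_in_gabriel_topology:
  assumes "z \<in> carrier R" "u z = \<zero>\<^bsub>U\<^esub>"
  shows "{b \<in> carrier R. z \<otimes>\<^bsub>R\<^esub> b = \<zero>\<^bsub>R\<^esub>} \<in> gabriel_topology R U u"
  unfolding gabriel_topology_iff
proof
  show "right_ideal R {b \<in> carrier R. z \<otimes>\<^bsub>R\<^esub> b = \<zero>\<^bsub>R\<^esub>}"
    by (rule R.right_idealI) (use assms in \<open>auto simp: R.r_distr R.m_assoc[symmetric]\<close>)
  show "\<one>\<^bsub>U\<^esub> \<in> ideal_span UM {b \<in> carrier R. z \<otimes>\<^bsub>R\<^esub> b = \<zero>\<^bsub>R\<^esub>}"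
    by (rule flat_annihilator_span[OF flat assms(1)]) (use assms in auto)
qed

definition denominators :: "'u \<Rightarrow> 'r set"
  where "denominators x = {r \<in> carrier R. x \<otimes>\<^bsub>U\<^esub> u r \<in> u ` carrier R}"

text \<open>Apply \<open>flat_tensor_zero\<close> to \<open>x \<otimes> 1 + 1 \<otimes> (- x) = 0\<close>.  A syzygy \<open>(b, c)\<close> of \<open>(x, 1)\<close> satisfies
  \<open>x u(b) = - u(c)\<close>, so \<open>b\<close> is a denominator of \<open>x\<close>; the first entry of the tuple is \<open>1\<close>.\<close>

lemma denominators_in_gabriel_topology:
  assumes x: "x \<in> carrier U"
  shows "denominators x \<in> gabriel_topology R U u"
  unfolding gabriel_topology_iff
proof
  let ?D = "denominators x"
  have D: "?D \<subseteq> carrier R" by (auto simp: denominators_def)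
  show "right_ideal R ?D"
  proof (rule R.right_idealI[OF D])
    show "\<zero>\<^bsub>R\<^esub> \<in> ?D" using x by (auto simp: denominators_def intro: image_eqI[of _ _ "\<zero>\<^bsub>R\<^esub>"])
  next
    fix r s assume "r \<in> ?D" "s \<in> ?D"
    then obtain r' s' where "r \<in> carrier R" "s \<in> carrier R" "r' \<in> carrier R" "s' \<in> carrier R"
      "x \<otimes>\<^bsub>U\<^esub> u r = u r'" "x \<otimes>\<^bsub>U\<^esub> u s = u s'" by (auto simp: denominators_def)
    then show "r \<oplus>\<^bsub>R\<^esub> s \<in> ?D"
      using x by (auto simp: denominators_def U.r_distr intro!: image_eqI[of _ _ "r' \<oplus>\<^bsub>R\<^esub> s'"])
  next
    fix r a assume "r \<in> ?D" "a \<in> carrier R"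
    moreover from this obtain r' where "r \<in> carrier R" "r' \<in> carrier R" "x \<otimes>\<^bsub>U\<^esub> u r = u r'"
      by (auto simp: denominators_def)
    ultimately show "r \<otimes>\<^bsub>R\<^esub> a \<in> ?D"
      using x by (auto simp: denominators_def U.m_assoc[symmetric] intro!: image_eqI[of _ _ "r' \<otimes>\<^bsub>R\<^esub> a"])
  qed
  let ?A = "right_restrict_scalars U u"
  have A: "right_module R ?A"
    by (rule right_restrict_scalars_right_module[OF R.ring_axioms U.ring_axioms u_hom])
  interpret A: right_module R ?A by fact
  define a where "a j = (if j then x else \<one>\<^bsub>U\<^esub>)" for j
  define y where "y j = (if j then \<one>\<^bsub>U\<^esub> else \<ominus>\<^bsub>U\<^esub> x)" for j
  let ?N = "{v. (\<forall>j. v j \<in> carrier UM) \<and> v True \<in> ideal_span UM ?D}"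
  have "y \<in> ?N"
  proof (rule flat_tensor_zero[OF flat A finite_UNIV, of a])
    have "frag_of (\<one>\<^bsub>U\<^esub>, \<ominus>\<^bsub>U\<^esub> x) + frag_of (\<one>\<^bsub>U\<^esub>, x) \<in> tensor_kernel R ?A UM"
      using tensor_kernel_zero(3)[OF A M.left_module_axioms, of "\<one>\<^bsub>U\<^esub>" x] x by (simp add: UM_minus)
    from tensor_kernel_closed(4)[OF A M.left_module_axioms epimorphism_tensor_commute[OF epi x] this]
    show "(\<Sum>j\<in>UNIV. frag_of (a j, y j)) \<in> tensor_kernel R ?A UM"
      by (simp add: UNIV_bool a_def y_def algebra_simps)
  next
    show "subgroup ?N (tuple_group UM)" by (rule M.tuple_subgroup[OF M.ideal_span_subgroup[OF D]])
  next
    fix b :: "bool \<Rightarrow> 'r" and w assume b: "\<And>j. b j \<in> carrier R" and "A.rcomb UNIV a b = \<zero>\<^bsub>?A\<^esub>" and w: "w \<in> carrier UM"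
    moreover have "A.rcomb UNIV a b = \<one>\<^bsub>U\<^esub> \<otimes>\<^bsub>U\<^esub> u (b False) \<oplus>\<^bsub>U\<^esub> x \<otimes>\<^bsub>U\<^esub> u (b True)"
      using x b by (simp add: A.rcomb_def UNIV_bool a_def)
    ultimately have "x \<otimes>\<^bsub>U\<^esub> u (b True) = u (\<ominus>\<^bsub>R\<^esub> b False)"
      using x U.minus_equality[of "x \<otimes>\<^bsub>U\<^esub> u (b True)" "u (b False)"] by (simp add: U.a_comm)
    then have "b True \<in> ?D" using b by (auto simp: denominators_def simp del: u_simps(6))
    then show "(\<lambda>j. b j \<odot>\<^bsub>UM\<^esub> w) \<in> ?N" using b w M.ideal_spanI by auto
  qed (use x in \<open>auto simp: a_def y_def\<close>)
  then show "\<one>\<^bsub>U\<^esub> \<in> ideal_span UM ?D" by (simp add: y_def)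
qed

lemma common_denominators:
  assumes "finite E" "E \<subseteq> carrier U"
  shows "{r \<in> carrier R. \<forall>x\<in>E. r \<in> denominators x} \<in> gabriel_topology R U u"
  using assms
proof (induction E)
  case empty
  have "right_ideal R (carrier R)" by (rule R.right_idealI) auto
  moreover have "\<one>\<^bsub>U\<^esub> \<in> ideal_span UM (carrier R)"
    using M.ideal_spanI[of "\<one>\<^bsub>R\<^esub>" "carrier R" "\<one>\<^bsub>U\<^esub>"] by simp
  ultimately show ?case by (simp add: gabriel_topology_iff)
next
  case (insert x E)
  have "{r \<in> carrier R. \<forall>x\<in>insert x E. r \<in> denominators x} =
    denominators x \<inter> {r \<in> carrier R. \<forall>x\<in>E. r \<in> denominators x}" by (auto simp: denominators_def)
  then show ?case
    using gabriel_topology_inter[OF denominators_in_gabriel_topology[of x]] insert by simp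
qed

end

section \<open>Kernels of maps from free modules onto flat modules\<close>

definition lsubmodule :: "('r, 's) ring_scheme \<Rightarrow> ('r, 'b, 'n) module_scheme \<Rightarrow> 'b set \<Rightarrow> bool"
  where "lsubmodule R M S \<longleftrightarrow> S \<subseteq> carrier M \<and> \<zero>\<^bsub>M\<^esub> \<in> S \<and>
    (\<forall>x\<in>S. \<forall>y\<in>S. x \<oplus>\<^bsub>M\<^esub> y \<in> S) \<and> (\<forall>a\<in>carrier R. \<forall>x\<in>S. a \<odot>\<^bsub>M\<^esub> x \<in> S)"

lemma lsubmoduleD:
  assumes "lsubmodule R M S"
  shows "\<lbrakk>x \<in> S; y \<in> S\<rbrakk> \<Longrightarrow> x \<oplus>\<^bsub>M\<^esub> y \<in> S"
    and "\<lbrakk>a \<in> carrier R; x \<in> S\<rbrakk> \<Longrightarrow> a \<odot>\<^bsub>M\<^esub> x \<in> S"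
  using assms by (auto simp: lsubmodule_def)

context left_module begin

lemma lsubmodule_minus:
  assumes "lsubmodule R M S" "x \<in> S"
  shows "\<ominus>\<^bsub>M\<^esub> x \<in> S"
proof -
  have "(\<ominus>\<^bsub>R\<^esub> \<one>\<^bsub>R\<^esub>) \<odot>\<^bsub>M\<^esub> x \<in> S" "x \<in> carrier M" using assms by (auto simp: lsubmodule_def)
  then show ?thesis using lsmult_minus[of "\<one>\<^bsub>R\<^esub>" x] by simp
qed

lemma lsubmodule_left_module:
  assumes S: "lsubmodule R M S"
  shows "left_module R (M\<lparr>carrier := S\<rparr>)"
proof -
  have S': "x \<in> carrier M" if "x \<in> S" for x using that S by (auto simp: lsubmodule_def)
  have neg: "\<exists>y\<in>S. y \<oplus>\<^bsub>M\<^esub> x = \<zero>\<^bsub>M\<^esub>" if "x \<in> S" for x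
    using lsubmodule_minus[OF S that] S'[OF that] M.l_neg by blast
  have "abelian_group (M\<lparr>carrier := S\<rparr>)"
    by (rule abelian_groupI) (use S S' neg in \<open>auto simp: lsubmodule_def M.a_assoc intro: M.a_comm\<close>)
  then show ?thesis
    by (intro left_module.intro left_module_axioms.intro R.ring_axioms)
      (use S S' in \<open>auto simp: lsubmodule_def lsmult_l_distr lsmult_r_distr lsmult_assoc\<close>)
qed

lemma finsum_in_lsubmodule:
  assumes "lsubmodule R M S" "finite A" "\<And>i. i \<in> A \<Longrightarrow> c i \<in> S"
  shows "finsum M c A \<in> S"
  using assms(2,3)
proof (induction A)
  case empty
  then show ?case using assms(1) by (simp add: lsubmodule_def)
next
  case (insert i A)
  have "c \<in> A \<rightarrow> carrier M" "c i \<in> carrier M" using insert assms(1) by (auto simp: lsubmodule_def)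
  then show ?case using insert assms(1) by (simp add: lsubmodule_def)
qed

lemma free_eval_cong:
  assumes "m \<in> Y \<rightarrow> carrier M" "\<And>y. y \<in> Y \<Longrightarrow> m y = m' y" "\<theta> \<in> carrier (free_mod R Y)"
  shows "free_eval R M m \<theta> = free_eval R M m' \<theta>"
proof -
  have supp: "{x. \<theta> x \<noteq> \<zero>\<^bsub>R\<^esub>} \<subseteq> Y" "\<And>x. \<theta> x \<in> carrier R" using assms(3) by (auto simp: free_mod_def)
  show ?thesis unfolding free_eval_def
  proof (rule M.finsum_cong'[OF refl])
    show "(\<lambda>x. \<theta> x \<odot>\<^bsub>M\<^esub> m' x) \<in> {x. \<theta> x \<noteq> \<zero>\<^bsub>R\<^esub>} \<rightarrow> carrier M"
    proof
      fix x assume "x \<in> {x. \<theta> x \<noteq> \<zero>\<^bsub>R\<^esub>}"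
      then have "x \<in> Y" using supp by blast
      then have "m' x \<in> carrier M" using funcset_mem[OF assms(1), of x] assms(2)[of x] by simp
      then show "\<theta> x \<odot>\<^bsub>M\<^esub> m' x \<in> carrier M" using supp by simp
    qed
    show "\<theta> x \<odot>\<^bsub>M\<^esub> m x = \<theta> x \<odot>\<^bsub>M\<^esub> m' x" if "x \<in> {x. \<theta> x \<noteq> \<zero>\<^bsub>R\<^esub>}" for x
      using that supp(1) assms(2)[of x] by auto
  qed
qed

end

definition free_basis :: "('r, 's) ring_scheme \<Rightarrow> 'p \<Rightarrow> 'p \<Rightarrow> 'r"
  where "free_basis R x = (\<lambda>y. if y = x then \<one>\<^bsub>R\<^esub> else \<zero>\<^bsub>R\<^esub>)"

lemma free_basis_closed: "ring R \<Longrightarrow> x \<in> Y \<Longrightarrow> free_basis R x \<in> carrier (free_mod R Y)"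
  by (auto simp: free_basis_def free_mod_def ring.ring_simprules)

lemma (in left_module) free_eval_free_basis:
  "\<lbrakk>m \<in> Y \<rightarrow> carrier M; x \<in> Y\<rbrakk> \<Longrightarrow> free_eval R M m (free_basis R x) = m x"
  unfolding free_basis_def by (rule free_eval_basis)

lemma free_mod_simps [simp]:
  "(\<theta> \<oplus>\<^bsub>free_mod R Y\<^esub> \<psi>) = (\<lambda>x. \<theta> x \<oplus>\<^bsub>R\<^esub> \<psi> x)" "\<zero>\<^bsub>free_mod R Y\<^esub> = (\<lambda>x. \<zero>\<^bsub>R\<^esub>)"
  "a \<odot>\<^bsub>free_mod R Y\<^esub> \<theta> = (\<lambda>x. a \<otimes>\<^bsub>R\<^esub> \<theta> x)"
  by (simp_all add: free_mod_def)

lemma free_modD: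
  assumes "\<theta> \<in> carrier (free_mod R Y)"
  shows "\<theta> x \<in> carrier R" "x \<notin> Y \<Longrightarrow> \<theta> x = \<zero>\<^bsub>R\<^esub>" "finite {x. \<theta> x \<noteq> \<zero>\<^bsub>R\<^esub>}"
  using assms by (auto simp: free_mod_def)

lemma free_eval_self:
  fixes R :: "('r, 's) ring_scheme"
  assumes R: "ring R" and \<theta>: "\<theta> \<in> carrier (free_mod R Y)"
  shows "free_eval R (free_mod R Y) (free_basis R) \<theta> = \<theta>"
proof
  fix z
  interpret R: ring R by fact
  let ?F = "free_mod R Y" and ?S = "{x. \<theta> x \<noteq> \<zero>\<^bsub>R\<^esub>}"
  interpret F: left_module R ?F by (rule free_mod_left_module[OF R])
  have L: "left_module R (restrict_scalars R (\<lambda>r. r))" (is "left_module R ?L")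
    by (rule restrict_scalars_left_module[OF R R]) (auto intro: ring_hom_memI)
  interpret L: left_module R ?L by fact
  have ev: "(\<lambda>\<psi>. \<psi> z) \<in> mod_hom R ?F ?L" by (rule mod_homI) (auto dest: free_modD)
  have S: "finite ?S" "?S \<subseteq> Y" using free_modD[OF \<theta>] by auto
  have "free_eval R ?F (free_basis R) \<theta> z = finsum ?L (\<lambda>x. (\<theta> x \<odot>\<^bsub>?F\<^esub> free_basis R x) z) ?S"
    unfolding free_eval_def
  proof (rule mod_hom_finsum[OF F.M.abelian_group_axioms L.M.abelian_group_axioms ev S(1)])
    show "(\<lambda>x. \<theta> x \<odot>\<^bsub>?F\<^esub> free_basis R x) \<in> ?S \<rightarrow> carrier ?F"
    proof
      fix x assume "x \<in> ?S"
      then have "free_basis R x \<in> carrier ?F" using S(2) by (intro free_basis_closed[OF R]) blast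
      then show "\<theta> x \<odot>\<^bsub>?F\<^esub> free_basis R x \<in> carrier ?F"
        by (rule F.lsmult_closed[OF free_modD(1)[OF \<theta>]])
    qed
  qed
  also have "\<dots> = finsum ?L (\<lambda>x. if z = x then \<theta> x else \<zero>\<^bsub>?L\<^esub>) ?S"
    by (rule L.M.finsum_cong') (use free_modD(1)[OF \<theta>] in \<open>auto simp: free_basis_def\<close>)
  also have "\<dots> = \<theta> z"
  proof (cases "z \<in> ?S")
    case True
    then show ?thesis using L.M.finsum_singleton[OF True S(1), of \<theta>] free_modD(1)[OF \<theta>] by auto
  next
    case False
    then have "finsum ?L (\<lambda>x. if z = x then \<theta> x else \<zero>\<^bsub>?L\<^esub>) ?S = \<zero>\<^bsub>?L\<^esub>"
      by (intro L.M.add.finprod_one_eqI) auto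
    then show ?thesis using False by simp
  qed
  finally show "free_eval R ?F (free_basis R) \<theta> z = \<theta> z" .
qed

lemma projective_moduleI:
  fixes P :: "('r, 'p) module"
  assumes "left_module R P"
    and "\<And>(M :: ('r, 'p \<Rightarrow> 'r) module) (N :: ('r, 'p) module) f g.
      \<lbrakk>left_module R M; left_module R N; f \<in> mod_hom R M N; f ` carrier M = carrier N;
        g \<in> mod_hom R P N\<rbrakk> \<Longrightarrow> \<exists>h\<in>mod_hom R P M. \<forall>x\<in>carrier P. f (h x) = g x"
  shows "projective_module R P"
  using assms unfolding projective_module_def by blast

lemma free_mod_projective:
  fixes R :: "('r, 's) ring_scheme" and Y :: "'p set"
  assumes R: "ring R"
  shows "projective_module R (free_mod R Y)"
proof (rule projective_moduleI)
  let ?F = "free_mod R Y"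
  show F: "left_module R ?F" by (rule free_mod_left_module[OF R])
  fix M :: "('r, ('p \<Rightarrow> 'r) \<Rightarrow> 'r) module" and N :: "('r, 'p \<Rightarrow> 'r) module" and f g
  assume M: "left_module R M" and N: "left_module R N" and f: "f \<in> mod_hom R M N"
    and surj: "f ` carrier M = carrier N" and g: "g \<in> mod_hom R ?F N"
  interpret M: left_module R M by fact
  interpret N: left_module R N by fact
  have e: "free_basis R \<in> Y \<rightarrow> carrier ?F"
    by (rule Pi_I) (rule free_basis_closed[OF R])
  have "\<exists>w\<in>carrier M. f w = g (free_basis R y)" if "y \<in> Y" for y
  proof -
    have ey: "free_basis R y \<in> carrier ?F" by (rule free_basis_closed[OF R that])
    have "g (free_basis R y) \<in> carrier N" by (rule mod_homD(1)[OF g ey])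
    then have "g (free_basis R y) \<in> f ` carrier M" by (simp only: surj)
    then show ?thesis by (auto simp: image_iff eq_commute)
  qed
  then obtain m where m: "\<And>y. y \<in> Y \<Longrightarrow> m y \<in> carrier M" "\<And>y. y \<in> Y \<Longrightarrow> f (m y) = g (free_basis R y)"
    by metis
  then have mY: "m \<in> Y \<rightarrow> carrier M" by blast
  show "\<exists>h\<in>mod_hom R ?F M. \<forall>x\<in>carrier ?F. f (h x) = g x"
  proof (intro bexI ballI)
    show "free_eval R M m \<in> mod_hom R ?F M" by (rule M.free_eval_hom[OF mY])
    fix \<theta> assume \<theta>: "\<theta> \<in> carrier ?F"
    have "f (free_eval R M m \<theta>) = free_eval R N (\<lambda>y. f (m y)) \<theta>"
      by (rule mod_hom_free_eval[OF M N f mY \<theta>])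
    also have "\<dots> = free_eval R N (\<lambda>y. g (free_basis R y)) \<theta>"
    proof (rule N.free_eval_cong[OF _ m(2) \<theta>])
      show "(\<lambda>y. f (m y)) \<in> Y \<rightarrow> carrier N" using mod_homD(1)[OF f m(1)] by blast
    qed
    also have "\<dots> = g (free_eval R ?F (free_basis R) \<theta>)"
      by (rule mod_hom_free_eval[OF F N g e \<theta>, symmetric])
    also have "\<dots> = g \<theta>" by (simp only: free_eval_self[OF R \<theta>])
    finally show "f (free_eval R M m \<theta>) = g \<theta>" .
  qed
qed

text \<open>Let \<open>\<beta>\<^sub>n\<close> be an endomorphism with \<open>(1 - \<beta>\<^sub>n) F \<subseteq> K\<close> that kills \<open>\<alpha>\<^sub>n k\<^sub>n\<close>, where \<open>\<alpha>\<^sub>0 = 1\<close> and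
  \<open>\<alpha>\<^sub>n\<^sub>+\<^sub>1 = \<beta>\<^sub>n \<alpha>\<^sub>n\<close>.  All \<open>\<alpha>\<^sub>n\<close> map \<open>K\<close> to itself, and as \<open>\<alpha>\<^sub>n\<^sub>+\<^sub>1 k\<^sub>n = 0\<close>, each element of \<open>K\<close> is
  killed by some \<open>\<alpha>\<^sub>n\<close>.  To lift \<open>g : K \<rightarrow> N\<close> along \<open>f : M \<rightarrow> N\<close>, lift each
  \<open>g (1 - \<beta>\<^sub>n) : F \<rightarrow> N\<close> to \<open>H\<^sub>n : F \<rightarrow> M\<close> and put \<open>h x = \<Sum> H\<^sub>n (\<alpha>\<^sub>n x)\<close>: then
  \<open>f (h x) = \<Sum> g (\<alpha>\<^sub>n x - \<alpha>\<^sub>n\<^sub>+\<^sub>1 x)\<close> telescopes to \<open>g x\<close>.\<close>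

lemma locally_split_projective:
  fixes R :: "('r, 's) ring_scheme" and F :: "('r, 'p) module" and k :: "nat \<Rightarrow> 'p"
  assumes F: "projective_module R F" and K: "lsubmodule R F K"
    and split: "\<And>x. x \<in> K \<Longrightarrow> \<exists>\<beta>\<in>mod_hom R F F. (\<forall>y\<in>carrier F. y \<ominus>\<^bsub>F\<^esub> \<beta> y \<in> K) \<and> \<beta> x = \<zero>\<^bsub>F\<^esub>"
    and k: "\<And>n. k n \<in> K"
    and gen: "\<And>L. \<lbrakk>lsubmodule R F L; \<And>n. k n \<in> L\<rbrakk> \<Longrightarrow> K \<subseteq> L"
  shows "projective_module R (F\<lparr>carrier := K\<rparr>)"
proof (rule projective_moduleI)
  have Fm: "left_module R F" using F by (simp add: projective_module_def)
  interpret F: left_module R F by fact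
  let ?K = "F\<lparr>carrier := K\<rparr>"
  show K_mod: "left_module R ?K" by (rule F.lsubmodule_left_module[OF K])
  interpret K: left_module R ?K by fact
  have K_sub: "x \<in> carrier F" if "x \<in> K" for x using that K by (auto simp: lsubmodule_def)
  have F0: "h \<zero>\<^bsub>F\<^esub> = \<zero>\<^bsub>F\<^esub>" if "h \<in> mod_hom R F F" for h
    by (rule mod_hom_zero[OF F.M.abelian_group_axioms F.M.abelian_group_axioms that])
  obtain B where B: "\<And>x. x \<in> K \<Longrightarrow> B x \<in> mod_hom R F F"
    "\<And>x y. \<lbrakk>x \<in> K; y \<in> carrier F\<rbrakk> \<Longrightarrow> y \<ominus>\<^bsub>F\<^esub> B x y \<in> K" "\<And>x. x \<in> K \<Longrightarrow> B x x = \<zero>\<^bsub>F\<^esub>"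
    using split by metis
  define \<alpha> where "\<alpha> = rec_nat (\<lambda>y. y) (\<lambda>n \<phi> y. B (\<phi> (k n)) (\<phi> y))"
  have \<alpha>_simps: "\<alpha> 0 y = y" "\<alpha> (Suc n) y = B (\<alpha> n (k n)) (\<alpha> n y)" for n y
    by (simp_all add: \<alpha>_def)
  have B_K: "B x y \<in> K" if "x \<in> K" "y \<in> K" for x y
  proof -
    have y: "y \<in> carrier F" "B x y \<in> carrier F" using that K_sub mod_homD(1)[OF B(1)] by auto
    have "y \<oplus>\<^bsub>F\<^esub> \<ominus>\<^bsub>F\<^esub> (y \<ominus>\<^bsub>F\<^esub> B x y) \<in> K"
      using that(2) F.lsubmodule_minus[OF K B(2)[OF that(1) y(1)]] K by (simp add: lsubmodule_def)
    moreover have "y \<oplus>\<^bsub>F\<^esub> \<ominus>\<^bsub>F\<^esub> (y \<ominus>\<^bsub>F\<^esub> B x y) = B x y"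
      using y by (simp add: a_minus_def F.M.minus_add F.M.a_assoc[symmetric] F.M.r_neg)
    ultimately show ?thesis by simp
  qed
  have \<alpha>: "\<alpha> n \<in> mod_hom R F F \<and> (\<forall>y\<in>K. \<alpha> n y \<in> K)" for n
  proof (induction n)
    case 0
    show ?case unfolding \<alpha>_simps mod_hom_def by (simp add: \<alpha>_simps)
  next
    case (Suc n)
    then have "\<alpha> n (k n) \<in> K" using k by blast
    from mod_hom_comp[OF conjunct1[OF Suc] B(1)[OF this]] B_K[OF this] Suc
    show ?case by (simp add: \<alpha>_simps[abs_def])
  qed
  note \<alpha>_hom = conjunct1[OF \<alpha>]
  define \<beta> where "\<beta> n = B (\<alpha> n (k n))" for n
  have \<alpha>k: "\<alpha> n (k n) \<in> K" for n using \<alpha> k by blast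
  have \<alpha>_Suc: "\<alpha> (Suc n) y = \<beta> n (\<alpha> n y)" for n y by (simp add: \<alpha>_simps \<beta>_def)
  have \<beta>: "\<beta> n \<in> mod_hom R F F" "y \<in> carrier F \<Longrightarrow> y \<ominus>\<^bsub>F\<^esub> \<beta> n y \<in> K" for n y
    unfolding \<beta>_def using B \<alpha>k by auto
  have \<alpha>_stable: "\<alpha> j y = \<zero>\<^bsub>F\<^esub>" if "\<alpha> n y = \<zero>\<^bsub>F\<^esub>" "n \<le> j" for n j y
    using that(2,1) by (induction j rule: dec_induct) (simp_all add: \<alpha>_Suc F0[OF \<beta>(1)])
  define L where "L = {y \<in> carrier F. \<exists>n. \<alpha> n y = \<zero>\<^bsub>F\<^esub>}"
  have "K \<subseteq> L"
  proof (rule gen)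
    show "k n \<in> L" for n
    proof -
      have "\<alpha> (Suc n) (k n) = \<zero>\<^bsub>F\<^esub>" using B(3)[OF \<alpha>k] by (simp add: \<alpha>_simps)
      then show ?thesis using k K_sub unfolding L_def by blast
    qed
    show "lsubmodule R F L"
      unfolding lsubmodule_def
    proof (intro conjI ballI)
      show "L \<subseteq> carrier F" by (auto simp: L_def)
      show "\<zero>\<^bsub>F\<^esub> \<in> L" by (auto simp: L_def \<alpha>_simps intro!: exI[of _ 0])
      fix x y assume "x \<in> L" "y \<in> L"
      then obtain i j where ij: "\<alpha> i x = \<zero>\<^bsub>F\<^esub>" "\<alpha> j y = \<zero>\<^bsub>F\<^esub>" "x \<in> carrier F" "y \<in> carrier F"
        by (auto simp: L_def)
      then have "\<alpha> (max i j) (x \<oplus>\<^bsub>F\<^esub> y) = \<zero>\<^bsub>F\<^esub>"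
        using mod_homD(2)[OF \<alpha>_hom] \<alpha>_stable by simp
      then show "x \<oplus>\<^bsub>F\<^esub> y \<in> L" using ij by (auto simp: L_def)
    next
      fix a x assume a: "a \<in> carrier R" and "x \<in> L"
      then obtain i where i: "\<alpha> i x = \<zero>\<^bsub>F\<^esub>" "x \<in> carrier F" by (auto simp: L_def)
      then have "\<alpha> i (a \<odot>\<^bsub>F\<^esub> x) = \<zero>\<^bsub>F\<^esub>" using mod_homD(3)[OF \<alpha>_hom] a by simp
      then show "a \<odot>\<^bsub>F\<^esub> x \<in> L" using i a by (auto simp: L_def)
    qed
  qed
  then have \<alpha>_zero: "\<exists>n. \<alpha> n x = \<zero>\<^bsub>F\<^esub>" if "x \<in> K" for x using that by (auto simp: L_def)
  fix M :: "('r, 'p \<Rightarrow> 'r) module" and N :: "('r, 'p) module" and f g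
  assume M: "left_module R M" and N: "left_module R N" and f: "f \<in> mod_hom R M N"
    and surj: "f ` carrier M = carrier N" and g: "g \<in> mod_hom R ?K N"
  interpret M: left_module R M by fact
  interpret N: left_module R N by fact
  have "\<exists>h\<in>mod_hom R F M. \<forall>y\<in>carrier F. f (h y) = g (y \<ominus>\<^bsub>F\<^esub> \<beta> n y)" for n
  proof -
    have "(\<lambda>y. y \<ominus>\<^bsub>F\<^esub> \<beta> n y) \<in> mod_hom R F ?K"
      using \<beta>(2) mod_homD[OF \<beta>(1)]
      by (intro mod_homI) (auto simp: a_minus_def F.M.minus_add F.M.a_ac F.lsmult_r_distr F.lsmult_minus_right)
    from mod_hom_comp[OF this g] have "(\<lambda>y. g (y \<ominus>\<^bsub>F\<^esub> \<beta> n y)) \<in> mod_hom R F N" .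
    with F M N f surj show ?thesis unfolding projective_module_def by blast
  qed
  then obtain H where H: "\<And>n. H n \<in> mod_hom R F M"
    "\<And>n y. y \<in> carrier F \<Longrightarrow> f (H n y) = g (y \<ominus>\<^bsub>F\<^esub> \<beta> n y)" by metis
  have H0: "H n \<zero>\<^bsub>F\<^esub> = \<zero>\<^bsub>M\<^esub>" for n
    by (rule mod_hom_zero[OF F.M.abelian_group_axioms M.M.abelian_group_axioms H(1)])
  define h where "h x = finsum M (\<lambda>n. H n (\<alpha> n x)) {n. \<alpha> n x \<noteq> \<zero>\<^bsub>F\<^esub>}" for x
  have H_closed: "H n (\<alpha> n x) \<in> carrier M" if "x \<in> K" for n x
    using mod_homD(1)[OF H(1)] mod_homD(1)[OF \<alpha>_hom] K_sub[OF that] by blast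
  have h_eq: "h x = finsum M (\<lambda>n. H n (\<alpha> n x)) {..<n}" if x: "x \<in> K" and n: "\<alpha> n x = \<zero>\<^bsub>F\<^esub>" for x n
    unfolding h_def
  proof (rule M.M.add.finprod_mono_neutral_cong_left)
    show "{n. \<alpha> n x \<noteq> \<zero>\<^bsub>F\<^esub>} \<subseteq> {..<n}" using \<alpha>_stable[OF n] by (force simp: not_less[symmetric])
  qed (use x H0 H_closed in auto)
  show "\<exists>h\<in>mod_hom R ?K M. \<forall>x\<in>carrier ?K. f (h x) = g x"
  proof (intro bexI ballI)
    show "h \<in> mod_hom R ?K M"
    proof (rule mod_homI)
      fix x assume "x \<in> carrier ?K"
      then show "h x \<in> carrier M" unfolding h_def using H_closed by (intro M.M.finsum_closed) auto
    next
      fix x y assume "x \<in> carrier ?K" "y \<in> carrier ?K"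
      then have x: "x \<in> K" and y: "y \<in> K" by simp_all
      obtain i j where "\<alpha> i x = \<zero>\<^bsub>F\<^esub>" "\<alpha> j y = \<zero>\<^bsub>F\<^esub>" using \<alpha>_zero x y by blast
      then have n: "\<alpha> (max i j) x = \<zero>\<^bsub>F\<^esub>" "\<alpha> (max i j) y = \<zero>\<^bsub>F\<^esub>" using \<alpha>_stable by auto
      let ?n = "max i j"
      have xy: "x \<oplus>\<^bsub>F\<^esub> y \<in> K" using x y K by (simp add: lsubmodule_def)
      have "\<alpha> ?n (x \<oplus>\<^bsub>F\<^esub> y) = \<zero>\<^bsub>F\<^esub>" using n mod_homD(2)[OF \<alpha>_hom] K_sub x y by simp
      then have "h (x \<oplus>\<^bsub>F\<^esub> y) = finsum M (\<lambda>n. H n (\<alpha> n (x \<oplus>\<^bsub>F\<^esub> y))) {..<?n}" by (rule h_eq[OF xy])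
      also have "\<dots> = finsum M (\<lambda>n. H n (\<alpha> n x) \<oplus>\<^bsub>M\<^esub> H n (\<alpha> n y)) {..<?n}"
        using mod_homD(2)[OF \<alpha>_hom] mod_homD(1)[OF \<alpha>_hom] mod_homD(2)[OF H(1)] H_closed K_sub x y
        by (intro M.M.finsum_cong') auto
      also have "\<dots> = h x \<oplus>\<^bsub>M\<^esub> h y"
        unfolding h_eq[OF x n(1)] h_eq[OF y n(2)]
        using H_closed x y by (intro M.M.finsum_addf) auto
      finally show "h (x \<oplus>\<^bsub>?K\<^esub> y) = h x \<oplus>\<^bsub>M\<^esub> h y" by simp
    next
      fix a x assume a: "a \<in> carrier R" and "x \<in> carrier ?K"
      then have x: "x \<in> K" by simp
      obtain n where n: "\<alpha> n x = \<zero>\<^bsub>F\<^esub>" using \<alpha>_zero x by blast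
      have ax: "a \<odot>\<^bsub>F\<^esub> x \<in> K" using a x K by (simp add: lsubmodule_def)
      have "\<alpha> n (a \<odot>\<^bsub>F\<^esub> x) = \<zero>\<^bsub>F\<^esub>" using n a mod_homD(3)[OF \<alpha>_hom] K_sub x by simp
      then have "h (a \<odot>\<^bsub>F\<^esub> x) = finsum M (\<lambda>n. H n (\<alpha> n (a \<odot>\<^bsub>F\<^esub> x))) {..<n}" by (rule h_eq[OF ax])
      also have "\<dots> = finsum M (\<lambda>n. a \<odot>\<^bsub>M\<^esub> H n (\<alpha> n x)) {..<n}"
        using mod_homD(3)[OF \<alpha>_hom] mod_homD(1)[OF \<alpha>_hom] mod_homD(3)[OF H(1)] H_closed K_sub x a
        by (intro M.M.finsum_cong') auto
      also have "\<dots> = a \<odot>\<^bsub>M\<^esub> h x"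
        unfolding h_eq[OF x n] using H_closed x a by (intro M.lsmult_finsum[symmetric]) auto
      finally show "h (a \<odot>\<^bsub>?K\<^esub> x) = a \<odot>\<^bsub>M\<^esub> h x" by simp
    qed
    fix x assume "x \<in> carrier ?K"
    then have x: "x \<in> K" by simp
    have \<alpha>x: "\<alpha> n x \<in> K" for n using \<alpha> x by blast
    have diff: "y \<ominus>\<^bsub>F\<^esub> z \<in> K" if "y \<in> K" "z \<in> K" for y z
      using that F.lsubmodule_minus[OF K that(2)] K by (simp add: lsubmodule_def a_minus_def)
    have telescope: "finsum N (\<lambda>n. g (\<alpha> n x \<ominus>\<^bsub>F\<^esub> \<alpha> (Suc n) x)) {..<n} =
      g (x \<ominus>\<^bsub>F\<^esub> \<alpha> n x)" for n
    proof (induction n)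
      case 0
      have "x \<ominus>\<^bsub>F\<^esub> x = \<zero>\<^bsub>F\<^esub>" using x K_sub by (simp add: a_minus_def F.M.r_neg)
      then show ?case
        using mod_hom_zero[OF K.M.abelian_group_axioms N.M.abelian_group_axioms g] by (simp add: \<alpha>_simps)
    next
      case (Suc n)
      have "finsum N (\<lambda>n. g (\<alpha> n x \<ominus>\<^bsub>F\<^esub> \<alpha> (Suc n) x)) {..<Suc n} =
        g (\<alpha> n x \<ominus>\<^bsub>F\<^esub> \<alpha> (Suc n) x) \<oplus>\<^bsub>N\<^esub> g (x \<ominus>\<^bsub>F\<^esub> \<alpha> n x)"
        unfolding lessThan_Suc Suc.IH[symmetric] using \<alpha>x diff mod_homD(1)[OF g]
        by (intro N.M.finsum_insert) auto
      also have "\<dots> = g ((\<alpha> n x \<ominus>\<^bsub>F\<^esub> \<alpha> (Suc n) x) \<oplus>\<^bsub>F\<^esub> (x \<ominus>\<^bsub>F\<^esub> \<alpha> n x))"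
        using mod_homD(2)[OF g] diff x \<alpha>x by simp
      also have "(\<alpha> n x \<ominus>\<^bsub>F\<^esub> \<alpha> (Suc n) x) \<oplus>\<^bsub>F\<^esub> (x \<ominus>\<^bsub>F\<^esub> \<alpha> n x) = x \<ominus>\<^bsub>F\<^esub> \<alpha> (Suc n) x"
        using K_sub[OF \<alpha>x[of n]] K_sub[OF \<alpha>x[of "Suc n"]] K_sub[OF x]
        by (simp add: a_minus_def F.M.a_ac F.M.r_neg1 F.M.r_neg2)
      finally show ?case .
    qed
    obtain n where n: "\<alpha> n x = \<zero>\<^bsub>F\<^esub>" using \<alpha>_zero x by blast
    have "f (h x) = finsum N (\<lambda>n. f (H n (\<alpha> n x))) {..<n}"
      unfolding h_eq[OF x n]
      by (rule mod_hom_finsum[OF M.M.abelian_group_axioms N.M.abelian_group_axioms f])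
        (use H_closed x in auto)
    also have "\<dots> = finsum N (\<lambda>n. g (\<alpha> n x \<ominus>\<^bsub>F\<^esub> \<alpha> (Suc n) x)) {..<n}"
      by (rule N.M.finsum_cong')
        (use H(2) \<alpha>x K_sub diff mod_homD(1)[OF g] in \<open>auto simp: \<alpha>_Suc[symmetric]\<close>)
    also have "\<dots> = g (x \<ominus>\<^bsub>F\<^esub> \<alpha> n x)" by (rule telescope)
    also have "g (x \<ominus>\<^bsub>F\<^esub> \<alpha> n x) = g x"
    proof -
      have neg_zero: "\<ominus>\<^bsub>F\<^esub> \<zero>\<^bsub>F\<^esub> = \<zero>\<^bsub>F\<^esub>" by (rule F.M.minus_equality) auto
      show ?thesis unfolding n a_minus_def neg_zero F.M.r_zero[OF K_sub[OF x]] ..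
    qed
    finally show "f (h x) = g x" .
  qed
qed

text \<open>By flatness, the relation \<open>\<Sum> \<theta>\<^sub>y m\<^sub>y = 0\<close> has a reason: there are lifts \<open>W\<^sub>y \<in> F\<close> of the
  \<open>m\<^sub>y\<close> with \<open>\<Sum> \<theta>\<^sub>y W\<^sub>y = 0\<close>.  The endomorphism \<open>\<beta>\<close> sends the basis vector \<open>y\<close> to \<open>W\<^sub>y\<close> if
  \<open>\<theta>\<^sub>y \<noteq> 0\<close> and to itself otherwise.\<close>

lemma flat_kernel_locally_split:
  fixes R :: "('r, 's) ring_scheme" and M :: "('r, 'c, 'n) module_scheme" and Y :: "'p set"
  assumes flat: "flat_left_module R M" and m: "m \<in> Y \<rightarrow> carrier M"
    and surj: "free_eval R M m ` carrier (free_mod R Y) = carrier M"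
    and \<theta>: "\<theta> \<in> carrier (free_mod R Y)" and zero: "free_eval R M m \<theta> = \<zero>\<^bsub>M\<^esub>"
  shows "\<exists>\<beta>\<in>mod_hom R (free_mod R Y) (free_mod R Y).
    (\<forall>\<psi>\<in>carrier (free_mod R Y). free_eval R M m (\<beta> \<psi>) = free_eval R M m \<psi>) \<and> \<beta> \<theta> = \<zero>\<^bsub>free_mod R Y\<^esub>"
proof -
  have M: "left_module R M" using flat by (simp add: flat_left_module_def)
  interpret M: left_module R M by fact
  have R: "ring R" by (rule M.R.ring_axioms)
  let ?F = "free_mod R Y" and ?\<epsilon> = "free_eval R M m"
  have F: "left_module R ?F" by (rule free_mod_left_module[OF R])
  interpret F: left_module R ?F by fact
  have \<epsilon>: "?\<epsilon> \<in> mod_hom R ?F M" by (rule M.free_eval_hom[OF m])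
  define J where "J = {x. \<theta> x \<noteq> \<zero>\<^bsub>R\<^esub>}"
  have J: "finite J" "J \<subseteq> Y" and \<theta>R: "\<And>y. \<theta> y \<in> carrier R"
    using free_modD[OF \<theta>] by (auto simp: J_def)
  \<comment> \<open>The tuples \<open>v\<close> that lift to tuples \<open>W\<close> in \<open>F\<close> satisfying the given relation.\<close>
  define N where "N = {v. \<exists>W. (\<forall>j. W j \<in> carrier ?F) \<and> (\<forall>j. ?\<epsilon> (W j) = v j) \<and>
    finsum ?F (\<lambda>j. \<theta> j \<odot>\<^bsub>?F\<^esub> W j) J = \<zero>\<^bsub>?F\<^esub>}"
  have NI: "v \<in> N" if "\<And>j. W j \<in> carrier ?F" "\<And>j. ?\<epsilon> (W j) = v j"
    "finsum ?F (\<lambda>j. \<theta> j \<odot>\<^bsub>?F\<^esub> W j) J = \<zero>\<^bsub>?F\<^esub>" for v W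
    unfolding N_def using that by blast
  interpret V: comm_group "tuple_group M :: ('p \<Rightarrow> 'c) monoid" by (rule M.M.tuple_comm_group)
  have \<theta>W: "\<theta> j \<odot>\<^bsub>?F\<^esub> W j \<in> carrier ?F" if "\<And>j. W j \<in> carrier ?F" for W j
    by (rule F.lsmult_closed[OF \<theta>R that])
  have rel_add: "finsum ?F (\<lambda>j. \<theta> j \<odot>\<^bsub>?F\<^esub> (W j \<oplus>\<^bsub>?F\<^esub> Z j)) J =
      finsum ?F (\<lambda>j. \<theta> j \<odot>\<^bsub>?F\<^esub> W j) J \<oplus>\<^bsub>?F\<^esub> finsum ?F (\<lambda>j. \<theta> j \<odot>\<^bsub>?F\<^esub> Z j) J"
    if "\<And>j. W j \<in> carrier ?F" "\<And>j. Z j \<in> carrier ?F" for W Z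
    unfolding F.lsmult_r_distr[OF \<theta>R that]
    by (rule F.M.finsum_addf) (rule Pi_I, rule \<theta>W, rule that)+
  have rel_zero: "finsum ?F (\<lambda>j. \<theta> j \<odot>\<^bsub>?F\<^esub> \<zero>\<^bsub>?F\<^esub>) J = \<zero>\<^bsub>?F\<^esub>"
    unfolding F.lsmult_zero_right[OF \<theta>R] by (rule F.M.finsum_zero)
  have N: "subgroup N (tuple_group M)"
  proof (rule V.subgroupI)
    show "N \<subseteq> carrier (tuple_group M)"
    proof
      fix v assume "v \<in> N"
      then obtain W where "\<And>j. W j \<in> carrier ?F" "\<And>j. ?\<epsilon> (W j) = v j" unfolding N_def by blast
      then have "v j \<in> carrier M" for j using mod_homD(1)[OF \<epsilon>, of "W j"] by simp
      then show "v \<in> carrier (tuple_group M)" by simp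
    qed
    have "(\<lambda>_. \<zero>\<^bsub>M\<^esub>) \<in> N"
      by (rule NI[of "\<lambda>_. \<zero>\<^bsub>?F\<^esub>", OF F.M.zero_closed _ rel_zero])
        (rule mod_hom_zero[OF F.M.abelian_group_axioms M.M.abelian_group_axioms \<epsilon>])
    then show "N \<noteq> {}" by blast
  next
    fix v assume "v \<in> N"
    then obtain W where W: "\<And>j. W j \<in> carrier ?F" "\<And>j. ?\<epsilon> (W j) = v j"
      "finsum ?F (\<lambda>j. \<theta> j \<odot>\<^bsub>?F\<^esub> W j) J = \<zero>\<^bsub>?F\<^esub>"
      unfolding N_def by blast
    have v: "v j \<in> carrier M" for j using mod_homD(1)[OF \<epsilon> W(1)] W(2) by metis
    have W': "\<ominus>\<^bsub>?F\<^esub> W j \<in> carrier ?F" for j by (rule F.M.a_inv_closed[OF W(1)])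
    have "(\<lambda>j. \<ominus>\<^bsub>M\<^esub> v j) \<in> N"
    proof (rule NI[OF W'])
      fix j
      have "?\<epsilon> (\<ominus>\<^bsub>?F\<^esub> W j) \<oplus>\<^bsub>M\<^esub> v j = ?\<epsilon> (\<ominus>\<^bsub>?F\<^esub> W j \<oplus>\<^bsub>?F\<^esub> W j)"
        unfolding mod_homD(2)[OF \<epsilon> W' W(1)] W(2) ..
      also have "\<dots> = \<zero>\<^bsub>M\<^esub>"
        unfolding F.M.l_neg[OF W(1)]
        by (rule mod_hom_zero[OF F.M.abelian_group_axioms M.M.abelian_group_axioms \<epsilon>])
      finally show "?\<epsilon> (\<ominus>\<^bsub>?F\<^esub> W j) = \<ominus>\<^bsub>M\<^esub> v j"
        using M.M.minus_equality[OF _ v mod_homD(1)[OF \<epsilon> W']] by simp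
    next
      have "finsum ?F (\<lambda>j. \<theta> j \<odot>\<^bsub>?F\<^esub> (\<ominus>\<^bsub>?F\<^esub> W j)) J \<oplus>\<^bsub>?F\<^esub> \<zero>\<^bsub>?F\<^esub> = \<zero>\<^bsub>?F\<^esub>"
        using rel_add[of "\<lambda>j. \<ominus>\<^bsub>?F\<^esub> W j" W, OF W' W(1)]
        unfolding W(3) F.M.l_neg[OF W(1)] rel_zero by (rule sym)
      moreover have "finsum ?F (\<lambda>j. \<theta> j \<odot>\<^bsub>?F\<^esub> (\<ominus>\<^bsub>?F\<^esub> W j)) J \<in> carrier ?F"
        by (rule F.M.finsum_closed) (rule Pi_I, rule \<theta>W[OF W'])
      ultimately show "finsum ?F (\<lambda>j. \<theta> j \<odot>\<^bsub>?F\<^esub> (\<ominus>\<^bsub>?F\<^esub> W j)) J = \<zero>\<^bsub>?F\<^esub>"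
        by (simp only: F.M.r_zero)
    qed
    then show "inv\<^bsub>tuple_group M\<^esub> v \<in> N" using v by (simp add: M.M.tuple_inv)
  next
    fix v w assume "v \<in> N" "w \<in> N"
    then obtain W Z where W: "\<And>j. W j \<in> carrier ?F" "\<And>j. ?\<epsilon> (W j) = v j"
      "finsum ?F (\<lambda>j. \<theta> j \<odot>\<^bsub>?F\<^esub> W j) J = \<zero>\<^bsub>?F\<^esub>"
      and Z: "\<And>j. Z j \<in> carrier ?F" "\<And>j. ?\<epsilon> (Z j) = w j"
      "finsum ?F (\<lambda>j. \<theta> j \<odot>\<^bsub>?F\<^esub> Z j) J = \<zero>\<^bsub>?F\<^esub>"
      unfolding N_def by blast
    have "(\<lambda>j. v j \<oplus>\<^bsub>M\<^esub> w j) \<in> N"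
    proof (rule NI)
      show "W j \<oplus>\<^bsub>?F\<^esub> Z j \<in> carrier ?F" for j by (rule F.M.a_closed[OF W(1) Z(1)])
      show "?\<epsilon> (W j \<oplus>\<^bsub>?F\<^esub> Z j) = v j \<oplus>\<^bsub>M\<^esub> w j" for j
        unfolding mod_homD(2)[OF \<epsilon> W(1) Z(1)] W(2) Z(2) ..
      show "finsum ?F (\<lambda>j. \<theta> j \<odot>\<^bsub>?F\<^esub> (W j \<oplus>\<^bsub>?F\<^esub> Z j)) J = \<zero>\<^bsub>?F\<^esub>"
        unfolding rel_add[of W Z, OF W(1) Z(1)] W(3) Z(3) by simp
    qed
    then show "v \<otimes>\<^bsub>tuple_group M\<^esub> w \<in> N" by simp
  qed
  define x where "x j = (if j \<in> J then m j else \<zero>\<^bsub>M\<^esub>)" for j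
  have "x \<in> N"
  proof (rule flat_relation[OF flat J(1), of \<theta>])
    show "\<theta> \<in> J \<rightarrow> carrier R" using \<theta>R by blast
    show "x j \<in> carrier M" for j using m J(2) by (auto simp: x_def)
    show "x j = \<zero>\<^bsub>M\<^esub>" if "j \<notin> J" for j using that by (simp add: x_def)
    have "finsum M (\<lambda>j. \<theta> j \<odot>\<^bsub>M\<^esub> x j) J = finsum M (\<lambda>j. \<theta> j \<odot>\<^bsub>M\<^esub> m j) J"
      by (rule M.M.finsum_cong') (use m J(2) \<theta>R in \<open>auto simp: x_def Pi_iff subset_eq\<close>)
    then show "finsum M (\<lambda>j. \<theta> j \<odot>\<^bsub>M\<^esub> x j) J = \<zero>\<^bsub>M\<^esub>"
      using zero by (simp add: free_eval_def J_def)
    show "subgroup N (tuple_group M)" by (rule N)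
  next
    let ?A = "right_restrict_scalars R (\<lambda>r. r)"
    interpret A: right_module R ?A by (rule regular_right_module[OF R])
    fix b w assume b: "\<And>j. b j \<in> carrier R"
      and rel: "finsum ?A (\<lambda>j. \<theta> j \<otimes>\<^bsub>R\<^esub> b j) J = \<zero>\<^bsub>R\<^esub>" and w: "w \<in> carrier M"
    obtain W where W: "W \<in> carrier ?F" "?\<epsilon> W = w" using surj w by (metis imageE)
    show "(\<lambda>j. b j \<odot>\<^bsub>M\<^esub> w) \<in> N"
    proof (rule NI)
      show "b j \<odot>\<^bsub>?F\<^esub> W \<in> carrier ?F" for j by (rule F.lsmult_closed[OF b W(1)])
      show "?\<epsilon> (b j \<odot>\<^bsub>?F\<^esub> W) = b j \<odot>\<^bsub>M\<^esub> w" for j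
        unfolding mod_homD(3)[OF \<epsilon> b W(1)] W(2) ..
      have "finsum ?F (\<lambda>j. \<theta> j \<odot>\<^bsub>?F\<^esub> (b j \<odot>\<^bsub>?F\<^esub> W)) J =
          finsum ?F (\<lambda>j. (\<theta> j \<otimes>\<^bsub>R\<^esub> b j) \<odot>\<^bsub>?F\<^esub> W) J"
        by (rule F.M.finsum_cong'[OF refl])
          (use F.lsmult_closed[OF M.R.m_closed[OF \<theta>R b] W(1)] F.lsmult_assoc[OF \<theta>R b W(1)] in \<open>auto simp del: free_mod_simps\<close>)
      \<comment> \<open>The map \<open>r \<mapsto> r W\<close> starts from a right module, so only its additivity is used.\<close>
      also have "\<dots> = finsum ?A (\<lambda>j. \<theta> j \<otimes>\<^bsub>R\<^esub> b j) J \<odot>\<^bsub>?F\<^esub> W"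
        by (rule mod_hom_finsum[of ?A ?F "\<lambda>r. r \<odot>\<^bsub>?F\<^esub> W" "R\<lparr>carrier := {}\<rparr>", symmetric])
          (use W(1) J(1) \<theta>R b F.lsmult_closed F.lsmult_l_distr in
            \<open>auto intro!: mod_homI simp: A.M.abelian_group_axioms F.M.abelian_group_axioms simp del: free_mod_simps\<close>)
      also have "\<dots> = \<zero>\<^bsub>?F\<^esub>" unfolding rel by (rule F.lsmult_zero[OF W(1)])
      finally show "finsum ?F (\<lambda>j. \<theta> j \<odot>\<^bsub>?F\<^esub> (b j \<odot>\<^bsub>?F\<^esub> W)) J = \<zero>\<^bsub>?F\<^esub>" .
    qed
  qed
  then obtain W where W: "\<And>j. W j \<in> carrier ?F" "\<And>j. ?\<epsilon> (W j) = x j"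
    "finsum ?F (\<lambda>j. \<theta> j \<odot>\<^bsub>?F\<^esub> W j) J = \<zero>\<^bsub>?F\<^esub>"
    unfolding N_def by blast
  define c where "c y = (if y \<in> J then W y else free_basis R y)" for y
  have c: "c \<in> Y \<rightarrow> carrier ?F"
    using W(1) free_basis_closed[OF R, of _ Y] by (simp add: c_def Pi_iff)
  show ?thesis
  proof (intro bexI conjI ballI)
    show "free_eval R ?F c \<in> mod_hom R ?F ?F" by (rule F.free_eval_hom[OF c])
    have "free_eval R ?F c \<theta> = finsum ?F (\<lambda>j. \<theta> j \<odot>\<^bsub>?F\<^esub> W j) J"
      unfolding free_eval_def J_def[symmetric]
      by (rule F.M.finsum_cong'[OF refl])
        (use F.lsmult_closed[OF \<theta>R W(1)] in \<open>auto simp: c_def simp del: free_mod_simps\<close>)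
    then show "free_eval R ?F c \<theta> = \<zero>\<^bsub>?F\<^esub>" using W(3) by simp
    fix \<psi> assume \<psi>: "\<psi> \<in> carrier ?F"
    have "?\<epsilon> (free_eval R ?F c \<psi>) = free_eval R M (\<lambda>y. ?\<epsilon> (c y)) \<psi>"
      by (rule mod_hom_free_eval[OF F M \<epsilon> c \<psi>])
    also have "\<dots> = ?\<epsilon> \<psi>"
    proof (rule M.free_eval_cong[OF _ _ \<psi>])
      show "(\<lambda>y. ?\<epsilon> (c y)) \<in> Y \<rightarrow> carrier M" using c mod_homD(1)[OF \<epsilon>] by blast
      show "?\<epsilon> (c y) = m y" if "y \<in> Y" for y
        using that W(2) M.free_eval_free_basis[OF m] by (simp add: c_def x_def)
    qed
    finally show "?\<epsilon> (free_eval R ?F c \<psi>) = ?\<epsilon> \<psi>" .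
  qed
qed

section \<open>Projective resolutions of length one\<close>

text \<open>The resolution is \<open>\<dots> \<rightarrow> 0 \<rightarrow> K \<rightarrow> P\<close> with \<open>K\<close> the kernel of \<open>\<epsilon>\<close>.  All its terms are submodules
  of \<open>P\<close>, so every differential is an inclusion.\<close>

lemma projective_resolution_length_one:
  fixes R :: "('r, 's) ring_scheme" and M :: "('r, 'c, 'n) module_scheme"
    and P :: "('r, 'c \<times> nat \<Rightarrow> 'r) module"
  assumes M: "left_module R M" and P: "projective_module R P" and \<epsilon>: "\<epsilon> \<in> mod_hom R P M"
    and surj: "\<epsilon> ` carrier P = carrier M"
    and K: "projective_module R (P\<lparr>carrier := {x \<in> carrier P. \<epsilon> x = \<zero>\<^bsub>M\<^esub>}\<rparr>)"
  shows "has_projective_resolution R M 1"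
proof -
  interpret P: left_module R P using P by (simp add: projective_module_def)
  interpret M: left_module R M by fact
  define K where "K = {x \<in> carrier P. \<epsilon> x = \<zero>\<^bsub>M\<^esub>}"
  define Q where "Q i = (if i = 0 then P else P\<lparr>carrier := if i = 1 then K else {\<zero>\<^bsub>P\<^esub>}\<rparr>)" for i :: nat
  have Q: "Q 0 = P" "Q (Suc 0) = P\<lparr>carrier := K\<rparr>" "Q (Suc (Suc i)) = P\<lparr>carrier := {\<zero>\<^bsub>P\<^esub>}\<rparr>" for i
    by (simp_all add: Q_def)
  have Q_zero: "\<zero>\<^bsub>Q i\<^esub> = \<zero>\<^bsub>P\<^esub>" for i by (simp add: Q_def)
  have "\<epsilon> \<zero>\<^bsub>P\<^esub> = \<zero>\<^bsub>M\<^esub>"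
    by (rule mod_hom_zero[OF P.M.abelian_group_axioms M.M.abelian_group_axioms \<epsilon>])
  then have K0: "\<zero>\<^bsub>P\<^esub> \<in> K" "K \<subseteq> carrier P" by (auto simp: K_def)
  have "lsubmodule R P {\<zero>\<^bsub>P\<^esub>}" by (auto simp: lsubmodule_def)
  then have zero: "left_module R (P\<lparr>carrier := {\<zero>\<^bsub>P\<^esub>}\<rparr>)" by (rule P.lsubmodule_left_module)
  have zero_proj: "projective_module R (P\<lparr>carrier := {\<zero>\<^bsub>P\<^esub>}\<rparr>)"
  proof (rule projective_moduleI[OF zero])
    fix M' :: "('r, ('c \<times> nat \<Rightarrow> 'r) \<Rightarrow> 'r) module" and N :: "('r, 'c \<times> nat \<Rightarrow> 'r) module" and f g
    assume *: "left_module R M'" "left_module R N" "f \<in> mod_hom R M' N"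
      "g \<in> mod_hom R (P\<lparr>carrier := {\<zero>\<^bsub>P\<^esub>}\<rparr>) N"
    interpret M': left_module R M' by fact
    interpret N: left_module R N by fact
    interpret Z: left_module R "P\<lparr>carrier := {\<zero>\<^bsub>P\<^esub>}\<rparr>" by (rule zero)
    have "f \<zero>\<^bsub>M'\<^esub> = \<zero>\<^bsub>N\<^esub>" "g \<zero>\<^bsub>P\<^esub> = \<zero>\<^bsub>N\<^esub>"
      using mod_hom_zero[OF M'.M.abelian_group_axioms N.M.abelian_group_axioms *(3)]
        mod_hom_zero[OF Z.M.abelian_group_axioms N.M.abelian_group_axioms *(4)] by simp_all
    then show "\<exists>h\<in>mod_hom R (P\<lparr>carrier := {\<zero>\<^bsub>P\<^esub>}\<rparr>) M'.
        \<forall>x\<in>carrier (P\<lparr>carrier := {\<zero>\<^bsub>P\<^esub>}\<rparr>). f (h x) = g x"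
      by (intro bexI[of _ "\<lambda>_. \<zero>\<^bsub>M'\<^esub>"] mod_homI) auto
  qed
  show ?thesis
    unfolding has_projective_resolution_def
  proof (intro exI[of _ Q] exI[of _ "\<lambda>_ x. x"] exI[of _ \<epsilon>] conjI allI impI)
    fix i :: nat
    show "projective_module R (Q i)" using P K zero_proj by (simp add: Q_def K_def)
    show "carrier (Q i) = {\<zero>\<^bsub>Q i\<^esub>}" if "1 < i" using that by (simp add: Q_def)
    show "(\<lambda>x. x) \<in> mod_hom R (Q (Suc i)) (Q i)"
      using K0 by (intro mod_homI) (auto simp: Q_def)
    show "(\<lambda>x. x) ` carrier (Q (Suc (Suc i))) = a_kernel (Q (Suc i)) (Q i) (\<lambda>x. x)"
      using K0 by (cases i) (auto simp: Q Q_zero a_kernel_def')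
  next
    show "(\<lambda>x. x) ` carrier (Q (Suc 0)) = a_kernel (Q 0) M \<epsilon>"
      by (auto simp: Q a_kernel_def' K_def)
  qed (use \<epsilon> surj in \<open>auto simp: Q\<close>)
qed

text \<open>The kernel is generated as a submodule by the sequence \<open>k\<close>; this is expressed by saying that
  every submodule containing the sequence contains the kernel.\<close>

lemma countably_presented_flat_resolution:
  fixes R :: "('r, 's) ring_scheme" and M :: "('r, 'c, 'n) module_scheme" and Y :: "('c \<times> nat) set"
    and k :: "nat \<Rightarrow> 'c \<times> nat \<Rightarrow> 'r"
  assumes flat: "flat_left_module R M" and m: "m \<in> Y \<rightarrow> carrier M"
    and surj: "free_eval R M m ` carrier (free_mod R Y) = carrier M"
    and k: "\<And>n. k n \<in> carrier (free_mod R Y)" "\<And>n. free_eval R M m (k n) = \<zero>\<^bsub>M\<^esub>"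
    and gen: "\<And>L \<theta>. \<lbrakk>lsubmodule R (free_mod R Y) L; \<And>n. k n \<in> L; \<theta> \<in> carrier (free_mod R Y);
      free_eval R M m \<theta> = \<zero>\<^bsub>M\<^esub>\<rbrakk> \<Longrightarrow> \<theta> \<in> L"
  shows "has_projective_resolution R M 1"
proof -
  have M: "left_module R M" using flat by (simp add: flat_left_module_def)
  interpret M: left_module R M by fact
  have R: "ring R" by (rule M.R.ring_axioms)
  let ?F = "free_mod R Y" and ?\<epsilon> = "free_eval R M m"
  have F: "left_module R ?F" by (rule free_mod_left_module[OF R])
  interpret F: left_module R ?F by fact
  have \<epsilon>: "?\<epsilon> \<in> mod_hom R ?F M" by (rule M.free_eval_hom[OF m])
  have \<epsilon>0: "?\<epsilon> \<zero>\<^bsub>?F\<^esub> = \<zero>\<^bsub>M\<^esub>"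
    by (rule mod_hom_zero[OF F.M.abelian_group_axioms M.M.abelian_group_axioms \<epsilon>])
  define K where "K = {\<theta> \<in> carrier ?F. ?\<epsilon> \<theta> = \<zero>\<^bsub>M\<^esub>}"
  have K: "lsubmodule R ?F K"
    unfolding lsubmodule_def
  proof (intro conjI ballI)
    show "K \<subseteq> carrier ?F" by (auto simp: K_def)
    show "\<zero>\<^bsub>?F\<^esub> \<in> K" using \<epsilon>0 F.M.zero_closed by (simp only: K_def mem_Collect_eq)
    show "\<theta> \<oplus>\<^bsub>?F\<^esub> \<psi> \<in> K" if "\<theta> \<in> K" "\<psi> \<in> K" for \<theta> \<psi>
      using that mod_homD(2)[OF \<epsilon>, of \<theta> \<psi>] F.M.a_closed[of \<theta> \<psi>]
      by (simp add: K_def del: free_mod_simps)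
    show "a \<odot>\<^bsub>?F\<^esub> \<theta> \<in> K" if "a \<in> carrier R" "\<theta> \<in> K" for a \<theta>
      using that mod_homD(3)[OF \<epsilon>, of a \<theta>] F.lsmult_closed[of a \<theta>]
      by (simp add: K_def del: free_mod_simps)
  qed
  have "projective_module R (?F\<lparr>carrier := K\<rparr>)"
  proof (rule locally_split_projective[OF free_mod_projective[OF R] K])
    fix \<theta> assume "\<theta> \<in> K"
    then obtain \<beta> where \<beta>: "\<beta> \<in> mod_hom R ?F ?F" "\<And>\<psi>. \<psi> \<in> carrier ?F \<Longrightarrow> ?\<epsilon> (\<beta> \<psi>) = ?\<epsilon> \<psi>"
      "\<beta> \<theta> = \<zero>\<^bsub>?F\<^esub>"
      using flat_kernel_locally_split[OF flat m surj, of \<theta>] unfolding K_def by blast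
    have "\<psi> \<ominus>\<^bsub>?F\<^esub> \<beta> \<psi> \<in> K" if \<psi>: "\<psi> \<in> carrier ?F" for \<psi>
    proof -
      have b: "\<beta> \<psi> \<in> carrier ?F" by (rule mod_homD(1)[OF \<beta>(1) \<psi>])
      have n: "\<ominus>\<^bsub>?F\<^esub> \<beta> \<psi> \<in> carrier ?F" by (rule F.M.a_inv_closed[OF b])
      have "?\<epsilon> (\<psi> \<ominus>\<^bsub>?F\<^esub> \<beta> \<psi>) = ?\<epsilon> (\<beta> \<psi>) \<oplus>\<^bsub>M\<^esub> ?\<epsilon> (\<ominus>\<^bsub>?F\<^esub> \<beta> \<psi>)"
        unfolding a_minus_def mod_homD(2)[OF \<epsilon> \<psi> n] \<beta>(2)[OF \<psi>] ..
      also have "\<dots> = ?\<epsilon> (\<beta> \<psi> \<oplus>\<^bsub>?F\<^esub> \<ominus>\<^bsub>?F\<^esub> \<beta> \<psi>)" by (rule mod_homD(2)[OF \<epsilon> b n, symmetric])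
      also have "\<dots> = \<zero>\<^bsub>M\<^esub>" unfolding F.M.r_neg[OF b] by (rule \<epsilon>0)
      finally show ?thesis using F.M.minus_closed[OF \<psi> b] by (simp only: K_def mem_Collect_eq)
    qed
    then show "\<exists>\<beta>\<in>mod_hom R ?F ?F. (\<forall>\<psi>\<in>carrier ?F. \<psi> \<ominus>\<^bsub>?F\<^esub> \<beta> \<psi> \<in> K) \<and> \<beta> \<theta> = \<zero>\<^bsub>?F\<^esub>"
      using \<beta>(1,3) by blast
  next
    show "k n \<in> K" for n using k by (simp add: K_def)
    show "K \<subseteq> L" if "lsubmodule R ?F L" "\<And>n. k n \<in> L" for L
      using gen[OF that] by (auto simp: K_def)
  qed
  then show ?thesis
    unfolding K_def by (rule projective_resolution_length_one[OF M free_mod_projective[OF R] \<epsilon> surj])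
qed

section \<open>Countable presentation from a countable base\<close>

lemma (in left_module) ideal_span_lift:
  fixes Y :: "'p set"
  assumes m: "m \<in> Y \<rightarrow> carrier M" and surj: "free_eval R M m ` carrier (free_mod R Y) = carrier M"
    and I: "right_ideal R I" and x: "x \<in> ideal_span M I"
  shows "\<exists>\<sigma>\<in>carrier (free_mod R Y). (\<forall>p. \<sigma> p \<in> I) \<and> free_eval R M m \<sigma> = x"
proof -
  let ?F = "free_mod R Y" and ?\<epsilon> = "free_eval R M m"
  have F: "left_module R ?F" by (rule free_mod_left_module[OF R.ring_axioms])
  interpret F: left_module R ?F by fact
  interpret I: additive_subgroup I R by (rule right_idealD(1)[OF I])
  have \<epsilon>: "?\<epsilon> \<in> mod_hom R ?F M" by (rule free_eval_hom[OF m])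
  from R.right_ideal_subset[OF I] x show ?thesis
  proof (induction rule: ideal_span_induct)
    case (smult s y)
    then have s: "s \<in> carrier R" using R.right_ideal_subset[OF I] by blast
    obtain W where W: "W \<in> carrier ?F" "?\<epsilon> W = y" using surj smult(2) by (metis imageE)
    show ?case
    proof (intro bexI conjI allI)
      show "s \<odot>\<^bsub>?F\<^esub> W \<in> carrier ?F" by (rule F.lsmult_closed[OF s W(1)])
      show "(s \<odot>\<^bsub>?F\<^esub> W) p \<in> I" for p
        using right_idealD(2)[OF I smult(1) free_modD(1)[OF W(1)]] by simp
      show "?\<epsilon> (s \<odot>\<^bsub>?F\<^esub> W) = s \<odot>\<^bsub>M\<^esub> y" unfolding mod_homD(3)[OF \<epsilon> s W(1)] W(2) ..
    qed
  next
    case zero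
    show ?case
    proof (intro bexI conjI allI)
      show "\<zero>\<^bsub>?F\<^esub> \<in> carrier ?F" by (rule F.M.zero_closed)
      show "\<zero>\<^bsub>?F\<^esub> p \<in> I" for p by simp
      show "?\<epsilon> \<zero>\<^bsub>?F\<^esub> = \<zero>\<^bsub>M\<^esub>"
        by (rule mod_hom_zero[OF F.M.abelian_group_axioms M.abelian_group_axioms \<epsilon>])
    qed
  next
    case (neg y)
    then obtain \<sigma> where \<sigma>: "\<sigma> \<in> carrier ?F" "\<And>p. \<sigma> p \<in> I" "?\<epsilon> \<sigma> = y" by blast
    have one: "\<ominus>\<^bsub>R\<^esub> \<one>\<^bsub>R\<^esub> \<in> carrier R" by simp
    show ?case
    proof (intro bexI conjI allI)
      show "(\<ominus>\<^bsub>R\<^esub> \<one>\<^bsub>R\<^esub>) \<odot>\<^bsub>?F\<^esub> \<sigma> \<in> carrier ?F" by (rule F.lsmult_closed[OF one \<sigma>(1)])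
      show "((\<ominus>\<^bsub>R\<^esub> \<one>\<^bsub>R\<^esub>) \<odot>\<^bsub>?F\<^esub> \<sigma>) p \<in> I" for p
        using \<sigma>(2)[of p] free_modD(1)[OF \<sigma>(1), of p] by (simp add: R.l_minus)
      show "?\<epsilon> ((\<ominus>\<^bsub>R\<^esub> \<one>\<^bsub>R\<^esub>) \<odot>\<^bsub>?F\<^esub> \<sigma>) = \<ominus>\<^bsub>M\<^esub> y"
        unfolding mod_homD(3)[OF \<epsilon> one \<sigma>(1)] \<sigma>(3) using neg(1) by (simp add: lsmult_minus)
    qed
  next
    case (add y z)
    then obtain \<sigma> \<tau> where *: "\<sigma> \<in> carrier ?F" "\<And>p. \<sigma> p \<in> I" "?\<epsilon> \<sigma> = y"
      "\<tau> \<in> carrier ?F" "\<And>p. \<tau> p \<in> I" "?\<epsilon> \<tau> = z" by blast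
    show ?case
    proof (intro bexI conjI allI)
      show "\<sigma> \<oplus>\<^bsub>?F\<^esub> \<tau> \<in> carrier ?F" by (rule F.M.a_closed[OF *(1,4)])
      show "(\<sigma> \<oplus>\<^bsub>?F\<^esub> \<tau>) p \<in> I" for p using *(2,5) by simp
      show "?\<epsilon> (\<sigma> \<oplus>\<^bsub>?F\<^esub> \<tau>) = y \<oplus>\<^bsub>M\<^esub> z" unfolding mod_homD(2)[OF \<epsilon> *(1,4)] *(3,6) ..
    qed
  qed
qed

context flat_epimorphism begin

text \<open>Multiplying \<open>1 = \<Sum> u(\<sigma>\<^sub>p) fst p\<close> by \<open>x\<close> on the left gives \<open>x = \<Sum> x u(\<sigma>\<^sub>p) fst p\<close>, whose
  coefficients lie in \<open>u(R)\<close> and can be lifted to \<open>R\<close>.\<close>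

lemma denominator_expansion:
  fixes Y :: "('u \<times> nat) set"
  assumes Y: "fst \<in> Y \<rightarrow> carrier U" and x: "x \<in> carrier U"
    and \<sigma>: "\<sigma> \<in> carrier (free_mod R Y)" "free_eval R UM fst \<sigma> = \<one>\<^bsub>U\<^esub>" "\<And>p. \<sigma> p \<in> denominators x"
  shows "\<exists>\<tau>\<in>carrier (free_mod R Y). (\<forall>p. u (\<tau> p) = x \<otimes>\<^bsub>U\<^esub> u (\<sigma> p)) \<and> free_eval R UM fst \<tau> = x"
proof -
  have "\<exists>r\<in>carrier R. u r = x \<otimes>\<^bsub>U\<^esub> u (\<sigma> p)" for p
    using \<sigma>(3)[of p] by (auto simp: denominators_def)
  then obtain c where c: "\<And>p. c p \<in> carrier R" "\<And>p. u (c p) = x \<otimes>\<^bsub>U\<^esub> u (\<sigma> p)" by metis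
  let ?S = "{p. \<sigma> p \<noteq> \<zero>\<^bsub>R\<^esub>}"
  define \<tau> where "\<tau> p = (if \<sigma> p = \<zero>\<^bsub>R\<^esub> then \<zero>\<^bsub>R\<^esub> else c p)" for p
  have S: "finite ?S" "?S \<subseteq> Y" using free_modD[OF \<sigma>(1)] by auto
  have \<tau>_u: "u (\<tau> p) = x \<otimes>\<^bsub>U\<^esub> u (\<sigma> p)" for p using c(2) x by (simp add: \<tau>_def)
  have "finite {p. \<tau> p \<noteq> \<zero>\<^bsub>R\<^esub>}" by (rule finite_subset[OF _ S(1)]) (auto simp: \<tau>_def)
  then have \<tau>: "\<tau> \<in> carrier (free_mod R Y)"
    using c(1) S(2) by (auto simp: free_mod_def \<tau>_def)
  have mem: "fst p \<in> carrier U" "\<sigma> p \<in> carrier R" if "p \<in> ?S" for p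
    using that S(2) Y free_modD(1)[OF \<sigma>(1)] by auto
  have "free_eval R UM fst \<tau> = finsum UM (\<lambda>p. \<tau> p \<odot>\<^bsub>UM\<^esub> fst p) ?S"
    by (rule M.free_eval_superset[OF S(1) _ S(2) _ \<tau>]) (use Y in \<open>auto simp: \<tau>_def\<close>)
  also have "\<dots> = finsum UM (\<lambda>p. x \<otimes>\<^bsub>U\<^esub> (\<sigma> p \<odot>\<^bsub>UM\<^esub> fst p)) ?S"
    by (rule M.M.finsum_cong'[OF refl]) (use mem x in \<open>auto simp: \<tau>_u U.m_assoc\<close>)
  \<comment> \<open>Left multiplication by \<open>x\<close> is additive but need not be \<open>R\<close>-linear, hence the empty scalar set.\<close>
  also have "\<dots> = x \<otimes>\<^bsub>U\<^esub> free_eval R UM fst \<sigma>"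
    unfolding free_eval_def
    by (rule mod_hom_finsum[of UM UM _ "R\<lparr>carrier := {}\<rparr>", symmetric])
      (use mem x S(1) in \<open>auto intro!: mod_homI simp: U.r_distr M.M.abelian_group_axioms\<close>)
  finally have "free_eval R UM fst \<tau> = x" using x \<sigma>(2) by simp
  with \<tau> \<tau>_u show ?thesis by blast
qed

text \<open>In the notation of the introduction, \<open>\<sigma> J\<close> is the expression of \<open>1\<close> with coefficients in \<open>J\<close>,
  \<open>Y\<close> is the countable set of generators, \<open>T x J\<close> the expansion of \<open>x\<close> for
  \<open>J\<close> consisting of denominators of \<open>x\<close>, and \<open>S p J\<close> an expansion of the generator \<open>p\<close> with coefficients in \<open>J\<close>.\<close>

lemma countable_base_resolution:
  assumes B: "countable B" "topology_base (gabriel_topology R U u) B"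
  shows "has_projective_resolution R UM 1"
proof -
  have BG: "J \<in> gabriel_topology R U u" if "J \<in> B" for J using B(2) that by (auto simp: topology_base_def)
  have base: "\<exists>J\<in>B. J \<subseteq> I" if "I \<in> gabriel_topology R U u" for I
    using B(2) that by (auto simp: topology_base_def)
  have B_ideal: "right_ideal R J" "carrier U \<subseteq> ideal_span UM J" if "J \<in> B" for J
    using BG[OF that] by (auto simp: gabriel_topology_span)
  \<comment> \<open>The second component puts the free module on the carrier type of projective resolutions.\<close>
  define Y0 where "Y0 = carrier U \<times> (UNIV :: nat set)"
  have Y0: "fst \<in> Y0 \<rightarrow> carrier UM" by (auto simp: Y0_def)
  have surj0: "free_eval R UM fst ` carrier (free_mod R Y0) = carrier UM"
  proof
    show "free_eval R UM fst ` carrier (free_mod R Y0) \<subseteq> carrier UM"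
      using mod_homD(1)[OF M.free_eval_hom[OF Y0]] by auto
    show "carrier UM \<subseteq> free_eval R UM fst ` carrier (free_mod R Y0)"
    proof
      fix x assume "x \<in> carrier UM"
      then have "(x, 0) \<in> Y0" by (simp add: Y0_def)
      then show "x \<in> free_eval R UM fst ` carrier (free_mod R Y0)"
        using M.free_eval_free_basis[OF Y0] free_basis_closed[OF R.ring_axioms, of "(x, 0)" Y0]
        by (metis fst_conv imageI)
    qed
  qed
  have "\<exists>\<sigma>\<in>carrier (free_mod R Y0). (\<forall>p. \<sigma> p \<in> J) \<and> free_eval R UM fst \<sigma> = \<one>\<^bsub>U\<^esub>" if "J \<in> B" for J
    using M.ideal_span_lift[OF Y0 surj0 B_ideal(1)[OF that], of "\<one>\<^bsub>U\<^esub>"] B_ideal(2)[OF that] by auto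
  then obtain \<sigma> where \<sigma>0: "\<And>J. J \<in> B \<Longrightarrow> \<sigma> J \<in> carrier (free_mod R Y0)"
    and \<sigma>_J: "\<And>J p. J \<in> B \<Longrightarrow> \<sigma> J p \<in> J" and \<sigma>_one: "\<And>J. J \<in> B \<Longrightarrow> free_eval R UM fst (\<sigma> J) = \<one>\<^bsub>U\<^esub>"
    by metis
  define Y where "Y = (\<Union>J\<in>B. {p. \<sigma> J p \<noteq> \<zero>\<^bsub>R\<^esub>})"
  have "countable Y"
    unfolding Y_def by (rule countable_UN[OF B(1)]) (rule countable_finite[OF free_modD(3)[OF \<sigma>0]])
  have "Y \<subseteq> Y0" using free_modD(2)[OF \<sigma>0] by (auto simp: Y_def)
  then have YU: "fst \<in> Y \<rightarrow> carrier U" by (auto simp: Y0_def)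
  then have Y: "fst \<in> Y \<rightarrow> carrier UM" by simp
  let ?F = "free_mod R Y" and ?\<epsilon> = "free_eval R UM fst"
  have F: "left_module R ?F" by (rule free_mod_left_module[OF R.ring_axioms])
  interpret F: left_module R ?F by fact
  have \<epsilon>: "?\<epsilon> \<in> mod_hom R ?F UM" by (rule M.free_eval_hom[OF Y])
  have \<sigma>: "\<sigma> J \<in> carrier ?F" if "J \<in> B" for J
    using free_modD(1,3)[OF \<sigma>0[OF that]] that by (auto simp: free_mod_def Y_def)
  have e: "free_basis R p \<in> carrier ?F" if "p \<in> Y" for p
    by (rule free_basis_closed[OF R.ring_axioms that])
  have \<epsilon>_e: "?\<epsilon> (free_basis R p) = fst p" if "p \<in> Y" for p by (rule M.free_eval_free_basis[OF Y that])

  have expand: "\<exists>\<tau>\<in>carrier ?F. (\<forall>p. u (\<tau> p) = x \<otimes>\<^bsub>U\<^esub> u (\<sigma> J p)) \<and> ?\<epsilon> \<tau> = x"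
    if "x \<in> carrier U" "J \<in> B" "J \<subseteq> denominators x" for x J
    by (rule denominator_expansion[OF YU that(1) \<sigma>[OF that(2)] \<sigma>_one[OF that(2)]]) (use \<sigma>_J that in blast)
  define T where "T x J = (SOME \<tau>. \<tau> \<in> carrier ?F \<and> (\<forall>p. u (\<tau> p) = x \<otimes>\<^bsub>U\<^esub> u (\<sigma> J p)) \<and> ?\<epsilon> \<tau> = x)" for x J
  have T: "T x J \<in> carrier ?F" and T_u: "u (T x J p) = x \<otimes>\<^bsub>U\<^esub> u (\<sigma> J p)" and T_eval: "?\<epsilon> (T x J) = x"
    if "x \<in> carrier U" "J \<in> B" "J \<subseteq> denominators x" for x J p
    unfolding T_def using someI_ex[OF expand[OF that, unfolded Bex_def]] by (elim conjE; simp only:)+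
  have surj: "?\<epsilon> ` carrier ?F = carrier UM"
  proof
    show "?\<epsilon> ` carrier ?F \<subseteq> carrier UM" using mod_homD(1)[OF \<epsilon>] by auto
    show "carrier UM \<subseteq> ?\<epsilon> ` carrier ?F"
    proof
      fix x assume "x \<in> carrier UM"
      then have x: "x \<in> carrier U" by simp
      obtain J where J: "J \<in> B" "J \<subseteq> denominators x"
        using base[OF denominators_in_gabriel_topology[OF x]] by blast
      from T_eval[OF x J] T[OF x J] show "x \<in> ?\<epsilon> ` carrier ?F" by (metis imageI)
    qed
  qed
  have lift: "\<exists>\<sigma>\<in>carrier ?F. (\<forall>q. \<sigma> q \<in> J) \<and> ?\<epsilon> \<sigma> = fst p" if "p \<in> Y" "J \<in> B" for p J
    using M.ideal_span_lift[OF Y surj B_ideal(1)[OF that(2)], of "fst p"] B_ideal(2)[OF that(2)] YU that(1)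
    by auto
  define S where "S p J = (SOME \<sigma>. \<sigma> \<in> carrier ?F \<and> (\<forall>q. \<sigma> q \<in> J) \<and> ?\<epsilon> \<sigma> = fst p)" for p :: "'u \<times> nat" and J
  have S: "S p J \<in> carrier ?F" and S_J: "S p J q \<in> J" and S_eval: "?\<epsilon> (S p J) = fst p"
    if "p \<in> Y" "J \<in> B" for p J q
    unfolding S_def using someI_ex[OF lift[OF that, unfolded Bex_def]] by (elim conjE; simp only:)+
  define rels where "rels = {\<zero>\<^bsub>?F\<^esub>} \<union>
    {free_basis R p \<ominus>\<^bsub>?F\<^esub> T (fst p) J | p J. p \<in> Y \<and> J \<in> B \<and> J \<subseteq> denominators (fst p)} \<union>
    {free_basis R p \<ominus>\<^bsub>?F\<^esub> S p J | p J. p \<in> Y \<and> J \<in> B}"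
  have countable_pairs: "countable {f p J | p J. p \<in> Y \<and> J \<in> B \<and> Q p J}"
    for f :: "'u \<times> nat \<Rightarrow> 'r set \<Rightarrow> 'u \<times> nat \<Rightarrow> 'r" and Q
    by (rule countable_subset[of _ "(\<lambda>(p, J). f p J) ` (Y \<times> B)"])
      (use \<open>countable Y\<close> B(1) in auto)
  have "countable rels"
    unfolding rels_def
  proof (intro countable_Un)
    show "countable {free_basis R p \<ominus>\<^bsub>?F\<^esub> T (fst p) J | p J.
        p \<in> Y \<and> J \<in> B \<and> J \<subseteq> denominators (fst p)}"
      by (rule countable_pairs)
    show "countable {free_basis R p \<ominus>\<^bsub>?F\<^esub> S p J | p J. p \<in> Y \<and> J \<in> B}"
      using countable_pairs[of "\<lambda>p J. free_basis R p \<ominus>\<^bsub>?F\<^esub> S p J" "\<lambda>_ _. True"] by (simp only: simp_thms)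
  qed simp
  moreover have "rels \<noteq> {}" by (simp add: rels_def)
  ultimately have range_rels: "range (from_nat_into rels) = rels" by (intro range_from_nat_into)
  have \<epsilon>0: "?\<epsilon> \<zero>\<^bsub>?F\<^esub> = \<zero>\<^bsub>UM\<^esub>"
    by (rule mod_hom_zero[OF F.M.abelian_group_axioms M.M.abelian_group_axioms \<epsilon>])
  have diff: "a \<ominus>\<^bsub>?F\<^esub> b \<in> carrier ?F \<and> ?\<epsilon> (a \<ominus>\<^bsub>?F\<^esub> b) = \<zero>\<^bsub>UM\<^esub>"
    if ab: "a \<in> carrier ?F" "b \<in> carrier ?F" "?\<epsilon> a = ?\<epsilon> b" for a b
  proof
    show "a \<ominus>\<^bsub>?F\<^esub> b \<in> carrier ?F" by (rule F.M.minus_closed[OF ab(1,2)])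
    have n: "\<ominus>\<^bsub>?F\<^esub> b \<in> carrier ?F" by (rule F.M.a_inv_closed[OF ab(2)])
    have "?\<epsilon> (a \<ominus>\<^bsub>?F\<^esub> b) = ?\<epsilon> b \<oplus>\<^bsub>UM\<^esub> ?\<epsilon> (\<ominus>\<^bsub>?F\<^esub> b)"
      unfolding a_minus_def mod_homD(2)[OF \<epsilon> ab(1) n] ab(3) ..
    also have "\<dots> = ?\<epsilon> (b \<oplus>\<^bsub>?F\<^esub> \<ominus>\<^bsub>?F\<^esub> b)" by (rule mod_homD(2)[OF \<epsilon> ab(2) n, symmetric])
    finally show "?\<epsilon> (a \<ominus>\<^bsub>?F\<^esub> b) = \<zero>\<^bsub>UM\<^esub>" unfolding F.M.r_neg[OF ab(2)] \<epsilon>0 .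
  qed
  have fstU: "fst p \<in> carrier U" if "p \<in> Y" for p using YU that by auto
  have rels: "\<theta> \<in> carrier ?F \<and> ?\<epsilon> \<theta> = \<zero>\<^bsub>UM\<^esub>" if "\<theta> \<in> rels" for \<theta>
  proof -
    from that consider "\<theta> = \<zero>\<^bsub>?F\<^esub>"
      | p J where "p \<in> Y" "J \<in> B" "J \<subseteq> denominators (fst p)" "\<theta> = free_basis R p \<ominus>\<^bsub>?F\<^esub> T (fst p) J"
      | p J where "p \<in> Y" "J \<in> B" "\<theta> = free_basis R p \<ominus>\<^bsub>?F\<^esub> S p J"
      unfolding rels_def Un_iff mem_Collect_eq singleton_iff by blast
    then show ?thesis
    proof cases
      case 1
      then show ?thesis using \<epsilon>0 F.M.zero_closed by metis
    next
      case 2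
      then show ?thesis
        using diff[OF e[OF 2(1)] T[OF fstU[OF 2(1)] 2(2,3)]] \<epsilon>_e T_eval[OF fstU[OF 2(1)] 2(2,3)] by metis
    next
      case 3
      then show ?thesis using diff[OF e[OF 3(1)] S[OF 3(1,2)]] \<epsilon>_e S_eval by metis
    qed
  qed
  show ?thesis
  proof (rule countably_presented_flat_resolution[OF flat Y surj, of "from_nat_into rels"])
    have mem: "from_nat_into rels n \<in> rels" for n
      using rangeI[of "from_nat_into rels" n] unfolding range_rels .
    show "from_nat_into rels n \<in> carrier ?F" for n by (rule conjunct1[OF rels[OF mem]])
    show "?\<epsilon> (from_nat_into rels n) = \<zero>\<^bsub>UM\<^esub>" for n by (rule conjunct2[OF rels[OF mem]])
    fix L \<theta>
    assume L: "lsubmodule R ?F L" and enum: "\<And>n. from_nat_into rels n \<in> L"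
      and \<theta>: "\<theta> \<in> carrier ?F" and \<theta>0: "?\<epsilon> \<theta> = \<zero>\<^bsub>UM\<^esub>"
    have rels_L: "\<psi> \<in> L" if "\<psi> \<in> rels" for \<psi>
    proof -
      have "\<psi> \<in> range (from_nat_into rels)" unfolding range_rels by (rule that)
      then obtain n where "\<psi> = from_nat_into rels n" by (rule rangeE)
      then show ?thesis using enum[of n] by (simp only:)
    qed
    have LT: "free_basis R p \<ominus>\<^bsub>?F\<^esub> T (fst p) J \<in> L"
      if "p \<in> Y" "J \<in> B" "J \<subseteq> denominators (fst p)" for p J
      by (rule rels_L, unfold rels_def, rule UnI1, rule UnI2, rule CollectI, rule exI[of _ p], rule exI[of _ J])
        (use that in simp)
    have LS: "free_basis R p \<ominus>\<^bsub>?F\<^esub> S p J \<in> L" if "p \<in> Y" "J \<in> B" for p J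
      by (rule rels_L, unfold rels_def, rule UnI2, rule CollectI, rule exI[of _ p], rule exI[of _ J])
        (use that in simp)
    note L_smult = lsubmoduleD(2)[OF L]
    have cancel: "(a \<ominus>\<^bsub>?F\<^esub> b) \<oplus>\<^bsub>?F\<^esub> b = a" if "a \<in> carrier ?F" "b \<in> carrier ?F" for a b
      unfolding a_minus_def F.M.a_assoc[OF that(1) F.M.a_inv_closed[OF that(2)] that(2)]
        F.M.l_neg[OF that(2)] by (rule F.M.r_zero[OF that(1)])

    define E where "E = {p. \<theta> p \<noteq> \<zero>\<^bsub>R\<^esub>}"
    have E: "finite E" "E \<subseteq> Y" and \<theta>R: "\<And>p. \<theta> p \<in> carrier R"
      using free_modD[OF \<theta>] by (auto simp: E_def)
    have "finite (fst ` E)" "fst ` E \<subseteq> carrier U" using E fstU by auto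
    from base[OF common_denominators[OF this]]
    obtain J where J: "J \<in> B" "\<And>p. p \<in> E \<Longrightarrow> J \<subseteq> denominators (fst p)" by auto
    have TE: "T (fst p) J \<in> carrier ?F" if "p \<in> E" for p
      using T[OF fstU J(1) J(2)[OF that]] E(2) that by blast
    have eE: "free_basis R p \<in> carrier ?F" if "p \<in> E" for p using e E(2) that by blast
    have \<theta>T: "\<theta> p \<odot>\<^bsub>?F\<^esub> T (fst p) J \<in> carrier ?F" if "p \<in> E" for p
      by (rule F.lsmult_closed[OF \<theta>R TE[OF that]])
    have \<theta>e: "\<theta> p \<odot>\<^bsub>?F\<^esub> free_basis R p \<in> carrier ?F" if "p \<in> E" for p
      by (rule F.lsmult_closed[OF \<theta>R eE[OF that]])
    have eT: "free_basis R p \<ominus>\<^bsub>?F\<^esub> T (fst p) J \<in> carrier ?F" if "p \<in> E" for p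
      by (rule F.M.minus_closed[OF eE[OF that] TE[OF that]])
    have \<theta>eT: "\<theta> p \<odot>\<^bsub>?F\<^esub> (free_basis R p \<ominus>\<^bsub>?F\<^esub> T (fst p) J) \<in> carrier ?F" if "p \<in> E" for p
      by (rule F.lsmult_closed[OF \<theta>R eT[OF that]])
    \<comment> \<open>Modulo the first family of relations, \<open>\<theta>\<close> equals \<open>\<zeta>\<close>, whose coefficients lie in the kernel
      of \<open>u\<close>.\<close>
    define \<zeta> where "\<zeta> = finsum ?F (\<lambda>p. \<theta> p \<odot>\<^bsub>?F\<^esub> T (fst p) J) E"
    have \<zeta>: "\<zeta> \<in> carrier ?F"
      unfolding \<zeta>_def by (rule F.M.finsum_closed[OF Pi_I[OF \<theta>T]])
    define \<eta> where "\<eta> = finsum ?F (\<lambda>p. \<theta> p \<odot>\<^bsub>?F\<^esub> (free_basis R p \<ominus>\<^bsub>?F\<^esub> T (fst p) J)) E"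
    have \<eta>: "\<eta> \<in> L"
      unfolding \<eta>_def
    proof (rule F.finsum_in_lsubmodule[OF L E(1)])
      fix p assume p: "p \<in> E"
      then have "p \<in> Y" using E(2) by blast
      from L_smult[OF \<theta>R LT[OF this J(1) J(2)[OF p]]]
      show "\<theta> p \<odot>\<^bsub>?F\<^esub> (free_basis R p \<ominus>\<^bsub>?F\<^esub> T (fst p) J) \<in> L" .
    qed
    have "\<eta> \<oplus>\<^bsub>?F\<^esub> \<zeta> = finsum ?F (\<lambda>p. \<theta> p \<odot>\<^bsub>?F\<^esub> (free_basis R p \<ominus>\<^bsub>?F\<^esub> T (fst p) J) \<oplus>\<^bsub>?F\<^esub>
        \<theta> p \<odot>\<^bsub>?F\<^esub> T (fst p) J) E"
      unfolding \<eta>_def \<zeta>_def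
      by (rule F.M.finsum_addf[OF Pi_I[OF \<theta>eT] Pi_I[OF \<theta>T], symmetric])
    also have "\<dots> = finsum ?F (\<lambda>p. \<theta> p \<odot>\<^bsub>?F\<^esub> free_basis R p) E"
    proof (rule F.M.finsum_cong'[OF refl])
      show "(\<lambda>p. \<theta> p \<odot>\<^bsub>?F\<^esub> free_basis R p) \<in> E \<rightarrow> carrier ?F"
        by (rule Pi_I[OF \<theta>e])
      fix p assume p: "p \<in> E"
      show "\<theta> p \<odot>\<^bsub>?F\<^esub> (free_basis R p \<ominus>\<^bsub>?F\<^esub> T (fst p) J) \<oplus>\<^bsub>?F\<^esub> \<theta> p \<odot>\<^bsub>?F\<^esub> T (fst p) J =
          \<theta> p \<odot>\<^bsub>?F\<^esub> free_basis R p"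
        unfolding F.lsmult_r_distr[OF \<theta>R eT[OF p] TE[OF p], symmetric]
          cancel[OF eE[OF p] TE[OF p]] ..
    qed
    also have "\<dots> = \<theta>" using free_eval_self[OF R.ring_axioms \<theta>] unfolding free_eval_def E_def .
    finally have \<theta>_eq: "\<eta> \<oplus>\<^bsub>?F\<^esub> \<zeta> = \<theta>" .

    have \<zeta>_ker: "u (\<zeta> q) = \<zero>\<^bsub>U\<^esub>" for q
    proof -
      have coeff: "(\<lambda>\<psi>. u (\<psi> q)) \<in> mod_hom R ?F UM"
        by (rule mod_homI) (simp_all add: free_modD(1)[where Y = Y])
      have w: "u (\<sigma> J q) \<in> carrier U" using free_modD(1)[OF \<sigma>[OF J(1)]] by simp
      have mult: "(\<lambda>x. x \<otimes>\<^bsub>U\<^esub> u (\<sigma> J q)) \<in> mod_hom R UM UM"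
        using w by (intro mod_homI) (auto simp: U.l_distr U.m_assoc)
      have "u (\<zeta> q) = finsum UM (\<lambda>p. u ((\<theta> p \<odot>\<^bsub>?F\<^esub> T (fst p) J) q)) E"
        unfolding \<zeta>_def
        by (rule mod_hom_finsum[OF F.M.abelian_group_axioms M.M.abelian_group_axioms coeff E(1) Pi_I[OF \<theta>T]])
      also have "\<dots> = finsum UM (\<lambda>p. \<theta> p \<odot>\<^bsub>UM\<^esub> fst p \<otimes>\<^bsub>U\<^esub> u (\<sigma> J q)) E"
      proof (rule M.M.finsum_cong'[OF refl])
        have fstE: "fst p \<in> carrier U" if "p \<in> E" for p using fstU E(2) that by blast
        show "(\<lambda>p. \<theta> p \<odot>\<^bsub>UM\<^esub> fst p \<otimes>\<^bsub>U\<^esub> u (\<sigma> J q)) \<in> E \<rightarrow> carrier UM"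
          using fstE w \<theta>R by auto
        fix p assume p: "p \<in> E"
        show "u ((\<theta> p \<odot>\<^bsub>?F\<^esub> T (fst p) J) q) = \<theta> p \<odot>\<^bsub>UM\<^esub> fst p \<otimes>\<^bsub>U\<^esub> u (\<sigma> J q)"
          using T_u[OF fstE[OF p] J(1) J(2)[OF p]] free_modD(1)[OF TE[OF p]] \<theta>R fstE[OF p] w
          by (simp add: U.m_assoc)
      qed
      also have "\<dots> = ?\<epsilon> \<theta> \<otimes>\<^bsub>U\<^esub> u (\<sigma> J q)"
        unfolding free_eval_def E_def[symmetric]
        by (rule mod_hom_finsum[OF M.M.abelian_group_axioms M.M.abelian_group_axioms mult E(1), symmetric])
          (use fstU E(2) \<theta>R in auto)
      also have "\<dots> = \<zero>\<^bsub>U\<^esub>" using w by (simp add: \<theta>0)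
      finally show ?thesis .
    qed
    have \<zeta>_summand: "\<zeta> p \<odot>\<^bsub>?F\<^esub> free_basis R p \<in> L" if p: "p \<in> Y" for p
    proof -
      have z: "\<zeta> p \<in> carrier R" by (rule free_modD(1)[OF \<zeta>])
      obtain J' where J': "J' \<in> B" "J' \<subseteq> {b \<in> carrier R. \<zeta> p \<otimes>\<^bsub>R\<^esub> b = \<zero>\<^bsub>R\<^esub>}"
        using base[OF annihilator_in_gabriel_topology[OF z \<zeta>_ker]] by blast
      \<comment> \<open>The second family of relations rewrites the generator \<open>p\<close> with coefficients in \<open>J'\<close>, which
        the coefficient \<open>\<zeta> p\<close> annihilates.\<close>
      have kill: "\<zeta> p \<odot>\<^bsub>?F\<^esub> S p J' = \<zero>\<^bsub>?F\<^esub>"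
        using subsetD[OF J'(2) S_J[OF p J'(1)]] by (intro ext) simp
      have "\<zeta> p \<odot>\<^bsub>?F\<^esub> free_basis R p =
          \<zeta> p \<odot>\<^bsub>?F\<^esub> ((free_basis R p \<ominus>\<^bsub>?F\<^esub> S p J') \<oplus>\<^bsub>?F\<^esub> S p J')"
        unfolding cancel[OF e[OF p] S[OF p J'(1)]] ..
      also have "\<dots> = \<zeta> p \<odot>\<^bsub>?F\<^esub> (free_basis R p \<ominus>\<^bsub>?F\<^esub> S p J')"
        unfolding F.lsmult_r_distr[OF z F.M.minus_closed[OF e[OF p] S[OF p J'(1)]] S[OF p J'(1)]] kill
        by (rule F.M.r_zero[OF F.lsmult_closed[OF z F.M.minus_closed[OF e[OF p] S[OF p J'(1)]]]])
      also have "\<dots> \<in> L" by (rule L_smult[OF z LS[OF p J'(1)]])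
      finally show ?thesis .
    qed
    have "finsum ?F (\<lambda>p. \<zeta> p \<odot>\<^bsub>?F\<^esub> free_basis R p) {p. \<zeta> p \<noteq> \<zero>\<^bsub>R\<^esub>} \<in> L"
    proof (rule F.finsum_in_lsubmodule[OF L free_modD(3)[OF \<zeta>]])
      fix p assume "p \<in> {p. \<zeta> p \<noteq> \<zero>\<^bsub>R\<^esub>}"
      then have "p \<in> Y" using free_modD(2)[OF \<zeta>, of p] by blast
      then show "\<zeta> p \<odot>\<^bsub>?F\<^esub> free_basis R p \<in> L" by (rule \<zeta>_summand)
    qed
    then have "\<zeta> \<in> L" using free_eval_self[OF R.ring_axioms \<zeta>] unfolding free_eval_def by (simp only:)
    then have "\<eta> \<oplus>\<^bsub>?F\<^esub> \<zeta> \<in> L" using \<eta> by (intro lsubmoduleD(1)[OF L])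
    then show "\<theta> \<in> L" unfolding \<theta>_eq .
  qed
qed

end

theorem theorem8p5:
  fixes R :: "('r, 's) ring_scheme" and U :: "('u, 't) ring_scheme" and u :: "'r \<Rightarrow> 'u"
  assumes "ring_epimorphism R U u"
    and "flat_left_module R (restrict_scalars U u)"
    and "\<exists>B. countable B \<and> topology_base (gabriel_topology R U u) B"
  shows "projective_dimension R (restrict_scalars U u) \<le> 1"
proof -
  interpret flat_epimorphism R U u by unfold_locales (fact assms)+
  obtain B where "countable B" "topology_base (gabriel_topology R U u) B" using assms(3) by blast
  then have "has_projective_resolution R (restrict_scalars U u) 1" by (rule countable_base_resolution)
  then have "projective_dimension R (restrict_scalars U u) \<le> enat 1"
    unfolding projective_dimension_def by (intro INF_lower) simp
  then show ?thesis by (simp add: one_enat_def)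
qed

end
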